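(* Let $v=Q'$, where $Q$ is a complex-valued ($\pi$-periodic) function of bounded variation on $[0,\pi]$, and let $bc\in\{Per^+,Per^-,Dir\}$. Then $$\|(S_N-S_N^0)f\|_\infty\to0\quad\text{as } N\to\infty\qquad\text{for every } f\in L^1([0,\pi]).$$
   Context: Potentials are $\pi$-periodic distributions $v=Q'$ with $Q\in L^2_{loc}(\mathbb{R})$, $Q(x+\pi)=Q(x)$. For a function $y$ on $[0,\pi]$ put $y^{[1]}=y'-Qy$ and $\ell(y)=-(y^{[1]})'-Qy'$ (formally $-y''+vy$). Boundary conditions: $Per^{\pm}$: $y(\pi)=\pm y(0)$, $y^{[1]}(\pi)=\pm y^{[1]}(0)$; $Dir$: $y(0)=y(\pi)=0$. $L=L_{bc}(v)$ is the closed operator in $L^2([0,\pi])$ with domain $\{y\in H^1([0,\pi]):\ y^{[1]}\in W^1_1([0,\pi]),\ bc\text{ holds},\ \ell(y)\in L^2([0,\pi])\}$ and $Ly=\ell(y)$. $L^0=L_{bc}(0)$ is the free operator $-d^2/dx^2$ with the same boundary conditions. Their spectra are discrete. Let $R_\lambda=(\lambda-L)^{-1}$, $R^0_\lambda=(\lambda-L^0)^{-1}$. For $\omega,h>0$ let $\Pi_N=\{x+iy:\ -\omega\le x\le N^2+N,\ |y|\le h\}$ and $$S_N=\frac1{2\pi i}\int_{\partial\Pi_N}R_\lambda\,d\lambda,\qquad S_N^0=\frac1{2\pi i}\int_{\partial\Pi_N}R^0_\lambda\,d\lambda,$$ where $\omega,h$ are taken large enough that the interior of $\Pi_N$ contains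 all eigenvalues of $L$ and $L^0$ with real part at most $N^2+N$, and $N$ is large enough that no eigenvalue lies on the line $\mathrm{Re}\,\lambda=N^2+N$ ($S_N$, $S_N^0$ do not depend on the choice of such $\omega,h$). Operators defined on $L^2$ are applied to $f\in L^1$ by extension by continuity from the dense subspace $L^2$. *)

theory Defs
  imports "HOL-Probability.Essential_Supremum"
begin

section \<open>Function spaces on the interval from 0 to pi\<close>

abbreviation leb :: "real measure"
  where "leb \<equiv> lebesgue_on {0..pi}"

definition bounded_variation_on :: "real \<Rightarrow> real \<Rightarrow> (real \<Rightarrow> complex) \<Rightarrow> bool"
  where "bounded_variation_on a b f \<longleftrightarrow>
    (\<exists>B. \<forall>n t. (\<forall>i\<le>n. t i \<in> {a..b}) \<longrightarrow> (\<forall>i<n. t i \<le> t (Suc i)) \<longrightarrow>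
       (\<Sum>i<n. norm (f (t (Suc i)) - f (t i))) \<le> B)"

definition L1 :: "(real \<Rightarrow> complex) set"
  where "L1 = {f. integrable leb f}"

definition L2 :: "(real \<Rightarrow> complex) set"
  where "L2 = {f. f \<in> borel_measurable leb \<and> integrable leb (\<lambda>x. (norm (f x))\<^sup>2)}"

definition L1_norm :: "(real \<Rightarrow> complex) \<Rightarrow> ennreal"
  where "L1_norm f = (\<integral>\<^sup>+x. ennreal (norm (f x)) \<partial>leb)"

definition L2_norm :: "(real \<Rightarrow> complex) \<Rightarrow> real"
  where "L2_norm f = sqrt (\<integral>x. (norm (f x))\<^sup>2 \<partial>leb)"

definition Linf_norm :: "(real \<Rightarrow> complex) \<Rightarrow> ennreal"
  where "Linf_norm f = esssup leb (\<lambda>x. ennreal (norm (f x)))"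

text \<open>
  Elements of the Lebesgue spaces are represented by functions, with equality almost everywhere
  where classes are meant. An element of a Sobolev space is represented by its absolutely
  continuous representative \<open>y\<close>, the indefinite integral of its weak derivative \<open>g\<close>; values of
  \<open>y\<close> at the endpoints are therefore meaningful. Then \<open>y\<close> belongs to $W^1_1$, and to $H^1$ if
  moreover \<open>g \<in> L2\<close>.
\<close>

definition has_weak_derivative :: "(real \<Rightarrow> complex) \<Rightarrow> (real \<Rightarrow> complex) \<Rightarrow> bool"
  where "has_weak_derivative y g \<longleftrightarrow>
    g \<in> L1 \<and> (\<forall>x\<in>{0..pi}. y x = y 0 + (\<integral>t. g t \<partial>lebesgue_on {0..x}))"


section \<open>The operators and their resolvents\<close>

datatype bc = Per_plus | Per_minus | Dir

text \<open>Here \<open>u\<close> stands for the quasi-derivative $y^{[1]}$.\<close>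

fun satisfies_bc :: "bc \<Rightarrow> (real \<Rightarrow> complex) \<Rightarrow> (real \<Rightarrow> complex) \<Rightarrow> bool"
  where
    "satisfies_bc Per_plus y u \<longleftrightarrow> y pi = y 0 \<and> u pi = u 0"
  | "satisfies_bc Per_minus y u \<longleftrightarrow> y pi = - y 0 \<and> u pi = - u 0"
  | "satisfies_bc Dir y u \<longleftrightarrow> y 0 = 0 \<and> y pi = 0"

text \<open>
  The graph of $L_{bc}(Q')$: \<open>hill_op bc Q y w\<close> means that \<open>y\<close> lies in the domain and
  $L y = w$. The function \<open>u\<close> is the absolutely continuous representative of
  $y^{[1]} = y' - Q y$, and $w = -(y^{[1]})' - Q y'$.
\<close>

definition hill_op :: "bc \<Rightarrow> (real \<Rightarrow> complex) \<Rightarrow> (real \<Rightarrow> complex) \<Rightarrow> (real \<Rightarrow> complex) \<Rightarrow> bool"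
  where "hill_op bc Q y w \<longleftrightarrow>
    (\<exists>y' u u'.
       has_weak_derivative y y' \<and> y' \<in> L2 \<and>
       has_weak_derivative u u' \<and> (AE x in leb. u x = y' x - Q x * y x) \<and>
       satisfies_bc bc y u \<and>
       w \<in> L2 \<and> (AE x in leb. w x = - u' x - Q x * y' x))"

definition eigenvalue :: "bc \<Rightarrow> (real \<Rightarrow> complex) \<Rightarrow> complex \<Rightarrow> bool"
  where "eigenvalue bc Q z \<longleftrightarrow>
    (\<exists>y w. hill_op bc Q y w \<and> (AE x in leb. w x = z * y x) \<and> \<not> (AE x in leb. y x = 0))"

text \<open>
  $(z - L)^{-1}$. For \<open>f \<in> L2\<close> and \<open>z\<close> outside the spectrum the chosen \<open>y\<close> exists and is
  unique on the interval.
\<close>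

definition resolvent :: "bc \<Rightarrow> (real \<Rightarrow> complex) \<Rightarrow> complex \<Rightarrow> (real \<Rightarrow> complex) \<Rightarrow> (real \<Rightarrow> complex)"
  where "resolvent bc Q z f =
    (SOME y. \<exists>w. hill_op bc Q y w \<and> (AE x in leb. z * y x - w x = f x))"


section \<open>Contour integrals of operator-valued functions\<close>

text \<open>
  The counterpart of \<open>has_contour_integral\<close> for functions with values in the bounded operators
  on $L^2$: this is \<open>has_integral\<close> over the unit interval of \<open>F (\<gamma> t)\<close> times the derivative of
  \<open>\<gamma>\<close>, with convergence of the Riemann sums to \<open>T\<close> in the operator norm.
\<close>

definition has_op_contour_integral ::
    "(complex \<Rightarrow> (real \<Rightarrow> complex) \<Rightarrow> (real \<Rightarrow> complex)) \<Rightarrow>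
     ((real \<Rightarrow> complex) \<Rightarrow> (real \<Rightarrow> complex)) \<Rightarrow> (real \<Rightarrow> complex) \<Rightarrow> bool"
  where "has_op_contour_integral F T \<gamma> \<longleftrightarrow>
    (\<forall>f\<in>L2. T f \<in> L2) \<and>
    (\<forall>\<epsilon>>0. \<forall>\<^sub>F p in division_filter {0..1}. \<forall>f\<in>L2.
       let D = (\<lambda>x. (\<Sum>(t, k)\<in>p. measure lborel k *\<^sub>R
                 (vector_derivative \<gamma> (at t within {0..1}) * F (\<gamma> t) f x)) - T f x)
       in D \<in> L2 \<and> L2_norm D \<le> \<epsilon> * L2_norm f)"

text \<open>On \<open>L2\<close> the chosen operator is determined up to equality almost everywhere.\<close>

definition op_contour_integral ::
    "(real \<Rightarrow> complex) \<Rightarrow> (complex \<Rightarrow> (real \<Rightarrow> complex) \<Rightarrow> (real \<Rightarrow> complex)) \<Rightarrow>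
     (real \<Rightarrow> complex) \<Rightarrow> (real \<Rightarrow> complex)"
  where "op_contour_integral \<gamma> F = (SOME T. has_op_contour_integral F T \<gamma>)"


section \<open>Spectral partial sums\<close>

definition rect :: "nat \<Rightarrow> real \<Rightarrow> real \<Rightarrow> complex set"
  where "rect N \<omega> h = {z. - \<omega> \<le> Re z \<and> Re z \<le> (real N)\<^sup>2 + real N \<and> \<bar>Im z\<bar> \<le> h}"

text \<open>
  The free operator is the case \<open>Q = 0\<close>. Every point of the rectangle's interior has real part
  less than $N^2 + N$, so the last conjunct also excludes eigenvalues on the line
  $\mathrm{Re}\,z = N^2 + N$.
\<close>

definition admissible :: "bc \<Rightarrow> (real \<Rightarrow> complex) \<Rightarrow> nat \<Rightarrow> real \<Rightarrow> real \<Rightarrow> bool"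
  where "admissible bc Q N \<omega> h \<longleftrightarrow> \<omega> > 0 \<and> h > 0 \<and>
    (\<forall>z. (eigenvalue bc Q z \<or> eigenvalue bc (\<lambda>_. 0) z) \<and> Re z \<le> (real N)\<^sup>2 + real N
       \<longrightarrow> z \<in> interior (rect N \<omega> h))"

text \<open>The path \<open>rectpath\<close> traverses the boundary of \<open>rect N \<omega> h\<close> counterclockwise.\<close>

definition spectral_sum ::
    "bc \<Rightarrow> (real \<Rightarrow> complex) \<Rightarrow> nat \<Rightarrow> real \<Rightarrow> real \<Rightarrow> (real \<Rightarrow> complex) \<Rightarrow> (real \<Rightarrow> complex)"
  where "spectral_sum bc Q N \<omega> h f = (\<lambda>x. 1 / (2 * pi * \<i>) *
    op_contour_integral (rectpath (Complex (- \<omega>) (- h)) (Complex ((real N)\<^sup>2 + real N) h))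
      (resolvent bc Q) f x)"

text \<open>
  The extension by continuity to \<open>L1\<close> of an operator \<open>T\<close> on \<open>L2\<close> that is bounded from the
  $L^1$-norm to the $L^\infty$-norm. As \<open>L2\<close> is dense in \<open>L1\<close>, the chosen \<open>g\<close> is determined up to
  equality almost everywhere.
\<close>

definition L1_extension ::
    "((real \<Rightarrow> complex) \<Rightarrow> (real \<Rightarrow> complex)) \<Rightarrow> (real \<Rightarrow> complex) \<Rightarrow> (real \<Rightarrow> complex)"
  where "L1_extension T f = (SOME g. \<forall>\<phi>. (\<forall>k. \<phi> k \<in> L2) \<longrightarrow>
    (\<lambda>k::nat. L1_norm (\<lambda>x. \<phi> k x - f x)) \<longlonglongrightarrow> 0 \<longrightarrow>
    (\<lambda>k. Linf_norm (\<lambda>x. T (\<phi> k) x - g x)) \<longlonglongrightarrow> 0)"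

end

theory Submission
  imports Defs "HOL-Complex_Analysis.Complex_Analysis" "HOL-Probability.Discrete_Topology"
begin

text \<open>
  Since \<open>Q\<close> has bounded variation, its derivative is a measure, and integrating the Green function
  $G$ of the free operator against the equation gives $y(x) = \int G f - \int Q\,(G y)'$, where the
  last term is at most $K \sup|G| \sup|y|$. On the part of the half-plane
  $\mathrm{Re}\,z \le N^2+N$ outside the disc $|z| < N^2+N$ one has $|G| \le 4/|z|^{1/2}$, so for
  large \<open>N\<close> there are no eigenvalues there, and
  $\|(R_z - R^0_z) f\|_\infty \le 8 K |z|^{-1/2} \|R^0_z f\|_\infty$. This allows the rectangle to be
  replaced by the circle $|z| = N^2+N$, whose length $2\pi|z|$ is compensated exactly by
  $\|R^0_z f\|_\infty = o(|z|^{-1/2})$, a Riemann--Lebesgue property.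

  The resolvent exists off the eigenvalues by the Fredholm alternative for the first-order system
  with bounded coefficients, and depends holomorphically on $z$ by the resolvent identity.
\<close>

text \<open>The radius \<open>N^2 + N\<close> is \<open>(N + 1/2)^2 - 1/4\<close>, while the free
  eigenvalues are squares of integers: a square root \<open>\<mu>\<close> of a point of the outer
  region lies either well off the real axis or close to a half-integer, and there
  \<open>1 - exp (2 * \<i> * \<mu> * pi)\<close> stays away from 0. The crude bound of the free
  resolvent, of order \<open>|z|^(-1/2)\<close>, would make the integral over the circle merely
  bounded in \<open>N\<close>; only the little-o turns boundedness into convergence, and it comes
  from density, not from a rate. The sides of the rectangle have no controlled length, since
  \<open>\<omega>\<close> and \<open>h\<close> are arbitrary, whereas the circle depends on
  \<open>N\<close> alone. Pairing the measure with the product \<open>G y\<close> as a whole keeps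
  derivatives of \<open>G\<close> and \<open>y\<close> out of the perturbation bound. A further
  obstacle is that resolvent, operator integral and extension are choices, the last two determined
  only almost everywhere: each is replaced by a function determined at every point \<open>x\<close>
  of the interval, so that ordinary scalar contour integrals can be moved.\<close>

section \<open>Absolutely continuous functions\<close>

lemma integrable_lebesgue_on_iff:
  fixes f :: "real \<Rightarrow> complex"
  shows "integrable (lebesgue_on {a..b}) f \<longleftrightarrow> f absolutely_integrable_on {a..b}"
  by (simp add: set_integrable_def integrable_restrict_space)

text \<open>Intermediate values of \<open>\<gamma>\<close> equally spaced between
  \<open>\<gamma> a\<close> and \<open>\<gamma> b\<close> give \<open>n\<close> increments of
  \<open>H\<close>, each at most \<open>(\<Gamma> / n)\<^sup>2\<close>, so their sum is at most
  \<open>\<Gamma>\<^sup>2 / n\<close> and tends to 0. The points need not be ordered, since the sum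
  telescopes anyway; this is why the increment bound is demanded for all pairs.\<close>

lemma quadratic_increments_imp_const:
  fixes H :: "real \<Rightarrow> 'a::real_normed_vector" and \<gamma> :: "real \<Rightarrow> real"
  assumes "a \<le> b" and cont: "continuous_on {a..b} \<gamma>"
    and le: "\<And>c d. c \<in> {a..b} \<Longrightarrow> d \<in> {a..b} \<Longrightarrow> norm (H d - H c) \<le> (\<gamma> d - \<gamma> c)\<^sup>2"
    and "\<gamma> a \<le> \<gamma> b"
  shows "H b = H a"
proof -
  define \<Gamma> where "\<Gamma> = \<gamma> b - \<gamma> a"
  have bound: "norm (H b - H a) \<le> \<Gamma>\<^sup>2 / real n" if "n > 0" for n
  proof -
    have "\<exists>t\<in>{a..b}. \<gamma> t = \<gamma> a + real i * (\<Gamma> / real n)" if "i \<le> n" for i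
    proof -
      have "0 \<le> real i / real n" "real i / real n \<le> 1" "\<Gamma> \<ge> 0"
        using that \<open>n > 0\<close> assms by (auto simp: \<Gamma>_def)
      then have "real i / real n * \<Gamma> \<le> \<Gamma>" "0 \<le> real i / real n * \<Gamma>"
        by (metis mult_left_le_one_le mult_nonneg_nonneg)+
      then have "\<gamma> a \<le> \<gamma> a + real i * (\<Gamma> / real n)" "\<gamma> a + real i * (\<Gamma> / real n) \<le> \<gamma> b"
        by (auto simp: \<Gamma>_def)
      then show ?thesis
        using IVT'[of \<gamma> a "\<gamma> a + real i * (\<Gamma> / real n)" b] cont \<open>a \<le> b\<close>
        by (meson atLeastAtMost_iff)
    qed
    then obtain t where t: "\<And>i. i \<le> n \<Longrightarrow> t i \<in> {a..b}"
        "\<And>i. i \<le> n \<Longrightarrow> \<gamma> (t i) = \<gamma> a + real i * (\<Gamma> / real n)"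
      by metis
    \<comment> \<open>\<open>t 0\<close> and \<open>t n\<close> need not be the end points, but
      \<open>\<gamma>\<close> agrees there, and the increment bound then forces equal values of
      \<open>H\<close>.\<close>
    have "H (t 0) = H a" "H (t n) = H b"
      using le[of a "t 0"] le[of b "t n"] t[of 0] t[of n] \<open>n > 0\<close> \<open>a \<le> b\<close> by (auto simp: \<Gamma>_def)
    then have "H b - H a = (\<Sum>i<n. H (t (Suc i)) - H (t i))"
      using sum_lessThan_telescope[of "\<lambda>i. H (t i)" n] by simp
    also have "norm \<dots> \<le> (\<Sum>i<n. (\<Gamma> / real n)\<^sup>2)"
    proof (rule sum_norm_le)
      fix i assume i: "i \<in> {..<n}"
      have "norm (H (t (Suc i)) - H (t i)) \<le> (\<gamma> (t (Suc i)) - \<gamma> (t i))\<^sup>2"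
        using i by (intro le t) auto
      also have "\<gamma> (t (Suc i)) - \<gamma> (t i) = \<Gamma> / real n"
        using i t(2)[of i] t(2)[of "Suc i"] by (simp add: algebra_simps add_divide_distrib)
      finally show "norm (H (t (Suc i)) - H (t i)) \<le> (\<Gamma> / real n)\<^sup>2" .
    qed
    also have "\<dots> = \<Gamma>\<^sup>2 / real n"
      using \<open>n > 0\<close> by (simp add: power2_eq_square)
    finally show ?thesis .
  qed
  have "(\<lambda>n. \<Gamma>\<^sup>2 / real n) \<longlonglongrightarrow> 0"
    by (rule lim_const_over_n)
  then have "norm (H b - H a) \<le> 0"
    by (rule Lim_bounded2[where N=1]) (use bound in auto)
  then show ?thesis by simp
qed

text \<open>Absolute continuity, with the Lebesgue derivative carried along as a witness.\<close>

definition ac_on :: "real \<Rightarrow> real \<Rightarrow> (real \<Rightarrow> complex) \<Rightarrow> (real \<Rightarrow> complex) \<Rightarrow> bool"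
  where "ac_on a b F f \<longleftrightarrow> f absolutely_integrable_on {a..b} \<and>
    (\<forall>x\<in>{a..b}. F x = F a + integral {a..x} f)"

lemma ac_onD: "ac_on a b F f \<Longrightarrow> x \<in> {a..b} \<Longrightarrow> F x = F a + integral {a..x} f"
  by (simp only: ac_on_def)

lemma ac_on_integrable: "ac_on a b F f \<Longrightarrow> f absolutely_integrable_on {a..b}"
  by (simp only: ac_on_def)

lemma has_weak_derivative_iff: "has_weak_derivative y g \<longleftrightarrow> ac_on 0 pi y g"
proof -
  have "integral\<^sup>L (lebesgue_on {0..x}) g = integral {0..x} g"
    if "g absolutely_integrable_on {0..pi}" "x \<in> {0..pi}" for x
  proof -
    have "g absolutely_integrable_on {0..x}"
      by (rule absolutely_integrable_on_subinterval[OF that(1)]) (use that in auto)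
    then show ?thesis
      by (intro lebesgue_integral_eq_integral) (auto simp: integrable_lebesgue_on_iff)
  qed
  then show ?thesis
    unfolding has_weak_derivative_def ac_on_def L1_def integrable_lebesgue_on_iff mem_Collect_eq
    by (intro conj_cong ball_cong refl) simp
qed

lemma ac_on_diff:
  assumes "ac_on a b F f" "c \<in> {a..b}" "d \<in> {a..b}" "c \<le> d"
  shows "F d - F c = integral {c..d} f"
proof -
  have "f integrable_on {a..b}"
    using ac_on_integrable[OF assms(1)] by (rule set_lebesgue_integral_eq_integral)
  then have "f integrable_on {a..d}"
    by (rule integrable_subinterval_real) (use assms in auto)
  then have "integral {a..d} f = integral {a..c} f + integral {c..d} f"
    using assms by (intro Henstock_Kurzweil_Integration.integral_combine[symmetric]) auto
  moreover have "F d = F a + integral {a..d} f" "F c = F a + integral {a..c} f"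
    using assms by (auto intro: ac_onD)
  ultimately show ?thesis by simp
qed

lemma ac_on_subinterval:
  assumes "ac_on a b F f" "a \<le> c" "c \<le> d" "d \<le> b"
  shows "ac_on c d F f"
  unfolding ac_on_def
proof (intro conjI ballI)
  show "f absolutely_integrable_on {c..d}"
    by (rule absolutely_integrable_on_subinterval[OF ac_on_integrable[OF assms(1)]]) (use assms in auto)
  show "F x = F c + integral {c..x} f" if "x \<in> {c..d}" for x
    using ac_on_diff[OF assms(1), of c x] that assms by (auto simp: algebra_simps)
qed

lemma ac_on_continuous:
  assumes "ac_on a b F f"
  shows "continuous_on {a..b} F"
proof -
  have "f integrable_on {a..b}"
    using ac_on_integrable[OF assms] by (rule set_lebesgue_integral_eq_integral)
  then have "continuous_on {a..b} (\<lambda>x. F a + integral {a..x} f)"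
    by (intro continuous_intros indefinite_integral_continuous_1)
  then show ?thesis
    by (rule continuous_on_eq) (rule ac_onD[OF assms, symmetric])
qed

lemma absolutely_integrable_bounded_mult:
  fixes h f :: "real \<Rightarrow> complex"
  assumes "h \<in> borel_measurable (lebesgue_on {a..b})" "\<And>x. x \<in> {a..b} \<Longrightarrow> norm (h x) \<le> B"
    and "f absolutely_integrable_on {a..b}"
  shows "(\<lambda>x. h x * f x) absolutely_integrable_on {a..b}"
proof (rule absolutely_integrable_bounded_measurable_product[where h="(*)" and f=h and g=f])
  show "bilinear ((*) :: complex \<Rightarrow> _)"
    unfolding bilinear_conv_bounded_bilinear by (rule bounded_bilinear_mult)
  show "bounded (h ` {a..b})"
    unfolding bounded_iff using assms(2) by blast
qed (use assms in simp_all)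

lemma absolutely_integrable_continuous_mult:
  fixes h f :: "real \<Rightarrow> complex"
  assumes h: "continuous_on {a..b} h" and "f absolutely_integrable_on {a..b}"
  shows "(\<lambda>x. h x * f x) absolutely_integrable_on {a..b}"
proof -
  have "bounded (h ` {a..b})"
    by (intro compact_imp_bounded compact_continuous_image h) auto
  then obtain B where "\<And>x. x \<in> {a..b} \<Longrightarrow> norm (h x) \<le> B"
    unfolding bounded_iff by blast
  then show ?thesis
    by (intro absolutely_integrable_bounded_mult assms continuous_imp_measurable_on_sets_lebesgue h)
       auto
qed

text \<open>Product rule without differentiation almost everywhere: with \<open>A\<close> and
  \<open>B\<close> the masses of \<open>f\<close> and \<open>g\<close> on \<open>{c..d}\<close>, the
  defect \<open>H\<close> of the formula changes by at most \<open>2 * A * B\<close> there, which is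
  below the square \<open>(A + B)\<^sup>2\<close> of the increment of \<open>\<gamma>\<close>. Hence
  \<open>H\<close> is constant.\<close>

lemma ac_on_mult:
  assumes F: "ac_on a b F f" and G: "ac_on a b G g" and "a \<le> b"
  shows "ac_on a b (\<lambda>t. F t * G t) (\<lambda>t. f t * G t + F t * g t)"
proof -
  let ?h = "\<lambda>t. f t * G t + F t * g t"
  have contF: "continuous_on {a..b} F" and contG: "continuous_on {a..b} G"
    using F G by (auto intro: ac_on_continuous)
  have f: "f absolutely_integrable_on {a..b}" and g: "g absolutely_integrable_on {a..b}"
    using F G by (auto intro: ac_on_integrable)
  have "(\<lambda>t. G t * f t) absolutely_integrable_on {a..b}" "(\<lambda>t. F t * g t) absolutely_integrable_on {a..b}"
    by (intro absolutely_integrable_continuous_mult contF contG f g)+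
  then have fG: "(\<lambda>t. f t * G t) absolutely_integrable_on {a..b}" and
    Fg: "(\<lambda>t. F t * g t) absolutely_integrable_on {a..b}"
    by (simp_all add: mult.commute)
  have h: "?h absolutely_integrable_on {a..b}"
    by (rule set_integral_add[OF fG Fg])
  define \<gamma> where "\<gamma> x = integral {a..x} (\<lambda>t. norm (f t)) + integral {a..x} (\<lambda>t. norm (g t))" for x
  define H where "H x = F x * G x - integral {a..x} ?h" for x
  have nf: "(\<lambda>t. norm (f t)) integrable_on {a..b}" and ng: "(\<lambda>t. norm (g t)) integrable_on {a..b}"
    using f g by (auto simp: absolutely_integrable_on_def)
  have incr: "norm (H d - H c) \<le> (\<gamma> d - \<gamma> c)\<^sup>2" if cd: "a \<le> c" "c \<le> d" "d \<le> b" for c d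
  proof -
    have sub: "{c..d} \<subseteq> {a..b}" using cd by auto
    note I = integrable_subinterval_real[OF _ sub]
    have If: "f integrable_on {c..d}" "g integrable_on {c..d}"
      "(\<lambda>t. f t * G t) integrable_on {c..d}" "(\<lambda>t. F t * g t) integrable_on {c..d}"
      using f g fG Fg by (auto intro!: I simp: absolutely_integrable_on_def)
    have In: "(\<lambda>t. norm (f t)) integrable_on {c..d}" "(\<lambda>t. norm (g t)) integrable_on {c..d}"
      using nf ng by (auto intro: I)
    define A where "A = integral {c..d} (\<lambda>t. norm (f t))"
    define B where "B = integral {c..d} (\<lambda>t. norm (g t))"
    have A0: "A \<ge> 0" and B0: "B \<ge> 0"
      unfolding A_def B_def by (auto intro!: Henstock_Kurzweil_Integration.integral_nonneg In)
    have split: "integral {a..d} k = integral {a..c} k + integral {c..d} k"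
      if "k integrable_on {a..b}" for k :: "real \<Rightarrow> 'c::euclidean_space"
      using cd that by (intro Henstock_Kurzweil_Integration.integral_combine[symmetric])
        (auto intro: integrable_subinterval_real[OF that])
    have \<gamma>: "\<gamma> d - \<gamma> c = A + B"
      using split[OF nf] split[OF ng] by (simp add: \<gamma>_def A_def B_def)
    have intc: "integral {c..d} ?h = integral {c..d} (\<lambda>t. f t * G t) + integral {c..d} (\<lambda>t. F t * g t)"
      by (intro Henstock_Kurzweil_Integration.integral_add If)
    \<comment> \<open>\<open>F d * G d - F c * G c\<close> is split as
      \<open>(F d - F c) * G d + F c * (G d - G c)\<close>; subtracting the integral of
      \<open>?h\<close> then leaves each density multiplied by an increment of the other function,
      which makes the error quadratic.\<close>
    have fG': "integral {c..d} (\<lambda>t. f t * (G d - G t)) = (F d - F c) * G d - integral {c..d} (\<lambda>t. f t * G t)"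
      using If cd ac_on_diff[OF F, of c d]
      by (simp add: right_diff_distrib Henstock_Kurzweil_Integration.integral_diff integrable_on_mult_left)
    have Fg': "integral {c..d} (\<lambda>t. (F c - F t) * g t) = F c * (G d - G c) - integral {c..d} (\<lambda>t. F t * g t)"
      using If cd ac_on_diff[OF G, of c d]
      by (simp add: left_diff_distrib Henstock_Kurzweil_Integration.integral_diff integrable_on_mult_right)
    have "integral {a..d} ?h = integral {a..c} ?h + integral {c..d} ?h"
      using h by (intro split) (auto simp: absolutely_integrable_on_def)
    then have H: "H d - H c = integral {c..d} (\<lambda>t. f t * (G d - G t)) + integral {c..d} (\<lambda>t. (F c - F t) * g t)"
      unfolding fG' Fg' H_def intc by (simp add: left_diff_distrib right_diff_distrib)
    have GA: "norm (G d - G t) \<le> B" if "t \<in> {c..d}" for t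
    proof -
      have *: "g integrable_on {t..d}" "(\<lambda>t. norm (g t)) integrable_on {t..d}"
        using If In that by (auto intro: integrable_subinterval_real)
      have "norm (G d - G t) = norm (integral {t..d} g)"
        using that cd by (subst ac_on_diff[OF G]) auto
      also have "\<dots> \<le> integral {t..d} (\<lambda>t. norm (g t))"
        using * by (intro integral_norm_bound_integral) auto
      also have "\<dots> \<le> B"
        unfolding B_def using that by (intro integral_subset_le * In) auto
      finally show ?thesis .
    qed
    have FA: "norm (F c - F t) \<le> A" if "t \<in> {c..d}" for t
    proof -
      have *: "f integrable_on {c..t}" "(\<lambda>t. norm (f t)) integrable_on {c..t}"
        using If In that by (auto intro: integrable_subinterval_real)
      have "norm (F c - F t) = norm (integral {c..t} f)"
        using that cd by (subst norm_minus_commute, subst ac_on_diff[OF F]) auto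
      also have "\<dots> \<le> integral {c..t} (\<lambda>t. norm (f t))"
        using * by (intro integral_norm_bound_integral) auto
      also have "\<dots> \<le> A"
        unfolding A_def using that by (intro integral_subset_le * In) auto
      finally show ?thesis .
    qed
    have "norm (integral {c..d} (\<lambda>t. f t * (G d - G t))) \<le> integral {c..d} (\<lambda>t. norm (f t) * B)"
    proof (rule integral_norm_bound_integral)
      show "(\<lambda>t. f t * (G d - G t)) integrable_on {c..d}"
        using If by (simp add: right_diff_distrib integrable_diff integrable_on_mult_left)
      show "(\<lambda>t. norm (f t) * B) integrable_on {c..d}"
        by (intro integrable_on_mult_left In)
    qed (use GA in \<open>auto simp: norm_mult intro: mult_left_mono\<close>)
    moreover have "norm (integral {c..d} (\<lambda>t. (F c - F t) * g t)) \<le> integral {c..d} (\<lambda>t. A * norm (g t))"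
    proof (rule integral_norm_bound_integral)
      show "(\<lambda>t. (F c - F t) * g t) integrable_on {c..d}"
        using If by (simp add: left_diff_distrib integrable_diff integrable_on_mult_right)
      show "(\<lambda>t. A * norm (g t)) integrable_on {c..d}"
        by (intro integrable_on_mult_right In)
    qed (use FA in \<open>auto simp: norm_mult intro: mult_right_mono\<close>)
    ultimately have "norm (H d - H c) \<le> A * B + A * B"
      unfolding H A_def B_def by (intro norm_triangle_mono) auto
    also have "\<dots> \<le> (\<gamma> d - \<gamma> c)\<^sup>2"
      unfolding \<gamma> using A0 B0 by (auto simp: power2_eq_square algebra_simps)
    finally show ?thesis .
  qed
  show ?thesis
    unfolding ac_on_def
  proof (intro conjI ballI h)
    fix x assume x: "x \<in> {a..b}"
    have "H x = H a"
    proof (rule quadratic_increments_imp_const[where \<gamma>=\<gamma>])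
      show "continuous_on {a..x} \<gamma>"
        unfolding \<gamma>_def using x nf ng
        by (intro continuous_intros indefinite_integral_continuous_1)
           (auto intro: integrable_subinterval_real)
      show "norm (H d - H c) \<le> (\<gamma> d - \<gamma> c)\<^sup>2" if "c \<in> {a..x}" "d \<in> {a..x}" for c d
        using incr[of c d] incr[of d c] that x
        by (cases "c \<le> d") (auto simp: norm_minus_commute power2_commute)
      show "\<gamma> a \<le> \<gamma> x"
        unfolding \<gamma>_def using x nf ng
        by (auto intro!: add_nonneg_nonneg Henstock_Kurzweil_Integration.integral_nonneg
            intro: integrable_subinterval_real)
    qed (use x in auto)
    then show "F x * G x = F a * G a + integral {a..x} ?h"
      by (simp add: H_def algebra_simps)
  qed
qed

lemma ac_on_has_vector_derivative:
  assumes "\<And>t. t \<in> {a..b} \<Longrightarrow> (F has_vector_derivative f t) (at t within {a..b})"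
    and "continuous_on {a..b} f"
  shows "ac_on a b F f"
  unfolding ac_on_def
proof (intro conjI ballI)
  show "f absolutely_integrable_on {a..b}"
    by (rule absolutely_integrable_continuous_real) fact
  fix x assume x: "x \<in> {a..b}"
  have "(f has_integral (F x - F a)) {a..x}"
  proof (rule fundamental_theorem_of_calculus)
    show "(F has_vector_derivative f t) (at t within {a..x})" if "t \<in> {a..x}" for t
      by (rule has_vector_derivative_within_subset[OF assms(1)]) (use that x in auto)
  qed (use x in auto)
  then have "integral {a..x} f = F x - F a"
    by (rule integral_unique)
  then show "F x = F a + integral {a..x} f"
    by simp
qed

section \<open>Functions of bounded variation as distributional coefficients\<close>

text \<open>
  The second condition says that the derivative of \<open>Q\<close> is a measure of mass at most \<open>K\<close>, including
  the jumps at the end points; it is the only regularity of \<open>Q\<close> that the argument uses.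
\<close>

definition measure_potential :: "(real \<Rightarrow> complex) \<Rightarrow> real \<Rightarrow> bool"
  where "measure_potential Q K \<longleftrightarrow>
    Q \<in> borel_measurable leb \<and> bounded (Q ` {0..pi}) \<and> K \<ge> 0 \<and>
    (\<forall>\<phi> \<phi>' S. ac_on 0 pi \<phi> \<phi>' \<longrightarrow> (\<forall>t\<in>{0..pi}. norm (\<phi> t) \<le> S) \<longrightarrow>
       norm (integral {0..pi} (\<lambda>t. Q t * \<phi>' t)) \<le> K * S)"

lemma measure_potentialD:
  assumes "measure_potential Q K"
  shows "Q \<in> borel_measurable leb" "bounded (Q ` {0..pi})" "K \<ge> 0"
    and "ac_on 0 pi \<phi> \<phi>' \<Longrightarrow> (\<And>t. t \<in> {0..pi} \<Longrightarrow> norm (\<phi> t) \<le> S) \<Longrightarrow>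
      norm (integral {0..pi} (\<lambda>t. Q t * \<phi>' t)) \<le> K * S"
  using assms unfolding measure_potential_def by blast+

lemma measure_potential_mult_integrable:
  assumes "measure_potential Q K" "f absolutely_integrable_on {0..pi}"
  shows "(\<lambda>t. Q t * f t) absolutely_integrable_on {0..pi}"
proof -
  obtain B where "\<And>x. x \<in> {0..pi} \<Longrightarrow> norm (Q x) \<le> B"
    using measure_potentialD(2)[OF assms(1)] unfolding bounded_iff by blast
  then show ?thesis
    by (intro absolutely_integrable_bounded_mult assms measure_potentialD(1)[OF assms(1)])
qed

lemma measure_potential_zero: "measure_potential (\<lambda>_. 0) 0"
  unfolding measure_potential_def by (auto simp: image_constant_conv)

lemma measure_potential_add_scale:
  assumes "measure_potential Q1 K1" "measure_potential Q2 K2"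
  shows "measure_potential (\<lambda>t. Q1 t + c * Q2 t) (K1 + norm c * K2)"
proof -
  note m1 = measure_potentialD[OF assms(1)] and m2 = measure_potentialD[OF assms(2)]
  have "bounded ((\<lambda>t. Q1 t + c * Q2 t) ` {0..pi})"
  proof -
    have "bounded ((\<lambda>t. c * Q2 t) ` {0..pi})"
      using bounded_linear_image[OF m2(2) bounded_linear_mult_right[of c]] by (simp add: image_image)
    then show ?thesis
      by (rule bounded_plus_comp[OF m1(2)])
  qed
  moreover have "norm (integral {0..pi} (\<lambda>t. (Q1 t + c * Q2 t) * \<phi>' t)) \<le> (K1 + norm c * K2) * S"
    if ac: "ac_on 0 pi \<phi> \<phi>'" and S: "\<forall>t\<in>{0..pi}. norm (\<phi> t) \<le> S" for \<phi> \<phi>' S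
  proof -
    have "(\<lambda>t. Q1 t * \<phi>' t) integrable_on {0..pi}" "(\<lambda>t. Q2 t * \<phi>' t) integrable_on {0..pi}"
      using ac_on_integrable[OF ac]
      by (auto intro!: set_lebesgue_integral_eq_integral(1) measure_potential_mult_integrable assms)
    then have "integral {0..pi} (\<lambda>t. (Q1 t + c * Q2 t) * \<phi>' t)
        = integral {0..pi} (\<lambda>t. Q1 t * \<phi>' t) + c * integral {0..pi} (\<lambda>t. Q2 t * \<phi>' t)"
      by (simp add: distrib_right mult.assoc Henstock_Kurzweil_Integration.integral_add integrable_on_mult_right)
    also have "norm \<dots> \<le> K1 * S + norm c * (K2 * S)"
      using m1(4)[OF ac, of S] m2(4)[OF ac, of S] S
      by (intro norm_triangle_mono) (auto simp: norm_mult intro!: mult_left_mono)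
    finally show ?thesis
      by (simp add: algebra_simps)
  qed
  ultimately show ?thesis
    unfolding measure_potential_def using m1(1,3) m2(1,3) by auto
qed

lemma borel_measurable_mono_leb:
  fixes q :: "real \<Rightarrow> real"
  assumes "mono_on {0..pi} q"
  shows "q \<in> borel_measurable leb"
proof -
  have "q \<in> borel_measurable (restrict_space borel {0..pi})"
    using borel_measurable_mono_on_fnc[OF assms] .
  moreover have "sets (restrict_space borel {0..pi}) \<subseteq> sets leb"
    unfolding sets_restrict_space by (intro image_mono subsetI sets_completionI_sets) simp
  ultimately show ?thesis
    by (rule borel_measurable_subalgebra[rotated 2]) (simp add: space_restrict_space)
qed

text \<open>By the second mean value theorem the integral is a combination, with coefficients
  \<open>q 0\<close> and \<open>q pi\<close>, of integrals of the density over two subintervals, and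
  each of those is at most a difference of values of \<open>\<phi>\<close>, hence at most
  \<open>2 * S\<close>. The theorem is real, so real and imaginary parts are treated separately,
  which doubles 2 to 4.\<close>

lemma measure_potential_mono:
  fixes q :: "real \<Rightarrow> real"
  assumes q: "mono_on {0..pi} q"
  shows "measure_potential (\<lambda>t. of_real (q t)) (4 * (\<bar>q 0\<bar> + \<bar>q pi\<bar>))"
proof -
  have bd: "\<bar>q t\<bar> \<le> \<bar>q 0\<bar> + \<bar>q pi\<bar>" if "t \<in> {0..pi}" for t
    using mono_onD[OF q, of 0 t] mono_onD[OF q, of t pi] that by auto
  have bdd: "bounded ((\<lambda>t. complex_of_real (q t)) ` {0..pi})"
    unfolding bounded_iff by (intro exI[of _ "\<bar>q 0\<bar> + \<bar>q pi\<bar>"]) (use bd in auto)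
  have meas: "(\<lambda>t. complex_of_real (q t)) \<in> borel_measurable leb"
    using borel_measurable_mono_leb[OF q] by measurable
  moreover have "norm (integral {0..pi} (\<lambda>t. of_real (q t) * \<phi>' t)) \<le> 4 * (\<bar>q 0\<bar> + \<bar>q pi\<bar>) * S"
    if ac: "ac_on 0 pi \<phi> \<phi>'" and S: "\<forall>t\<in>{0..pi}. norm (\<phi> t) \<le> S" for \<phi> \<phi>' S
  proof -
    have part: "\<bar>integral {0..pi} (\<lambda>t. q t * r (\<phi>' t))\<bar> \<le> 2 * (\<bar>q 0\<bar> + \<bar>q pi\<bar>) * S"
      if r: "bounded_linear r" and r1: "\<And>z. \<bar>r z\<bar> \<le> norm z" for r :: "complex \<Rightarrow> real"
    proof -
      have int: "\<phi>' integrable_on {0..pi}"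
        using ac_on_integrable[OF ac] by (rule set_lebesgue_integral_eq_integral)
      then have "(\<lambda>t. r (\<phi>' t)) integrable_on {0..pi}"
        using integrable_linear[OF int r] by (simp add: o_def)
      then obtain c where c: "c \<in> {0..pi}" and
        eq: "integral {0..pi} (\<lambda>t. q t * r (\<phi>' t))
          = q 0 * integral {0..c} (\<lambda>t. r (\<phi>' t)) + q pi * integral {c..pi} (\<lambda>t. r (\<phi>' t))"
        by (rule second_mean_value_theorem[where g=q]) (auto intro!: mono_onD[OF q])
      have i: "\<bar>integral {x..y} (\<lambda>t. r (\<phi>' t))\<bar> \<le> 2 * S" if "0 \<le> x" "x \<le> y" "y \<le> pi" for x y
      proof -
        have "\<phi>' integrable_on {x..y}"
          by (rule integrable_subinterval_real[OF int]) (use that in auto)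
        then have "integral {x..y} (\<lambda>t. r (\<phi>' t)) = r (integral {x..y} \<phi>')"
          using integral_linear[OF _ r] by (simp add: o_def)
        also have "integral {x..y} \<phi>' = \<phi> y - \<phi> x"
          using ac_on_diff[OF ac, of x y] that by auto
        finally have "\<bar>integral {x..y} (\<lambda>t. r (\<phi>' t))\<bar> \<le> norm (\<phi> y - \<phi> x)"
          using r1 by simp
        also have "\<dots> \<le> norm (\<phi> y) + norm (\<phi> x)"
          by (rule norm_triangle_ineq4)
        also have "\<dots> \<le> S + S"
          by (intro add_mono S[rule_format]) (use that in auto)
        finally show ?thesis by simp
      qed
      have "\<bar>integral {0..pi} (\<lambda>t. q t * r (\<phi>' t))\<bar> \<le> \<bar>q 0\<bar> * (2 * S) + \<bar>q pi\<bar> * (2 * S)"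
        unfolding eq abs_mult[symmetric] using i[of 0 c] i[of c pi] c
        by (intro order_trans[OF abs_triangle_ineq] add_mono) (auto simp: abs_mult mult_left_mono)
      then show ?thesis by (simp add: algebra_simps)
    qed
    have "(\<lambda>t. of_real (q t) * \<phi>' t) absolutely_integrable_on {0..pi}"
      by (rule absolutely_integrable_bounded_mult[OF meas, where B="\<bar>q 0\<bar> + \<bar>q pi\<bar>"])
         (use bd ac_on_integrable[OF ac] in auto)
    then have int: "(\<lambda>t. of_real (q t) * \<phi>' t) integrable_on {0..pi}"
      by (rule set_lebesgue_integral_eq_integral)
    have "Re (integral {0..pi} (\<lambda>t. of_real (q t) * \<phi>' t)) = integral {0..pi} (\<lambda>t. q t * Re (\<phi>' t))"
      using integral_linear[OF int bounded_linear_Re] by (simp add: o_def)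
    moreover have "Im (integral {0..pi} (\<lambda>t. of_real (q t) * \<phi>' t)) = integral {0..pi} (\<lambda>t. q t * Im (\<phi>' t))"
      using integral_linear[OF int bounded_linear_Im] by (simp add: o_def)
    ultimately show ?thesis
      using cmod_le[of "integral {0..pi} (\<lambda>t. of_real (q t) * \<phi>' t)"]
        part[OF bounded_linear_Re abs_Re_le_cmod] part[OF bounded_linear_Im abs_Im_le_cmod]
      by linarith
  qed
  ultimately show ?thesis
    unfolding measure_potential_def using bdd by auto
qed

text \<open>\<open>V x\<close> is the variation of \<open>Q\<close> on \<open>{a..x}\<close>.
  Appending \<open>x\<close> and \<open>y\<close> to a chain in \<open>{a..x}\<close> raises its sum
  by at least \<open>norm (Q y - Q x)\<close>.\<close>

lemma bounded_variation_dominating_mono: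
  fixes Q :: "real \<Rightarrow> complex"
  assumes "bounded_variation_on a b Q"
  obtains V where "\<And>x y. a \<le> x \<Longrightarrow> x \<le> y \<Longrightarrow> y \<le> b \<Longrightarrow> norm (Q y - Q x) \<le> V y - V x"
proof
  obtain B where B: "\<And>n t. (\<forall>i\<le>n. t i \<in> {a..b}) \<Longrightarrow> (\<forall>i<n. t i \<le> t (Suc i)) \<Longrightarrow>
      (\<Sum>i<n. norm (Q (t (Suc i)) - Q (t i))) \<le> B"
    using assms unfolding bounded_variation_on_def by blast
  define P where "P x = {(\<Sum>i<n. norm (Q (t (Suc i)) - Q (t i))) | n t.
      (\<forall>i\<le>n. t i \<in> {a..x}) \<and> (\<forall>i<n. t i \<le> t (Suc i))}" for x
  define V where "V x = Sup (P x)" for x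
  have bdd: "bdd_above (P x)" if "x \<le> b" for x
    unfolding bdd_above_def P_def using that by (intro exI[of _ B]) (auto intro!: B)
  fix x y assume xy: "a \<le> x" "x \<le> y" "y \<le> b"
  have "s \<le> V y - norm (Q y - Q x)" if s_in: "s \<in> P x" for s
  proof -
    obtain n t where s: "s = (\<Sum>i<n. norm (Q (t (Suc i)) - Q (t i)))"
      and t: "\<forall>i\<le>n. t i \<in> {a..x}" "\<forall>i<n. t i \<le> t (Suc i)"
      using s_in unfolding P_def by blast
    \<comment> \<open>A chain in \<open>{a..x}\<close> need not end at \<open>x\<close>, so
      \<open>x\<close> is inserted before \<open>y\<close>; the extra step from \<open>t n\<close>
      to \<open>x\<close> only enlarges the sum.\<close>
    define t' where "t' i = (if i \<le> n then t i else if i = Suc n then x else y)" for i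
    have "(\<Sum>i<Suc (Suc n). norm (Q (t' (Suc i)) - Q (t' i))) \<in> P y"
      unfolding P_def
      using t xy by (intro CollectI exI[of _ "Suc (Suc n)"] exI[of _ t'])
        (force simp: t'_def less_Suc_eq le_Suc_eq)
    then have "(\<Sum>i<Suc (Suc n). norm (Q (t' (Suc i)) - Q (t' i))) \<le> V y"
      unfolding V_def using bdd xy by (intro cSup_upper) auto
    moreover have "(\<Sum>i<n. norm (Q (t' (Suc i)) - Q (t' i))) = s"
      unfolding s by (intro sum.cong) (auto simp: t'_def)
    ultimately have "s + norm (Q x - Q (t n)) + norm (Q y - Q x) \<le> V y"
      by (simp add: t'_def)
    then show ?thesis
      using norm_ge_zero[of "Q x - Q (t n)"] by linarith
  qed
  moreover have "P x \<noteq> {}"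
    unfolding P_def using xy by (auto intro!: exI[of _ 0] exI[of _ "\<lambda>_. x"])
  ultimately have "V x \<le> V y - norm (Q y - Q x)"
    unfolding V_def[of x] by (intro cSup_least) auto
  then show "norm (Q y - Q x) \<le> V y - V x" by simp
qed

text \<open>Jordan decomposition: \<open>V\<close>, \<open>V - Re Q\<close> and
  \<open>V - Im Q\<close> are monotone because the variation dominates the increments of
  \<open>Re Q\<close> and \<open>Im Q\<close>, and \<open>Q\<close> is a combination of them with
  coefficients 1, -1, \<open>\<i>\<close> and \<open>- \<i>\<close>.\<close>

lemma bounded_variation_measure_potential:
  assumes "bounded_variation_on 0 pi Q"
  obtains K where "measure_potential Q K"
proof -
  obtain V where V: "\<And>x y. 0 \<le> x \<Longrightarrow> x \<le> y \<Longrightarrow> y \<le> pi \<Longrightarrow> norm (Q y - Q x) \<le> V y - V x"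
    using bounded_variation_dominating_mono[OF assms] by blast
  have mono: "mono_on {0..pi} V" "mono_on {0..pi} (\<lambda>t. V t - Re (Q t))" "mono_on {0..pi} (\<lambda>t. V t - Im (Q t))"
    using V order_trans[OF abs_Re_le_cmod V] order_trans[OF abs_Im_le_cmod V] norm_ge_zero
    by (fastforce intro!: mono_onI simp: abs_le_iff)+
  note M = mono[THEN measure_potential_mono]
  note X = measure_potential_add_scale[OF measure_potential_add_scale[OF measure_potential_add_scale[OF M(1) M(2), of "-1"] M(1), of \<i>] M(3), of "- \<i>"]
  have eq: "Q = (\<lambda>t. complex_of_real (V t) + - 1 * complex_of_real (V t - Re (Q t)) +
         \<i> * complex_of_real (V t) + - \<i> * complex_of_real (V t - Im (Q t)))"
    by (auto simp: fun_eq_iff complex_eq_iff)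
  show ?thesis
    by (rule that, subst eq, rule X)
qed

section \<open>The equation as a first-order system\<close>

lemma AE_leb_negligible:
  assumes "AE t in lebesgue_on {a..b}. P (t::real)"
  obtains N where "negligible N" "\<And>t. t \<in> {a..b} - N \<Longrightarrow> P t"
proof -
  have "AE t in lebesgue. t \<in> {a..b} \<longrightarrow> P t"
    using assms by (subst (asm) AE_restrict_space_iff) auto
  then obtain N where "N \<in> null_sets lebesgue" "{t. \<not> (t \<in> {a..b} \<longrightarrow> P t)} \<subseteq> N"
    by (auto simp: eventually_ae_filter)
  then show ?thesis
    using that[of N] by (auto simp: negligible_iff_null_sets)
qed

lemma ac_on_cong_AE:
  assumes "ac_on a b F f" and "AE t in lebesgue_on {a..b}. f t = g t"
  shows "ac_on a b F g"
proof -
  obtain N where N: "negligible N" "\<And>t. t \<in> {a..b} - N \<Longrightarrow> f t = g t"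
    using AE_leb_negligible[OF assms(2)] by blast
  have "g absolutely_integrable_on {a..b}"
    by (rule absolutely_integrable_spike[OF ac_on_integrable[OF assms(1)] N(1)]) (use N in auto)
  moreover have "integral {a..x} f = integral {a..x} g" if "x \<in> {a..b}" for x
    by (rule integral_spike[OF N(1)]) (use N that in auto)
  moreover have "F x = F a + integral {a..x} g" if "x \<in> {a..b}" for x
    using ac_onD[OF assms(1) that] calculation(2)[OF that] by metis
  ultimately show ?thesis
    unfolding ac_on_def by blast
qed

lemma ac_on_add_scale:
  assumes "ac_on a b F f" "ac_on a b G g"
  shows "ac_on a b (\<lambda>t. F t + c * G t) (\<lambda>t. f t + c * g t)"
  unfolding ac_on_def
proof (intro conjI ballI)
  have cg: "(\<lambda>t. c * g t) absolutely_integrable_on {a..b}"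
    using absolutely_integrable_continuous_mult[OF continuous_on_const ac_on_integrable[OF assms(2)]] .
  show "(\<lambda>t. f t + c * g t) absolutely_integrable_on {a..b}"
    by (rule set_integral_add(1)[OF ac_on_integrable[OF assms(1)] cg])
  fix x assume x: "x \<in> {a..b}"
  have "f integrable_on {a..b}" "g integrable_on {a..b}"
    using assms[THEN ac_on_integrable] by (auto intro: set_lebesgue_integral_eq_integral(1))
  then have "f integrable_on {a..x}" "g integrable_on {a..x}"
    using x by (auto elim!: integrable_subinterval_real)
  then have "integral {a..x} (\<lambda>t. f t + c * g t) = integral {a..x} f + c * integral {a..x} g"
    by (simp add: Henstock_Kurzweil_Integration.integral_add integrable_on_mult_right)
  moreover have "F x = F a + integral {a..x} f" "G x = G a + integral {a..x} g"
    using ac_onD[OF assms(1) x] ac_onD[OF assms(2) x] .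
  ultimately show "F x + c * G x = F a + c * G a + integral {a..x} (\<lambda>t. f t + c * g t)"
    by (simp add: distrib_left)
qed

text \<open>Meant for the product \<open>G y\<close>, whose factor \<open>G\<close> has a kink at
  \<open>x\<close>. At \<open>c\<close> itself the two densities may disagree, which is a null
  set.\<close>

lemma ac_on_combine:
  assumes F: "ac_on a c F f" and G: "ac_on c b G g" and "F c = G c" "a \<le> c" "c \<le> b"
  shows "ac_on a b (\<lambda>t. if t \<le> c then F t else G t) (\<lambda>t. if t \<le> c then f t else g t)"
    (is "ac_on a b ?H ?h")
  unfolding ac_on_def
proof (intro conjI ballI)
  have l: "?h absolutely_integrable_on {a..c}"
    by (rule absolutely_integrable_spike[OF ac_on_integrable[OF F], of "{}"]) auto
  have r: "?h absolutely_integrable_on {c..b}"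
    by (rule absolutely_integrable_spike[OF ac_on_integrable[OF G], of "{c}"]) auto
  show h: "?h absolutely_integrable_on {a..b}"
    by (rule absolutely_integrable_on_combine[OF l r]) (use assms in auto)
  have hi: "?h integrable_on {a..b}"
    using h by (rule set_lebesgue_integral_eq_integral)
  have left: "integral {a..x} ?h = F x - F a" if "x \<in> {a..c}" for x
  proof -
    have "integral {a..x} ?h = integral {a..x} f"
      by (rule integral_cong) (use that in auto)
    then show ?thesis
      using ac_onD[OF F that] by simp
  qed
  fix x assume x: "x \<in> {a..b}"
  show "?H x = ?H a + integral {a..x} ?h"
  proof (cases "x \<le> c")
    case True
    with left[of x] x assms show ?thesis by simp
  next
    case False
    have "?h integrable_on {a..x}"
      by (rule integrable_subinterval_real[OF hi]) (use x in auto)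
    then have "integral {a..x} ?h = integral {a..c} ?h + integral {c..x} ?h"
      by (intro Henstock_Kurzweil_Integration.integral_combine[symmetric]) (use x assms False in auto)
    also have "integral {a..c} ?h = F c - F a"
      by (rule left) (use assms in auto)
    also have "integral {c..x} ?h = integral {c..x} g"
      by (rule integral_spike[of "{c}"]) auto
    also have "\<dots> = G x - G c"
      using ac_onD[OF G, of x] x False by simp
    finally show ?thesis
      using assms False by simp
  qed
qed

text \<open>\<open>(z - L) y = f\<close> as a first-order system for \<open>y\<close> and its
  quasi-derivative \<open>u\<close>: the derivative of \<open>y\<close> is \<open>u + Q y\<close>,
  and \<open>f = z y - w\<close> turns \<open>w = - u' - Q y'\<close> into the second equation. No
  square integrability is asked for, so the notion also makes sense for \<open>f\<close> in
  \<open>L1\<close>.\<close>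

definition hill_solution ::
    "bc \<Rightarrow> (real \<Rightarrow> complex) \<Rightarrow> complex \<Rightarrow> (real \<Rightarrow> complex) \<Rightarrow> (real \<Rightarrow> complex) \<Rightarrow> (real \<Rightarrow> complex) \<Rightarrow> bool"
  where "hill_solution bc Q z f y u \<longleftrightarrow>
    ac_on 0 pi y (\<lambda>t. u t + Q t * y t) \<and>
    ac_on 0 pi u (\<lambda>t. f t - z * y t - Q t * (u t + Q t * y t)) \<and>
    satisfies_bc bc y u"

lemma hill_solution_continuous:
  "hill_solution bc Q z f y u \<Longrightarrow> continuous_on {0..pi} y"
  by (auto simp: hill_solution_def intro: ac_on_continuous)

lemma hill_solution_add_scale:
  assumes "hill_solution bc Q z f y u" "hill_solution bc Q z g v w"
  shows "hill_solution bc Q z (\<lambda>t. f t + c * g t) (\<lambda>t. y t + c * v t) (\<lambda>t. u t + c * w t)"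
proof -
  have 1: "ac_on 0 pi y (\<lambda>t. u t + Q t * y t)" "ac_on 0 pi v (\<lambda>t. w t + Q t * v t)"
    and 2: "ac_on 0 pi u (\<lambda>t. f t - z * y t - Q t * (u t + Q t * y t))"
      "ac_on 0 pi w (\<lambda>t. g t - z * v t - Q t * (w t + Q t * v t))"
    and 3: "satisfies_bc bc y u" "satisfies_bc bc v w"
    using assms by (auto simp: hill_solution_def)
  have "satisfies_bc bc (\<lambda>t. y t + c * v t) (\<lambda>t. u t + c * w t)"
    using 3 by (cases bc) (auto simp: algebra_simps)
  then show ?thesis
    using ac_on_add_scale[OF 1, of c] ac_on_add_scale[OF 2, of c]
    by (simp add: hill_solution_def algebra_simps)
qed

text \<open>A change of the spectral parameter is absorbed by the source; the resolvent identity and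
  the local bounds near a regular point rest on this.\<close>

lemma hill_solution_shift:
  assumes "hill_solution bc Q z f y u"
  shows "hill_solution bc Q w (\<lambda>t. f t + (w - z) * y t) y u"
  using assms by (simp add: hill_solution_def algebra_simps)

section \<open>Square integrability and the passage between the operator and the system\<close>

lemma L2_imp_L1: assumes "f \<in> L2" shows "f \<in> L1"
proof -
  have "integrable leb (\<lambda>x. 1 + (norm (f x))\<^sup>2)"
    using assms by (intro Bochner_Integration.integrable_add finite_measure.integrable_const
        finite_measure_lebesgue_on) (auto simp: L2_def)
  then have "integrable leb f"
  proof (rule Bochner_Integration.integrable_bound)
    have "norm (f x) \<le> 1 + (norm (f x))\<^sup>2" for x
    proof -
      have "0 \<le> (norm (f x) - 1)\<^sup>2" "0 \<le> (norm (f x))\<^sup>2"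
        by simp_all
      then show ?thesis
        unfolding power2_diff one_power2 by linarith
    qed
    then show "AE x in leb. norm (f x) \<le> norm (1 + (norm (f x))\<^sup>2)"
      by (auto intro!: AE_I2)
  qed (use assms in \<open>auto simp: L2_def\<close>)
  then show ?thesis by (simp add: L1_def)
qed

lemma bounded_imp_L2:
  assumes "f \<in> borel_measurable leb" "\<And>x. x \<in> {0..pi} \<Longrightarrow> norm (f x) \<le> B"
  shows "f \<in> L2"
proof -
  have "(norm (f x))\<^sup>2 \<le> B\<^sup>2" if "x \<in> {0..pi}" for x
    using assms(2)[OF that] by (intro power_mono) auto
  then have "integrable leb (\<lambda>x. (norm (f x))\<^sup>2)"
    using assms(1)
    by (intro finite_measure.integrable_const_bound[where B="B\<^sup>2"] finite_measure_lebesgue_on) auto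
  then show ?thesis using assms by (simp add: L2_def)
qed

lemma continuous_imp_L2:
  assumes "continuous_on {0..pi} f"
  shows "f \<in> L2"
proof -
  have "bounded (f ` {0..pi})"
    by (intro compact_imp_bounded compact_continuous_image assms) auto
  then obtain B where "\<And>x. x \<in> {0..pi} \<Longrightarrow> norm (f x) \<le> B"
    unfolding bounded_iff by blast
  then show ?thesis
    by (intro bounded_imp_L2 continuous_imp_measurable_on_sets_lebesgue assms) auto
qed

lemma L2_add_scale:
  assumes "f \<in> L2" "g \<in> L2"
  shows "(\<lambda>x. f x + c * g x) \<in> L2"
proof -
  have m: "f \<in> borel_measurable leb" "g \<in> borel_measurable leb" and
    i: "integrable leb (\<lambda>x. (norm (f x))\<^sup>2)" "integrable leb (\<lambda>x. (norm (g x))\<^sup>2)"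
    using assms by (auto simp: L2_def)
  have "integrable leb (\<lambda>x. 2 * (norm (f x))\<^sup>2 + 2 * (norm c)\<^sup>2 * (norm (g x))\<^sup>2)"
    using i by simp
  then have "integrable leb (\<lambda>x. (norm (f x + c * g x))\<^sup>2)"
  proof (rule Bochner_Integration.integrable_bound)
    have "(norm (f x + c * g x))\<^sup>2 \<le> 2 * (norm (f x))\<^sup>2 + 2 * (norm c)\<^sup>2 * (norm (g x))\<^sup>2" for x
    proof -
      have "(norm (f x + c * g x))\<^sup>2 \<le> (norm (f x) + norm c * norm (g x))\<^sup>2"
        by (intro power_mono order_trans[OF norm_triangle_ineq]) (auto simp: norm_mult)
      also have "\<dots> \<le> 2 * (norm (f x))\<^sup>2 + 2 * (norm c * norm (g x))\<^sup>2"
        using zero_le_power2[of "norm (f x) - norm c * norm (g x)"]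
        by (simp add: power2_eq_square algebra_simps)
      finally show ?thesis by (simp add: power_mult_distrib)
    qed
    then show "AE x in leb. norm ((norm (f x + c * g x))\<^sup>2)
        \<le> norm (2 * (norm (f x))\<^sup>2 + 2 * (norm c)\<^sup>2 * (norm (g x))\<^sup>2)"
      by (auto intro!: AE_I2)
  qed (use m in measurable)
  then show ?thesis
    using m by (simp add: L2_def)
qed

lemma hill_op_imp_solution:
  assumes "hill_op bc Q y w" "AE x in leb. z * y x - w x = f x"
  obtains u where "hill_solution bc Q z f y u"
proof -
  obtain y' u u' where y: "ac_on 0 pi y y'" and u: "ac_on 0 pi u u'"
    and eq: "AE x in leb. u x = y' x - Q x * y x" "AE x in leb. w x = - u' x - Q x * y' x"
    and bc: "satisfies_bc bc y u"
    using assms(1) unfolding hill_op_def has_weak_derivative_iff by blast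
  have "ac_on 0 pi y (\<lambda>t. u t + Q t * y t)"
    by (rule ac_on_cong_AE[OF y]) (use eq(1) in \<open>eventually_elim, simp\<close>)
  moreover have "ac_on 0 pi u (\<lambda>t. f t - z * y t - Q t * (u t + Q t * y t))"
  proof (rule ac_on_cong_AE[OF u])
    show "AE t in leb. u' t = f t - z * y t - Q t * (u t + Q t * y t)"
      using eq assms(2)
    proof eventually_elim
      case (elim t)
      have "u t + Q t * y t = y' t"
        using elim(1) by simp
      then show ?case
        unfolding elim(3)[symmetric] using elim(2) by simp
    qed
  qed
  ultimately show ?thesis
    using that bc by (auto simp: hill_solution_def)
qed

text \<open>The square integrability required by \<open>hill_op\<close> is automatic:
  \<open>y\<close> and \<open>u\<close> are continuous and \<open>Q\<close> is bounded, so the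
  derivative of \<open>y\<close> is bounded.\<close>

lemma hill_solution_imp_hill_op:
  assumes Q: "measure_potential Q K" and sol: "hill_solution bc Q z f y u" and f: "f \<in> L2"
  shows "hill_op bc Q y (\<lambda>x. z * y x - f x)"
proof -
  note yu = sol[unfolded hill_solution_def]
  have cont: "continuous_on {0..pi} y" "continuous_on {0..pi} u"
    using yu by (auto intro: ac_on_continuous)
  have bQ: "bounded (Q ` {0..pi})" and mQ: "Q \<in> borel_measurable leb"
    using measure_potentialD[OF Q] by auto
  have "bounded (y ` {0..pi})" "bounded (u ` {0..pi})"
    by (intro compact_imp_bounded compact_continuous_image cont; simp)+
  then obtain By Bu BQ where B: "\<And>x. x \<in> {0..pi} \<Longrightarrow> norm (y x) \<le> By"
      "\<And>x. x \<in> {0..pi} \<Longrightarrow> norm (u x) \<le> Bu" "\<And>x. x \<in> {0..pi} \<Longrightarrow> norm (Q x) \<le> BQ"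
    using bQ unfolding bounded_iff by (metis image_eqI)
  have my: "y \<in> borel_measurable leb" "u \<in> borel_measurable leb"
    using cont by (auto intro!: continuous_imp_measurable_on_sets_lebesgue)
  have y'_L2: "(\<lambda>t. u t + Q t * y t) \<in> L2"
  proof (rule bounded_imp_L2)
    show "(\<lambda>t. u t + Q t * y t) \<in> borel_measurable leb"
      using my mQ by measurable
    show "norm (u x + Q x * y x) \<le> Bu + BQ * By" if "x \<in> {0..pi}" for x
      using B[OF that] order_trans[OF norm_ge_zero B(3)[OF that]]
      by (intro norm_triangle_mono) (auto simp: norm_mult intro!: mult_mono)
  qed
  have "(\<lambda>x. z * y x + - 1 * f x) \<in> L2"
    by (intro L2_add_scale continuous_imp_L2 continuous_intros cont f)
  then have "(\<lambda>x. z * y x - f x) \<in> L2"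
    by simp
  then show ?thesis
    unfolding hill_op_def has_weak_derivative_iff
    using yu y'_L2
    by (intro exI[of _ "\<lambda>t. u t + Q t * y t"] exI[of _ u]
          exI[of _ "\<lambda>t. f t - z * y t - Q t * (u t + Q t * y t)"])
       (auto simp: algebra_simps)
qed

text \<open>An eigenfunction may be tested at a single point: \<open>y\<close> is continuous, so
  vanishing almost everywhere means vanishing on the whole interval.\<close>

lemma eigenvalue_iff:
  assumes Q: "measure_potential Q K"
  shows "eigenvalue bc Q z \<longleftrightarrow>
    (\<exists>y u. hill_solution bc Q z (\<lambda>_. 0) y u \<and> (\<exists>x\<in>{0..pi}. y x \<noteq> 0))"
proof
  assume "eigenvalue bc Q z"
  then obtain y w where *: "hill_op bc Q y w" "AE x in leb. w x = z * y x"
      "\<not> (AE x in leb. y x = 0)"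
    by (auto simp: eigenvalue_def)
  have "AE x in leb. z * y x - w x = 0"
    using *(2) by eventually_elim simp
  then obtain u where "hill_solution bc Q z (\<lambda>_. 0) y u"
    by (rule hill_op_imp_solution[OF *(1)])
  moreover have "\<exists>x\<in>{0..pi}. y x \<noteq> 0"
    using *(3) by (auto intro!: AE_I2)
  ultimately show "\<exists>y u. hill_solution bc Q z (\<lambda>_. 0) y u \<and> (\<exists>x\<in>{0..pi}. y x \<noteq> 0)"
    by blast
next
  assume "\<exists>y u. hill_solution bc Q z (\<lambda>_. 0) y u \<and> (\<exists>x\<in>{0..pi}. y x \<noteq> 0)"
  then obtain y u x where *: "hill_solution bc Q z (\<lambda>_. 0) y u" "x \<in> {0..pi}" "y x \<noteq> 0"
    by blast
  have "hill_op bc Q y (\<lambda>x. z * y x - 0)"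
    by (rule hill_solution_imp_hill_op[OF Q *(1)]) (simp add: L2_def)
  moreover have "\<not> (AE x in leb. y x = 0)"
  proof
    assume "AE x in leb. y x = 0"
    then obtain N where N: "negligible N" "\<And>t. t \<in> {0..pi} - N \<Longrightarrow> y t = 0"
      using AE_leb_negligible by blast
    have "integral {0..pi} (\<lambda>t. norm (y t)) = integral {0..pi} (\<lambda>_. 0)"
      by (rule integral_spike[OF N(1)]) (use N(2) in simp)
    moreover have "continuous_on {0..pi} (\<lambda>t. norm (y t))"
      by (intro continuous_intros hill_solution_continuous[OF *(1)])
    ultimately have "\<forall>t\<in>{0..pi}. norm (y t) = 0"
      using integral_eq_0_iff[of 0 pi "\<lambda>t. norm (y t)"] by simp
    then show False using *(2,3) by simp
  qed
  ultimately show "eigenvalue bc Q z"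
    unfolding eigenvalue_def by (intro exI[of _ y] exI) auto
qed

section \<open>Free Green functions\<close>

lemma has_vector_derivative_exp_affine:
  fixes k :: complex
  shows "((\<lambda>t. exp (k * of_real (a + b * t))) has_vector_derivative
     k * of_real b * exp (k * of_real (a + b * t))) (at (t::real) within S)"
proof -
  have "((\<lambda>z. exp (k * (of_real a + of_real b * z))) has_field_derivative
      k * of_real b * exp (k * (of_real a + of_real b * of_real t))) (at (of_real t :: complex))"
    by (auto intro!: derivative_eq_intros)
  from has_vector_derivative_real_field[OF this] show ?thesis
    by simp
qed

lemma norm_exp_affine_le:
  assumes "Im \<mu> \<ge> 0" "a \<ge> 0"
  shows "norm (exp (\<i> * \<mu> * of_real a)) \<le> 1"
  using assms by simp

text \<open>
  The two branches \<open>g1\<close>, \<open>g2\<close> of the Green function $G(x,\cdot)$ on either side of \<open>x\<close>. The boundary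
  conditions of \<open>G\<close> are recorded by the pairing that makes the boundary terms of Green's identity
  cancel.
\<close>

definition green_branches ::
    "bc \<Rightarrow> complex \<Rightarrow> real \<Rightarrow> real \<Rightarrow> (real \<Rightarrow> complex) \<Rightarrow> (real \<Rightarrow> complex) \<Rightarrow>
      (real \<Rightarrow> complex) \<Rightarrow> (real \<Rightarrow> complex) \<Rightarrow> bool"
  where "green_branches bc z B x g1 dg1 g2 dg2 \<longleftrightarrow>
    (\<forall>t S. (g1 has_vector_derivative dg1 t) (at t within S)) \<and>
    (\<forall>t S. (dg1 has_vector_derivative - z * g1 t) (at t within S)) \<and>
    (\<forall>t S. (g2 has_vector_derivative dg2 t) (at t within S)) \<and>
    (\<forall>t S. (dg2 has_vector_derivative - z * g2 t) (at t within S)) \<and>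
    g1 x = g2 x \<and> dg2 x - dg1 x = 1 \<and>
    (\<forall>y u. satisfies_bc bc y u \<longrightarrow> g2 pi * u pi - dg2 pi * y pi = g1 0 * u 0 - dg1 0 * y 0) \<and>
    (\<forall>t\<in>{0..x}. norm (g1 t) \<le> B) \<and> (\<forall>t\<in>{x..pi}. norm (g2 t) \<le> B)"

lemma green_branches_periodic:
  assumes \<mu>: "Im \<mu> \<ge> 0" "\<mu> \<noteq> 0" and x: "x \<in> {0..pi}"
    and \<sigma>: "\<sigma> * \<sigma> = 1" "norm \<sigma> = 1"
    and bc: "\<And>y u. satisfies_bc bc y u \<Longrightarrow> y pi = \<sigma> * y 0 \<and> u pi = \<sigma> * u 0"
    and d: "1 - \<sigma> * exp (\<i> * \<mu> * pi) \<noteq> 0"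
  shows "\<exists>g1 dg1 g2 dg2. green_branches bc (\<mu>\<^sup>2) (1 / (norm \<mu> * norm (1 - \<sigma> * exp (\<i> * \<mu> * pi)))) x g1 dg1 g2 dg2"
proof -
  define E where "E a b t = exp (\<i> * \<mu> * of_real (a + b * t))" for a b t :: real
  define D where "D = 2 * \<i> * \<mu> * (1 - \<sigma> * exp (\<i> * \<mu> * pi))"
  have dE: "((\<lambda>t. E a b t) has_vector_derivative \<i> * \<mu> * of_real b * E a b t) (at t within S)" for a b t S
    unfolding E_def by (rule has_vector_derivative_exp_affine)
  have D0: "D \<noteq> 0" using \<mu> d by (simp add: D_def)
  have Ele: "norm (E a b t) \<le> 1" if "a + b * t \<ge> 0" for a b t
    unfolding E_def using norm_exp_affine_le[OF \<mu>(1) that] .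
  define g1 where "g1 t = (E x (-1) t + \<sigma> * E (pi - x) 1 t) / D" for t
  define dg1 where "dg1 t = \<i> * \<mu> * (- E x (-1) t + \<sigma> * E (pi - x) 1 t) / D" for t
  define g2 where "g2 t = (E (-x) 1 t + \<sigma> * E (pi + x) (-1) t) / D" for t
  define dg2 where "dg2 t = \<i> * \<mu> * (E (-x) 1 t - \<sigma> * E (pi + x) (-1) t) / D" for t
  have "norm (p + \<sigma> * q) / norm D \<le> 2 / norm D" if "norm p \<le> 1" "norm q \<le> 1" for p q
  proof -
    have "norm (p + \<sigma> * q) \<le> 1 + 1"
      using that \<sigma> by (intro norm_triangle_mono) (auto simp: norm_mult)
    then show ?thesis by (intro divide_right_mono) auto
  qed
  then have bound: "norm ((p + \<sigma> * q) / D) \<le> 1 / (norm \<mu> * norm (1 - \<sigma> * exp (\<i> * \<mu> * pi)))"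
    if "norm p \<le> 1" "norm q \<le> 1" for p q
    using that by (auto simp: norm_divide D_def norm_mult)
  have "green_branches bc (\<mu>\<^sup>2) (1 / (norm \<mu> * norm (1 - \<sigma> * exp (\<i> * \<mu> * pi)))) x g1 dg1 g2 dg2"
    unfolding green_branches_def
  proof (intro conjI allI impI ballI)
    fix t S
    show "(g1 has_vector_derivative dg1 t) (at t within S)"
      "(dg1 has_vector_derivative - \<mu>\<^sup>2 * g1 t) (at t within S)"
      "(g2 has_vector_derivative dg2 t) (at t within S)"
      "(dg2 has_vector_derivative - \<mu>\<^sup>2 * g2 t) (at t within S)"
      unfolding g1_def dg1_def g2_def dg2_def
      by (auto intro!: derivative_eq_intros dE simp: algebra_simps power2_eq_square)
  next
    show "g1 x = g2 x" by (simp add: g1_def g2_def E_def)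
    have "dg2 x - dg1 x = \<i> * \<mu> * (2 - 2 * \<sigma> * exp (\<i> * \<mu> * pi)) / D"
      by (simp add: dg1_def dg2_def E_def diff_divide_distrib[symmetric] algebra_simps)
    also have "\<dots> = D / D"
      by (simp add: D_def algebra_simps)
    finally show "dg2 x - dg1 x = 1" using D0 by simp
  next
    fix y u assume "satisfies_bc bc y u"
    then have yu: "y pi = \<sigma> * y 0" "u pi = \<sigma> * u 0"
      using bc by auto
    have "g2 pi = \<sigma> * g1 0" "dg2 pi = \<sigma> * dg1 0"
      using \<sigma>(1) by (auto simp: g1_def g2_def dg1_def dg2_def E_def algebra_simps)
    then have "g2 pi * u pi - dg2 pi * y pi = \<sigma> * \<sigma> * (g1 0 * u 0 - dg1 0 * y 0)"
      using yu by (simp add: algebra_simps)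
    then show "g2 pi * u pi - dg2 pi * y pi = g1 0 * u 0 - dg1 0 * y 0"
      using \<sigma>(1) by simp
  next
    fix t
    show "norm (g1 t) \<le> 1 / (norm \<mu> * norm (1 - \<sigma> * exp (\<i> * \<mu> * pi)))" if "t \<in> {0..x}"
      unfolding g1_def by (intro bound Ele) (use that x in auto)
    show "norm (g2 t) \<le> 1 / (norm \<mu> * norm (1 - \<sigma> * exp (\<i> * \<mu> * pi)))" if "t \<in> {x..pi}"
      unfolding g2_def by (intro bound Ele) (use that x in auto)
  qed
  then show ?thesis by blast
qed

text \<open>Method of images for reflection at 0 and \<open>pi\<close>: waves of distances
  \<open>|x - t|\<close> and \<open>2 pi - |x - t|\<close> minus waves of distances
  \<open>x + t\<close> and \<open>2 pi - x - t\<close>, which cancel at both end points. Compared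
  with a product of sines over \<open>sin (\<mu> pi)\<close>, this form uses only exponentials of
  norm at most 1 and yields \<open>4 / norm D\<close> at once.\<close>

lemma green_branches_Dir:
  assumes \<mu>: "Im \<mu> \<ge> 0" "\<mu> \<noteq> 0" and x: "x \<in> {0..pi}"
    and d: "1 - exp (2 * \<i> * \<mu> * pi) \<noteq> 0"
  shows "\<exists>g1 dg1 g2 dg2. green_branches Dir (\<mu>\<^sup>2) (2 / (norm \<mu> * norm (1 - exp (2 * \<i> * \<mu> * pi)))) x g1 dg1 g2 dg2"
proof -
  define E where "E a b t = exp (\<i> * \<mu> * of_real (a + b * t))" for a b t :: real
  define D where "D = 2 * \<i> * \<mu> * (1 - exp (2 * \<i> * \<mu> * pi))"
  have dE: "((\<lambda>t. E a b t) has_vector_derivative \<i> * \<mu> * of_real b * E a b t) (at t within S)" for a b t S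
    unfolding E_def by (rule has_vector_derivative_exp_affine)
  have D0: "D \<noteq> 0" using \<mu> d by (simp add: D_def)
  have Ele: "norm (E a b t) \<le> 1" if "a + b * t \<ge> 0" for a b t
    unfolding E_def using norm_exp_affine_le[OF \<mu>(1) that] .
  define g1 where "g1 t = (E x (-1) t + E (2 * pi - x) 1 t - E x 1 t - E (2 * pi - x) (-1) t) / D" for t
  define dg1 where "dg1 t = \<i> * \<mu> * (- E x (-1) t + E (2 * pi - x) 1 t - E x 1 t + E (2 * pi - x) (-1) t) / D" for t
  define g2 where "g2 t = (E (-x) 1 t + E (2 * pi + x) (-1) t - E x 1 t - E (2 * pi - x) (-1) t) / D" for t
  define dg2 where "dg2 t = \<i> * \<mu> * (E (-x) 1 t - E (2 * pi + x) (-1) t - E x 1 t + E (2 * pi - x) (-1) t) / D" for t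
  have bound: "norm ((p + q - r - s) / D) \<le> 2 / (norm \<mu> * norm (1 - exp (2 * \<i> * \<mu> * pi)))"
    if "norm p \<le> 1" "norm q \<le> 1" "norm r \<le> 1" "norm s \<le> 1" for p q r s
  proof -
    have "norm (p + q - r - s) \<le> norm p + norm q + norm r + norm s"
      by norm
    then have "norm (p + q - r - s) / norm D \<le> 4 / norm D"
      using that by (intro divide_right_mono) auto
    then show ?thesis by (simp add: norm_divide D_def norm_mult)
  qed
  have "green_branches Dir (\<mu>\<^sup>2) (2 / (norm \<mu> * norm (1 - exp (2 * \<i> * \<mu> * pi)))) x g1 dg1 g2 dg2"
    unfolding green_branches_def
  proof (intro conjI allI impI ballI)
    fix t S
    show "(g1 has_vector_derivative dg1 t) (at t within S)"
      "(dg1 has_vector_derivative - \<mu>\<^sup>2 * g1 t) (at t within S)"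
      "(g2 has_vector_derivative dg2 t) (at t within S)"
      "(dg2 has_vector_derivative - \<mu>\<^sup>2 * g2 t) (at t within S)"
      unfolding g1_def dg1_def g2_def dg2_def
      by (auto intro!: derivative_eq_intros dE simp: algebra_simps power2_eq_square)
  next
    show "g1 x = g2 x" by (simp add: g1_def g2_def E_def)
    have "dg2 x - dg1 x = \<i> * \<mu> * (2 - 2 * exp (2 * \<i> * \<mu> * pi)) / D"
      by (simp add: dg1_def dg2_def E_def diff_divide_distrib[symmetric] algebra_simps)
    also have "\<dots> = D / D"
      by (simp add: D_def algebra_simps)
    finally show "dg2 x - dg1 x = 1" using D0 by simp
  next
    fix y u assume "satisfies_bc Dir y u"
    moreover have "g2 pi = 0" "g1 0 = 0"
      by (auto simp: g1_def g2_def E_def algebra_simps)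
    ultimately show "g2 pi * u pi - dg2 pi * y pi = g1 0 * u 0 - dg1 0 * y 0"
      by simp
  next
    fix t
    show "norm (g1 t) \<le> 2 / (norm \<mu> * norm (1 - exp (2 * \<i> * \<mu> * pi)))" if "t \<in> {0..x}"
      unfolding g1_def by (intro bound Ele) (use that x in auto)
    show "norm (g2 t) \<le> 2 / (norm \<mu> * norm (1 - exp (2 * \<i> * \<mu> * pi)))" if "t \<in> {x..pi}"
      unfolding g2_def by (intro bound Ele) (use that x in auto)
  qed
  then show ?thesis by blast
qed

lemma green_branches_mono:
  "green_branches bc z B x g1 dg1 g2 dg2 \<Longrightarrow> B \<le> B' \<Longrightarrow> green_branches bc z B' x g1 dg1 g2 dg2"
  unfolding green_branches_def by (meson order_trans)

text \<open>One hypothesis serves all boundary conditions: with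
  \<open>q = exp (\<i> \<mu> pi)\<close>, \<open>1 - q^2 = (1 - \<sigma> q) (1 + \<sigma> q)\<close>
  and \<open>norm (1 + \<sigma> q) \<le> 2\<close>, so the periodic denominators are at least
  \<open>1/4\<close>; the Dirichlet one is at least \<open>1/2\<close>, with numerator 2. Either way
  the constant is 4.\<close>

lemma green_branches_exist:
  assumes \<mu>: "Im \<mu> \<ge> 0" "\<mu> \<noteq> 0" and x: "x \<in> {0..pi}"
    and d: "norm (1 - exp (2 * \<i> * \<mu> * pi)) \<ge> 1 / 2"
  shows "\<exists>g1 dg1 g2 dg2. green_branches bc (\<mu>\<^sup>2) (4 / norm \<mu>) x g1 dg1 g2 dg2"
proof -
  let ?q = "exp (\<i> * \<mu> * pi)"
  have q: "norm ?q \<le> 1"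
    using norm_exp_affine_le[OF \<mu>(1), of pi] by simp
  have per: "1 / 4 \<le> norm (1 - \<sigma> * ?q)" if "\<sigma> = 1 \<or> \<sigma> = -1" for \<sigma>
  proof -
    have "exp (2 * \<i> * \<mu> * pi) = ?q * ?q"
      by (simp add: mult_exp_exp mult.assoc)
    then have eq: "1 - exp (2 * \<i> * \<mu> * pi) = (1 - \<sigma> * ?q) * (1 + \<sigma> * ?q)"
      using that by (auto simp: algebra_simps)
    have "norm (1 + \<sigma> * ?q) \<le> 1 + 1"
      using q that by (intro norm_triangle_mono) (auto simp: norm_mult)
    then have "norm (1 - \<sigma> * ?q) * norm (1 + \<sigma> * ?q) \<le> norm (1 - \<sigma> * ?q) * 2"
      by (intro mult_left_mono) auto
    then show ?thesis
      using d unfolding eq norm_mult by linarith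
  qed
  have le: "c / (norm \<mu> * m) \<le> 4 / norm \<mu>" if "c / 4 \<le> m" "c > 0" for c m
    using that \<mu> by (simp add: field_simps)
  show ?thesis
  proof (cases bc)
    case Per_plus
    have "\<exists>g1 dg1 g2 dg2. green_branches Per_plus (\<mu>\<^sup>2) (1 / (norm \<mu> * norm (1 - 1 * ?q))) x g1 dg1 g2 dg2"
      by (rule green_branches_periodic[OF \<mu> x]) (use per[of 1] in auto)
    then show ?thesis
      using green_branches_mono[OF _ le[OF per[of 1]]] Per_plus by fastforce
  next
    case Per_minus
    have "\<exists>g1 dg1 g2 dg2. green_branches Per_minus (\<mu>\<^sup>2) (1 / (norm \<mu> * norm (1 - (-1) * ?q))) x g1 dg1 g2 dg2"
      by (rule green_branches_periodic[OF \<mu> x]) (use per[of "-1"] in auto)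
    then show ?thesis
      using green_branches_mono[OF _ le[OF per[of "-1"]]] Per_minus by fastforce
  next
    case Dir
    have "\<exists>g1 dg1 g2 dg2. green_branches Dir (\<mu>\<^sup>2) (2 / (norm \<mu> * norm (1 - exp (2 * \<i> * \<mu> * pi)))) x g1 dg1 g2 dg2"
      by (rule green_branches_Dir[OF \<mu> x]) (use d in auto)
    then show ?thesis
      using green_branches_mono[OF _ le[of 2]] d Dir by fastforce
  qed
qed

text \<open>On differentiating \<open>g u - dg y\<close> along the system, the terms with
  \<open>z\<close> and with \<open>dg u\<close> cancel and \<open>g f - Q (g y)'\<close> remains;
  integration over \<open>{a..b}\<close> gives the formula.\<close>

lemma green_identity:
  assumes sol: "hill_solution bc Q z f y u"
    and g: "\<And>t S. (g has_vector_derivative dg t) (at t within S)"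
      "\<And>t S. (dg has_vector_derivative - z * g t) (at t within S)"
    and ab: "0 \<le> a" "a \<le> b" "b \<le> pi"
    and Qi: "(\<lambda>t. Q t * (dg t * y t + g t * (u t + Q t * y t))) absolutely_integrable_on {a..b}"
  shows "ac_on a b (\<lambda>t. g t * y t) (\<lambda>t. dg t * y t + g t * (u t + Q t * y t))"
    and "((\<lambda>t. g t * f t) has_integral
      ((g b * u b - dg b * y b) - (g a * u a - dg a * y a)
        + integral {a..b} (\<lambda>t. Q t * (dg t * y t + g t * (u t + Q t * y t))))) {a..b}"
proof -
  let ?y' = "\<lambda>t. u t + Q t * y t" and ?u' = "\<lambda>t. f t - z * y t - Q t * (u t + Q t * y t)"
  have y: "ac_on a b y ?y'" and u: "ac_on a b u ?u'"
    using sol ab by (auto simp: hill_solution_def intro: ac_on_subinterval)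
  have cg: "continuous_on T g" "continuous_on T dg" for T
    using g by (auto intro!: continuous_on_vector_derivative)
  have acg: "ac_on a b g dg" "ac_on a b dg (\<lambda>t. - z * g t)"
    by (intro ac_on_has_vector_derivative g cg continuous_intros)+
  show "ac_on a b (\<lambda>t. g t * y t) (\<lambda>t. dg t * y t + g t * ?y' t)"
    by (rule ac_on_mult[OF acg(1) y ab(2)])
  have hi: "(h has_integral H b - H a) {a..b}" if "ac_on a b H h" for H h
    using ac_onD[OF that, of b] ab set_lebesgue_integral_eq_integral(1)[OF ac_on_integrable[OF that]]
    by (simp add: has_integral_integrable_integral)
  have "((\<lambda>t. (dg t * u t + g t * ?u' t) - (- z * g t * y t + dg t * ?y' t)
      + Q t * (dg t * y t + g t * ?y' t)) has_integral
      ((g b * u b - g a * u a) - (dg b * y b - dg a * y a)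
        + integral {a..b} (\<lambda>t. Q t * (dg t * y t + g t * ?y' t)))) {a..b}"
    by (intro has_integral_add has_integral_diff hi ac_on_mult acg y u ab integrable_integral
        set_lebesgue_integral_eq_integral(1)[OF Qi])
  moreover have "(\<lambda>t. (dg t * u t + g t * ?u' t) - (- z * g t * y t + dg t * ?y' t)
      + Q t * (dg t * y t + g t * ?y' t)) = (\<lambda>t. g t * f t)"
    by (simp add: fun_eq_iff algebra_simps)
  ultimately show "((\<lambda>t. g t * f t) has_integral
      ((g b * u b - dg b * y b) - (g a * u a - dg a * y a)
        + integral {a..b} (\<lambda>t. Q t * (dg t * y t + g t * ?y' t)))) {a..b}"
    by (simp add: algebra_simps)
qed

text \<open>
  The free Green function represents every solution up to $\int Q\,(G y)'$, the perturbation term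
  $-\int G y\,dQ$ after integration by parts.
\<close>

definition green_kernel :: "bc \<Rightarrow> complex \<Rightarrow> real \<Rightarrow> real \<Rightarrow> (real \<Rightarrow> complex) \<Rightarrow> bool"
  where "green_kernel bc z x B g \<longleftrightarrow>
    continuous_on {0..pi} g \<and> (\<forall>t\<in>{0..pi}. norm (g t) \<le> B) \<and>
    (\<forall>Q K f y u S. measure_potential Q K \<longrightarrow> hill_solution bc Q z f y u \<longrightarrow>
       (\<forall>t\<in>{0..pi}. norm (y t) \<le> S) \<longrightarrow>
       norm (y x - integral {0..pi} (\<lambda>t. g t * f t)) \<le> K * (B * S))"

text \<open>Sum of Green's identities on \<open>{0..x}\<close> and \<open>{x..pi}\<close>. The
  boundary terms at 0 and \<open>pi\<close> cancel by the pairing in \<open>green_branches\<close>;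
  at \<open>x\<close> the branches agree and the unit jump of the derivative leaves exactly
  \<open>y x\<close>. The two integrals with \<open>Q\<close> merge into one over the glued
  product.\<close>

lemma green_function:
  assumes \<mu>: "Im \<mu> \<ge> 0" "\<mu> \<noteq> 0" and x: "x \<in> {0..pi}"
    and d: "norm (1 - exp (2 * \<i> * \<mu> * pi)) \<ge> 1 / 2"
  obtains g where "green_kernel bc (\<mu>\<^sup>2) x (4 / norm \<mu>) g"
proof -
  obtain g1 dg1 g2 dg2 where G: "green_branches bc (\<mu>\<^sup>2) (4 / norm \<mu>) x g1 dg1 g2 dg2"
    using green_branches_exist[OF assms] by blast
  note G' = G[unfolded green_branches_def]
  have d1: "\<And>t S. (g1 has_vector_derivative dg1 t) (at t within S)"
      "\<And>t S. (dg1 has_vector_derivative - \<mu>\<^sup>2 * g1 t) (at t within S)"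
    and d2: "\<And>t S. (g2 has_vector_derivative dg2 t) (at t within S)"
      "\<And>t S. (dg2 has_vector_derivative - \<mu>\<^sup>2 * g2 t) (at t within S)"
    using G' by blast+
  have at_x: "g1 x = g2 x" "dg2 x - dg1 x = 1"
    and b1: "\<And>t. t \<in> {0..x} \<Longrightarrow> norm (g1 t) \<le> 4 / norm \<mu>"
    and b2: "\<And>t. t \<in> {x..pi} \<Longrightarrow> norm (g2 t) \<le> 4 / norm \<mu>"
    using G' by blast+
  have bc: "g2 pi * u pi - dg2 pi * y pi = g1 0 * u 0 - dg1 0 * y 0" if "satisfies_bc bc y u" for y u
    using G' that by blast
  define g where "g t = (if t \<le> x then g1 t else g2 t)" for t
  have "continuous_on ({0..x} \<union> {x..pi}) g"
    unfolding g_def using x at_x(1) continuous_on_vector_derivative[OF d1(1)]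
      continuous_on_vector_derivative[OF d2(1)]
    by (intro continuous_on_If) auto
  then have "continuous_on {0..pi} g"
    using x by (simp add: ivl_disj_un_two_touch)
  moreover have gB: "norm (g t) \<le> 4 / norm \<mu>" if "t \<in> {0..pi}" for t
    using b1 b2 that by (auto simp: g_def)
  moreover have "norm (y x - integral {0..pi} (\<lambda>t. g t * f t)) \<le> K * (4 / norm \<mu> * S)"
    if Q: "measure_potential Q K" and sol: "hill_solution bc Q (\<mu>\<^sup>2) f y u"
      and S: "\<And>t. t \<in> {0..pi} \<Longrightarrow> norm (y t) \<le> S" for Q K f y u S
  proof -
    let ?h = "\<lambda>g dg t. dg t * y t + g t * (u t + Q t * y t)"
    have y: "ac_on 0 pi y (\<lambda>t. u t + Q t * y t)"
      using sol by (simp add: hill_solution_def)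
    have Qi: "(\<lambda>t. Q t * ?h g dg t) absolutely_integrable_on {0..pi}"
      if "\<And>t S. (g has_vector_derivative dg t) (at t within S)"
        "\<And>t S. (dg has_vector_derivative - \<mu>\<^sup>2 * g t) (at t within S)" for g dg
    proof -
      have "ac_on 0 pi g dg"
        by (intro ac_on_has_vector_derivative that continuous_on_vector_derivative[OF that(2)])
      then show ?thesis
        by (intro measure_potential_mult_integrable[OF Q] ac_on_integrable[OF ac_on_mult[OF _ y]]) auto
    qed
    have Q1: "(\<lambda>t. Q t * ?h g1 dg1 t) absolutely_integrable_on {0..x}"
      by (rule absolutely_integrable_on_subinterval[OF Qi[OF d1]]) (use x in auto)
    have Q2: "(\<lambda>t. Q t * ?h g2 dg2 t) absolutely_integrable_on {x..pi}"
      by (rule absolutely_integrable_on_subinterval[OF Qi[OF d2]]) (use x in auto)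
    note I1 = green_identity[OF sol d1 _ _ _ Q1] and I2 = green_identity[OF sol d2 _ _ _ Q2]
    let ?\<phi> = "\<lambda>t. if t \<le> x then g1 t * y t else g2 t * y t"
    let ?\<phi>' = "\<lambda>t. if t \<le> x then ?h g1 dg1 t else ?h g2 dg2 t"
    have ac: "ac_on 0 pi ?\<phi> ?\<phi>'"
      by (rule ac_on_combine[OF I1(1) I2(1)]) (use x at_x in auto)
    have "((\<lambda>t. g t * f t) has_integral
        ((g1 x * u x - dg1 x * y x) - (g1 0 * u 0 - dg1 0 * y 0)
          + integral {0..x} (\<lambda>t. Q t * ?h g1 dg1 t)) +
        ((g2 pi * u pi - dg2 pi * y pi) - (g2 x * u x - dg2 x * y x)
          + integral {x..pi} (\<lambda>t. Q t * ?h g2 dg2 t))) {0..pi}"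
    proof (rule has_integral_combine)
      show "((\<lambda>t. g t * f t) has_integral
        ((g1 x * u x - dg1 x * y x) - (g1 0 * u 0 - dg1 0 * y 0)
          + integral {0..x} (\<lambda>t. Q t * ?h g1 dg1 t))) {0..x}"
        by (rule has_integral_eq[OF _ I1(2)]) (use x in \<open>auto simp: g_def\<close>)
      show "((\<lambda>t. g t * f t) has_integral
        ((g2 pi * u pi - dg2 pi * y pi) - (g2 x * u x - dg2 x * y x)
          + integral {x..pi} (\<lambda>t. Q t * ?h g2 dg2 t))) {x..pi}"
        by (rule has_integral_eq[OF _ I2(2)]) (use x at_x in \<open>auto simp: g_def\<close>)
    qed (use x in auto)
    then have "integral {0..pi} (\<lambda>t. g t * f t) =
        ((g1 x * u x - dg1 x * y x) - (g1 0 * u 0 - dg1 0 * y 0)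
          + integral {0..x} (\<lambda>t. Q t * ?h g1 dg1 t)) +
        ((g2 pi * u pi - dg2 pi * y pi) - (g2 x * u x - dg2 x * y x)
          + integral {x..pi} (\<lambda>t. Q t * ?h g2 dg2 t))"
      by (rule integral_unique)
    also have "\<dots> = y x * (dg2 x - dg1 x)
        + (integral {0..x} (\<lambda>t. Q t * ?h g1 dg1 t) + integral {x..pi} (\<lambda>t. Q t * ?h g2 dg2 t))"
      using bc[of y u] sol at_x(1) by (simp add: hill_solution_def algebra_simps)
    also have "integral {0..x} (\<lambda>t. Q t * ?h g1 dg1 t) + integral {x..pi} (\<lambda>t. Q t * ?h g2 dg2 t)
        = integral {0..pi} (\<lambda>t. Q t * ?\<phi>' t)"
    proof -
      have "((\<lambda>t. Q t * ?\<phi>' t) has_integral integral {0..x} (\<lambda>t. Q t * ?h g1 dg1 t)) {0..x}"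
        by (rule has_integral_eq[OF _ integrable_integral[OF set_lebesgue_integral_eq_integral(1)[OF Q1]]]) auto
      moreover have "((\<lambda>t. Q t * ?\<phi>' t) has_integral integral {x..pi} (\<lambda>t. Q t * ?h g2 dg2 t)) {x..pi}"
        by (rule has_integral_spike[of "{x}" _ _ "\<lambda>t. Q t * ?h g2 dg2 t"])
           (auto intro!: integrable_integral[OF set_lebesgue_integral_eq_integral(1)[OF Q2]])
      ultimately show ?thesis
        by (intro integral_unique[symmetric] has_integral_combine[of 0 x pi]) (use x in auto)
    qed
    finally have "norm (y x - integral {0..pi} (\<lambda>t. g t * f t)) = norm (integral {0..pi} (\<lambda>t. Q t * ?\<phi>' t))"
      using at_x(2) by simp
    \<comment> \<open>\<open>?\<phi>\<close> is the product \<open>g * y\<close>, and only its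
      supremum is asked for; its derivative, which contains \<open>u\<close>, is never
      estimated.\<close>
    also have "\<dots> \<le> K * (4 / norm \<mu> * S)"
    proof (rule measure_potentialD(4)[OF Q ac])
      fix t assume t: "t \<in> {0..pi}"
      have "?\<phi> t = g t * y t" by (simp add: g_def)
      moreover have "norm (g t * y t) \<le> 4 / norm \<mu> * S"
        unfolding norm_mult by (rule mult_mono[OF gB[OF t] S[OF t]]) auto
      ultimately show "norm (?\<phi> t) \<le> 4 / norm \<mu> * S" by simp
    qed
    finally show ?thesis .
  qed
  ultimately have "green_kernel bc (\<mu>\<^sup>2) x (4 / norm \<mu>) g"
    unfolding green_kernel_def by blast
  then show ?thesis by (rule that)
qed

section \<open>Initial value problems and the Fredholm alternative\<close>

text \<open>
  Contraction in the norm $\sup_x e^{-2Mx}|Y(x)|$; the bounded continuous function \<open>\<phi>\<close> of the proof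
  is $e^{-2Mx}Y(x)$.
\<close>

lemma linear_volterra_equation:
  fixes A :: "real \<Rightarrow> 'e::euclidean_space \<Rightarrow> 'e"
  assumes M: "M > 0" and T: "T \<ge> 0"
    and lip: "\<And>t v w. t \<in> {0..T} \<Longrightarrow> norm (A t v - A t w) \<le> M * norm (v - w)"
    and A0: "\<And>t. A t 0 = 0"
    and int: "\<And>Y. continuous_on {0..T} Y \<Longrightarrow> (\<lambda>t. A t (Y t)) integrable_on {0..T}"
    and F: "continuous_on {0..T} F" "\<And>t. t \<in> {0..T} \<Longrightarrow> norm (F t) \<le> b"
  obtains Y where "continuous_on {0..T} Y"
    "\<And>x. x \<in> {0..T} \<Longrightarrow> Y x = F x + integral {0..x} (\<lambda>t. A t (Y t))"
    "\<And>x. x \<in> {0..T} \<Longrightarrow> norm (Y x) \<le> 2 * exp (2 * M * T) * b"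
proof -
  have b0: "b \<ge> 0" by (rule order_trans[OF norm_ge_zero F(2)[of 0]]) (use T in auto)
  let ?e = "\<lambda>t. exp (2 * M * t)"
  \<comment> \<open>The exponent \<open>2 * M\<close> is chosen so that integrating
    \<open>M * exp (2 * M * t)\<close> produces the factor \<open>1/2\<close>, the contraction
    constant.\<close>
  have weight: "exp (- (2 * M * x)) * norm (integral {0..x} h) \<le> k / 2"
    if x: "x \<in> {0..T}" and h: "h integrable_on {0..x}"
      and le: "\<And>t. t \<in> {0..x} \<Longrightarrow> norm (h t) \<le> M * (?e t * k)" and k: "k \<ge> 0" for x k and h :: "real \<Rightarrow> 'e"
  proof -
    have "((\<lambda>t. ?e t * k / 2) has_vector_derivative M * (?e t * k)) (at t within {0..x})" for t
      unfolding has_real_derivative_iff_has_vector_derivative[symmetric]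
      by (auto intro!: derivative_eq_intros)
    then have "((\<lambda>t. M * (?e t * k)) has_integral (?e x * k / 2 - ?e 0 * k / 2)) {0..x}"
      by (intro fundamental_theorem_of_calculus) (use x in auto)
    moreover have "?e x * k / 2 - ?e 0 * k / 2 = (?e x - 1) * k / 2"
      by (simp add: algebra_simps diff_divide_distrib)
    ultimately have i: "(\<lambda>t. M * (?e t * k)) integrable_on {0..x}"
        "integral {0..x} (\<lambda>t. M * (?e t * k)) = (?e x - 1) * k / 2"
      by (simp_all add: has_integral_iff)
    have "norm (integral {0..x} h) \<le> (?e x - 1) * k / 2"
      unfolding i(2)[symmetric] by (rule integral_norm_bound_integral[OF h i(1) le])
    then have "exp (- (2 * M * x)) * norm (integral {0..x} h) \<le> exp (- (2 * M * x)) * ((?e x - 1) * k / 2)"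
      by (rule mult_left_mono) simp
    also have "\<dots> = (exp (- (2 * M * x)) * ?e x - exp (- (2 * M * x))) * (k / 2)"
      by (simp only: left_diff_distrib right_diff_distrib mult.assoc times_divide_eq_right mult_1)
    also have "exp (- (2 * M * x)) * ?e x = 1"
      by (simp add: mult_exp_exp)
    also have "(1 - exp (- (2 * M * x))) * (k / 2) \<le> 1 * (k / 2)"
      using k by (intro mult_right_mono) auto
    finally show ?thesis by simp
  qed
  define I where "I \<phi> x = integral {0..x} (\<lambda>t. A t (?e t *\<^sub>R \<phi> t))" for \<phi> :: "real \<Rightarrow> 'e" and x
  have Aint: "(\<lambda>t. A t (?e t *\<^sub>R apply_bcontfun \<phi> t)) integrable_on {0..T}" for \<phi>
    by (intro int continuous_intros continuous_on_apply_bcontfun)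
  then have Aint_sub: "(\<lambda>t. A t (?e t *\<^sub>R apply_bcontfun \<phi> t)) integrable_on {0..x}" if "x \<in> {0..T}" for \<phi> x
    by (rule integrable_subinterval_real) (use that in auto)
  \<comment> \<open>Clamping the argument turns continuous functions on \<open>{0..T}\<close> into
    bounded continuous functions on the whole line, so that the fixed point can be sought in a
    complete function space.\<close>
  have "\<exists>g :: real \<Rightarrow>\<^sub>C 'e. \<forall>x. g x = exp (- (2 * M * clamp 0 T x)) *\<^sub>R (F (clamp 0 T x) + I \<phi> (clamp 0 T x))"
    for \<phi> :: "real \<Rightarrow>\<^sub>C 'e"
  proof -
    have "continuous_on (cbox 0 T) (\<lambda>x. exp (- (2 * M * x)) *\<^sub>R (F x + I \<phi> x))"
      unfolding I_def cbox_interval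
      by (intro continuous_intros F indefinite_integral_continuous_1 Aint)
    from continuous_on_cbox_bcontfunE[OF this] show ?thesis by metis
  qed
  then obtain G :: "(real \<Rightarrow>\<^sub>C 'e) \<Rightarrow> (real \<Rightarrow>\<^sub>C 'e)" where
    G: "\<And>\<phi> x. G \<phi> x = exp (- (2 * M * clamp 0 T x)) *\<^sub>R (F (clamp 0 T x) + I \<phi> (clamp 0 T x))"
    by metis
  have clamp: "clamp 0 T x \<in> {0..T}" for x
    using clamp_in_interval[of 0 T x] T by simp
  have "dist (G \<phi>) (G \<psi>) \<le> 1 / 2 * dist \<phi> \<psi>" for \<phi> \<psi>
  proof (rule dist_bound)
    fix x
    let ?x = "clamp 0 T x"
    have "dist (G \<phi> x) (G \<psi> x) = exp (- (2 * M * ?x)) * norm (I \<phi> ?x - I \<psi> ?x)"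
      unfolding G dist_norm by (simp add: scaleR_diff_right[symmetric])
    also have "I \<phi> ?x - I \<psi> ?x = integral {0..?x} (\<lambda>t. A t (?e t *\<^sub>R \<phi> t) - A t (?e t *\<^sub>R \<psi> t))"
      unfolding I_def by (intro Henstock_Kurzweil_Integration.integral_diff[symmetric] Aint_sub clamp)
    also have "exp (- (2 * M * ?x)) * norm \<dots> \<le> dist \<phi> \<psi> / 2"
    proof (rule weight[OF clamp])
      fix t assume t: "t \<in> {0..?x}"
      have "norm (A t (?e t *\<^sub>R \<phi> t) - A t (?e t *\<^sub>R \<psi> t)) \<le> M * norm (?e t *\<^sub>R \<phi> t - ?e t *\<^sub>R \<psi> t)"
        using t clamp[of x] by (intro lip) auto
      also have "norm (?e t *\<^sub>R \<phi> t - ?e t *\<^sub>R \<psi> t) = ?e t * dist (\<phi> t) (\<psi> t)"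
        by (simp add: scaleR_diff_right[symmetric] dist_norm)
      also have "\<dots> \<le> ?e t * dist \<phi> \<psi>"
        by (intro mult_left_mono dist_bounded) auto
      finally show "norm (A t (?e t *\<^sub>R \<phi> t) - A t (?e t *\<^sub>R \<psi> t)) \<le> M * (?e t * dist \<phi> \<psi>)"
        using M by simp
    qed (auto intro!: integrable_diff Aint_sub clamp)
    finally show "dist (G \<phi> x) (G \<psi> x) \<le> 1 / 2 * dist \<phi> \<psi>" by simp
  qed
  then obtain \<phi> where \<phi>: "G \<phi> = \<phi>"
    using banach_fix_type[of "1 / 2" G] by auto
  define Y where "Y t = ?e t *\<^sub>R \<phi> t" for t
  have fixp: "\<phi> x = exp (- (2 * M * x)) *\<^sub>R (F x + I \<phi> x)" if "x \<in> {0..T}" for x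
    using G[of \<phi> x] that clamp_cancel_cbox[of x 0 T] unfolding \<phi> by simp
  have I: "I \<phi> x = integral {0..x} (\<lambda>t. A t (Y t))" for x
    unfolding I_def Y_def ..
  \<comment> \<open>A priori bound by the same weighted estimate, comparing with
    \<open>A t 0 = 0\<close>; half of the norm is absorbed, hence the factor 2 in the
    conclusion.\<close>
  have "norm \<phi> \<le> b + norm \<phi> / 2"
  proof (rule norm_bound)
    fix x
    let ?x = "clamp 0 T x"
    have "exp (- (2 * M * ?x)) * norm (I \<phi> ?x) \<le> norm \<phi> / 2"
      unfolding I_def
    proof (rule weight[OF clamp])
      fix t assume t: "t \<in> {0..?x}"
      have "norm (A t (?e t *\<^sub>R \<phi> t) - A t 0) \<le> M * norm (?e t *\<^sub>R \<phi> t - 0)"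
        using t clamp[of x] by (intro lip) auto
      also have "\<dots> \<le> M * (?e t * norm \<phi>)"
        using M norm_bounded[of \<phi> t] by (auto intro!: mult_left_mono)
      finally show "norm (A t (?e t *\<^sub>R \<phi> t)) \<le> M * (?e t * norm \<phi>)"
        by (simp add: A0)
    qed (auto intro!: Aint_sub clamp)
    moreover have "exp (- (2 * M * ?x)) * norm (F ?x) \<le> 1 * b"
      using M clamp[of x] b0 by (intro mult_mono F) auto
    ultimately have "exp (- (2 * M * ?x)) * (norm (F ?x) + norm (I \<phi> ?x)) \<le> b + norm \<phi> / 2"
      by (simp add: distrib_left)
    moreover have "norm (\<phi> x) \<le> exp (- (2 * M * ?x)) * (norm (F ?x) + norm (I \<phi> ?x))"
      using G[of \<phi> x] norm_triangle_ineq[of "F ?x" "I \<phi> ?x"] unfolding \<phi> by simp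
    ultimately show "norm (\<phi> x) \<le> b + norm \<phi> / 2" by linarith
  qed
  then have b: "norm \<phi> \<le> 2 * b" by simp
  show ?thesis
  proof (rule that)
    show "continuous_on {0..T} Y"
      unfolding Y_def by (intro continuous_intros continuous_on_apply_bcontfun)
    fix x assume x: "x \<in> {0..T}"
    show "Y x = F x + integral {0..x} (\<lambda>t. A t (Y t))"
    proof -
      have "Y x = F x + I \<phi> x"
        unfolding Y_def fixp[OF x] by (simp add: mult_exp_exp)
      then show ?thesis by (simp only: I)
    qed
    have "norm (Y x) = ?e x * norm (\<phi> x)"
      by (simp add: Y_def)
    also have "\<dots> \<le> exp (2 * M * T) * (2 * b)"
      using M x norm_bounded[of \<phi> x] b by (intro mult_mono) auto
    finally show "norm (Y x) \<le> 2 * exp (2 * M * T) * b" by simp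
  qed
qed

section \<open>The system with prescribed initial values, then with boundary conditions\<close>

definition L1_mass :: "(real \<Rightarrow> complex) \<Rightarrow> real"
  where "L1_mass f = integral {0..pi} (\<lambda>t. norm (f t))"

definition hill_system ::
    "(real \<Rightarrow> complex) \<Rightarrow> complex \<Rightarrow> (real \<Rightarrow> complex) \<Rightarrow> (real \<Rightarrow> complex) \<Rightarrow> (real \<Rightarrow> complex) \<Rightarrow> bool"
  where "hill_system Q z f y u \<longleftrightarrow> ac_on 0 pi y (\<lambda>t. u t + Q t * y t) \<and>
    ac_on 0 pi u (\<lambda>t. f t - z * y t - Q t * (u t + Q t * y t))"

text \<open>As \<open>Q\<close> is bounded, the system for the pair of \<open>y\<close> and
  \<open>u\<close> has bounded coefficients, and \<open>f\<close> enters only through its primitive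
  in the inhomogeneity \<open>F\<close>. The bound therefore depends on \<open>f\<close> through its
  mass alone, with \<open>C\<close> chosen before \<open>f\<close>, \<open>a\<close> and
  \<open>b\<close>.\<close>

lemma hill_initial_value_problem:
  assumes Q: "measure_potential Q K"
  obtains C where "C \<ge> 0"
    "\<And>f a b. f absolutely_integrable_on {0..pi} \<Longrightarrow>
      \<exists>y u. hill_system Q z f y u \<and> y 0 = a \<and> u 0 = b \<and>
        (\<forall>x\<in>{0..pi}. norm (y x) \<le> C * (norm a + norm b + L1_mass f) \<and>
                     norm (u x) \<le> C * (norm a + norm b + L1_mass f))"
proof -
  obtain q where q: "\<And>x. x \<in> {0..pi} \<Longrightarrow> norm (Q x) \<le> q"
    using measure_potentialD(2)[OF Q] unfolding bounded_iff by blast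
  have q0: "q \<ge> 0" by (rule order_trans[OF norm_ge_zero q[of 0]]) auto
  \<comment> \<open>The bounds of the two components of \<open>A t\<close>, added because the norm
    of a pair is at most the sum: \<open>1 + q\<close> for the first,
    \<open>norm z + q * (1 + q)\<close> for the second.\<close>
  define M where "M = (1 + q) + (norm z + q * (1 + q))"
  define A where "A t v = (snd v + Q t * fst v, - z * fst v - Q t * (snd v + Q t * fst v))"
    for t and v :: "complex \<times> complex"
  have M: "M > 0" unfolding M_def using q0 by (intro add_pos_nonneg) auto
  have A_diff: "A t v - A t w = A t (v - w)" for t v w
    by (simp add: A_def algebra_simps)
  have A_le: "norm (A t v) \<le> M * norm v" if "t \<in> {0..pi}" for t v
  proof -
    have 1: "norm (snd v + Q t * fst v) \<le> (1 + q) * norm v"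
    proof -
      have "norm (snd v + Q t * fst v) \<le> norm v + q * norm v"
        unfolding norm_mult[symmetric] using q[OF that] q0 norm_fst_le[of "fst v" "snd v"] norm_snd_le[of "snd v" "fst v"]
        by (intro norm_triangle_mono) (auto simp: norm_mult intro!: mult_mono)
      then show ?thesis by (simp add: algebra_simps)
    qed
    have "norm (- z * fst v - Q t * (snd v + Q t * fst v)) \<le> norm z * norm v + q * ((1 + q) * norm v)"
      using 1 q[OF that] q0 norm_fst_le[of "fst v" "snd v"]
      by (intro order_trans[OF norm_triangle_ineq4] add_mono) (auto simp: norm_mult intro!: mult_mono)
    then have "norm (A t v) \<le> (1 + q) * norm v + (norm z * norm v + q * ((1 + q) * norm v))"
      unfolding A_def using 1 by (intro order_trans[OF norm_Pair_le] add_mono)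
    then show ?thesis by (simp add: M_def algebra_simps)
  qed
  have A_int: "(\<lambda>t. A t (Y t)) integrable_on {0..pi}" if Y: "continuous_on {0..pi} Y" for Y
  proof -
    have fs: "(\<lambda>t. fst (Y t)) absolutely_integrable_on {0..pi}" "(\<lambda>t. snd (Y t)) absolutely_integrable_on {0..pi}"
      using Y by (auto intro!: absolutely_integrable_continuous_real continuous_intros)
    have 1: "(\<lambda>t. snd (Y t) + Q t * fst (Y t)) absolutely_integrable_on {0..pi}"
      by (intro set_integral_add(1) fs measure_potential_mult_integrable[OF Q])
    have 2: "(\<lambda>t. - z * fst (Y t) - Q t * (snd (Y t) + Q t * fst (Y t))) absolutely_integrable_on {0..pi}"
      by (intro set_integral_diff(1) measure_potential_mult_integrable[OF Q 1]
          absolutely_integrable_continuous_mult[OF continuous_on_const] fs)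
    have bl: "bounded_linear (\<lambda>x::complex. (x, 0::complex))" "bounded_linear (\<lambda>x::complex. (0::complex, x))"
      by (intro bounded_linear_Pair bounded_linear_ident bounded_linear_zero)+
    have "(\<lambda>t. (snd (Y t) + Q t * fst (Y t), 0) + (0, - z * fst (Y t) - Q t * (snd (Y t) + Q t * fst (Y t))))
        integrable_on {0..pi}"
      using integrable_linear[OF set_lebesgue_integral_eq_integral(1)[OF 1] bl(1)]
        integrable_linear[OF set_lebesgue_integral_eq_integral(1)[OF 2] bl(2)]
      by (intro integrable_add) (simp_all add: o_def)
    then show ?thesis by (simp add: A_def)
  qed
  define C where "C = 2 * exp (2 * M * pi)"
  have C: "C \<ge> 0" by (simp add: C_def)
  moreover have "\<exists>y u. hill_system Q z f y u \<and> y 0 = a \<and> u 0 = b \<and>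
        (\<forall>x\<in>{0..pi}. norm (y x) \<le> C * (norm a + norm b + L1_mass f) \<and>
                     norm (u x) \<le> C * (norm a + norm b + L1_mass f))"
    if f: "f absolutely_integrable_on {0..pi}" for f a b
  proof -
    have fi: "f integrable_on {0..pi}" "(\<lambda>t. norm (f t)) integrable_on {0..pi}"
      using f by (auto simp: absolutely_integrable_on_def)
    define F where "F x = (a, b + integral {0..x} f)" for x
    have Fc: "continuous_on {0..pi} F"
      unfolding F_def by (intro continuous_intros indefinite_integral_continuous_1 fi)
    let ?n = "norm a + norm b + integral {0..pi} (\<lambda>t. norm (f t))"
    have Fb: "norm (F x) \<le> ?n" if x: "x \<in> {0..pi}" for x
    proof -
      have sub: "f integrable_on {0..x}" "(\<lambda>t. norm (f t)) integrable_on {0..x}"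
        by (rule integrable_subinterval_real[OF fi(1)] integrable_subinterval_real[OF fi(2)]; use x in auto)+
      have "norm (integral {0..x} f) \<le> integral {0..x} (\<lambda>t. norm (f t))"
        using sub by (intro integral_norm_bound_integral) auto
      also have "\<dots> \<le> integral {0..pi} (\<lambda>t. norm (f t))"
        using x by (intro integral_subset_le sub fi) auto
      finally have i: "norm (integral {0..x} f) \<le> integral {0..pi} (\<lambda>t. norm (f t))" .
      have "norm (F x) \<le> norm a + norm (b + integral {0..x} f)"
        unfolding F_def by (rule norm_Pair_le)
      also have "\<dots> \<le> norm a + (norm b + norm (integral {0..x} f))"
        by (intro add_left_mono norm_triangle_ineq)
      finally show ?thesis using i by linarith
    qed
    obtain Y where Y: "continuous_on {0..pi} Y"
      "\<And>x. x \<in> {0..pi} \<Longrightarrow> Y x = F x + integral {0..x} (\<lambda>t. A t (Y t))"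
      "\<And>x. x \<in> {0..pi} \<Longrightarrow> norm (Y x) \<le> 2 * exp (2 * M * pi) * ?n"
    proof (rule linear_volterra_equation[of M pi A F ?n])
      show "norm (A t v - A t w) \<le> M * norm (v - w)" if "t \<in> {0..pi}" for t v w
        unfolding A_diff by (rule A_le[OF that])
      show "A t 0 = 0" for t
        by (simp add: A_def zero_prod_def)
    qed (use M A_int Fc Fb in auto)
    define y where "y t = fst (Y t)" for t
    define u where "u t = snd (Y t)" for t
    have AY: "A t (Y t) = (u t + Q t * y t, - z * y t - Q t * (u t + Q t * y t))" for t
      by (simp add: A_def y_def u_def)
    have comp: "y x = a + integral {0..x} (\<lambda>t. u t + Q t * y t)"
      "u x = b + integral {0..x} (\<lambda>t. f t - z * y t - Q t * (u t + Q t * y t))" if x: "x \<in> {0..pi}" for x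
    proof -
      have i: "(\<lambda>t. A t (Y t)) integrable_on {0..x}"
        by (rule integrable_subinterval_real[OF A_int[OF Y(1)]]) (use x in auto)
      have fx: "f integrable_on {0..x}"
        by (rule integrable_subinterval_real[OF fi(1)]) (use x in auto)
      have "fst (integral {0..x} (\<lambda>t. A t (Y t))) = integral {0..x} (\<lambda>t. u t + Q t * y t)"
        using integral_linear[OF i bounded_linear_fst] by (simp add: o_def AY)
      then show "y x = a + integral {0..x} (\<lambda>t. u t + Q t * y t)"
        using Y(2)[OF x] by (simp add: y_def F_def)
      have "snd (integral {0..x} (\<lambda>t. A t (Y t))) = integral {0..x} (\<lambda>t. - z * y t - Q t * (u t + Q t * y t))"
        using integral_linear[OF i bounded_linear_snd] by (simp add: o_def AY)
      moreover have "(\<lambda>t. - z * y t - Q t * (u t + Q t * y t)) integrable_on {0..x}"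
        using integrable_linear[OF i bounded_linear_snd] by (simp add: o_def AY)
      then have "integral {0..x} (\<lambda>t. f t + (- z * y t - Q t * (u t + Q t * y t)))
          = integral {0..x} f + integral {0..x} (\<lambda>t. - z * y t - Q t * (u t + Q t * y t))"
        by (intro Henstock_Kurzweil_Integration.integral_add fx)
      moreover have "(\<lambda>t. f t + (- z * y t - Q t * (u t + Q t * y t))) = (\<lambda>t. f t - z * y t - Q t * (u t + Q t * y t))"
        by (simp add: fun_eq_iff)
      ultimately show "u x = b + integral {0..x} (\<lambda>t. f t - z * y t - Q t * (u t + Q t * y t))"
        using Y(2)[OF x] by (simp add: u_def F_def)
    qed
    have c: "continuous_on {0..pi} y" "continuous_on {0..pi} u"
      unfolding y_def u_def by (intro continuous_intros Y(1))+
    note cy = absolutely_integrable_continuous_real[OF c(1)] and cu = absolutely_integrable_continuous_real[OF c(2)]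
    have y': "(\<lambda>t. u t + Q t * y t) absolutely_integrable_on {0..pi}"
      by (intro set_integral_add(1) cu measure_potential_mult_integrable[OF Q] cy)
    have u': "(\<lambda>t. f t - z * y t - Q t * (u t + Q t * y t)) absolutely_integrable_on {0..pi}"
      by (intro set_integral_diff(1) f measure_potential_mult_integrable[OF Q y']
          absolutely_integrable_continuous_mult[OF continuous_on_const cy])
    have init: "y 0 = a" "u 0 = b"
      using comp[of 0] by auto
    have "norm (y x) \<le> C * ?n \<and> norm (u x) \<le> C * ?n" if "x \<in> {0..pi}" for x
      using Y(3)[OF that] norm_fst_le[of "y x" "u x"] norm_snd_le[of "u x" "y x"]
      by (auto simp: C_def y_def u_def)
    moreover have "ac_on 0 pi y (\<lambda>t. u t + Q t * y t)"
      "ac_on 0 pi u (\<lambda>t. f t - z * y t - Q t * (u t + Q t * y t))"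
      unfolding ac_on_def init using y' u' comp by blast+
    ultimately show ?thesis
      unfolding hill_system_def L1_mass_def using init by blast
  qed
  ultimately show ?thesis using that by blast
qed

text \<open>Encodes the boundary conditions as the kernel of a linear map of the boundary data, so
  that imposing them amounts to a two by two linear system.\<close>

fun bc_defect :: "bc \<Rightarrow> (real \<Rightarrow> complex) \<Rightarrow> (real \<Rightarrow> complex) \<Rightarrow> complex \<times> complex"
  where
    "bc_defect Per_plus y u = (y pi - y 0, u pi - u 0)"
  | "bc_defect Per_minus y u = (y pi + y 0, u pi + u 0)"
  | "bc_defect Dir y u = (y 0, y pi)"

lemma bc_defect_eq_0_iff: "bc_defect bc y u = 0 \<longleftrightarrow> satisfies_bc bc y u"
  by (cases bc) (auto simp: zero_prod_def eq_neg_iff_add_eq_0)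

lemma bc_defect_combination:
  "bc_defect bc (\<lambda>t. y t + a * y1 t + b * y2 t) (\<lambda>t. u t + a * u1 t + b * u2 t) =
    bc_defect bc y u + (a * fst (bc_defect bc y1 u1) + b * fst (bc_defect bc y2 u2),
      a * snd (bc_defect bc y1 u1) + b * snd (bc_defect bc y2 u2))"
  by (cases bc) (auto simp: algebra_simps)

lemma bc_defect_bound:
  assumes "\<And>x. x \<in> {0..pi} \<Longrightarrow> norm (y x) \<le> B" "\<And>x. x \<in> {0..pi} \<Longrightarrow> norm (u x) \<le> B"
  shows "norm (bc_defect bc y u) \<le> 4 * B"
proof -
  have *: "norm (y 0) \<le> B" "norm (y pi) \<le> B" "norm (u 0) \<le> B" "norm (u pi) \<le> B"
    using assms by auto
  have B: "0 \<le> B" by (rule order_trans[OF norm_ge_zero *(1)])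
  show ?thesis
  proof (cases bc)
    case Per_plus
    show ?thesis unfolding Per_plus bc_defect.simps
      using * by (intro order_trans[OF norm_Pair_le]) norm
  next
    case Per_minus
    show ?thesis unfolding Per_minus bc_defect.simps
      using * by (intro order_trans[OF norm_Pair_le]) norm
  next
    case Dir
    show ?thesis unfolding Dir bc_defect.simps
      using * B by (intro order_trans[OF norm_Pair_le]) linarith
  qed
qed

text \<open>Shooting: a solution with zero initial data is corrected by a combination of two
  fundamental solutions until its boundary defect vanishes. A kernel vector of the map
  \<open>L\<close> from coefficients to defects would give an eigenfunction, so \<open>L\<close> is
  injective, hence surjective in finite dimension, and its lower bound \<open>B\<close> controls the
  size of the correction.\<close>

lemma hill_solvable:
  assumes Q: "measure_potential Q K" and z: "\<not> eigenvalue bc Q z"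
  obtains C where "C \<ge> 0"
    "\<And>f. f absolutely_integrable_on {0..pi} \<Longrightarrow>
      \<exists>y u. hill_solution bc Q z f y u \<and>
        (\<forall>x\<in>{0..pi}. norm (y x) \<le> C * L1_mass f)"
proof -
  obtain C where C: "C \<ge> 0"
    and ivp: "\<And>f a b. f absolutely_integrable_on {0..pi} \<Longrightarrow>
      \<exists>y u. hill_system Q z f y u \<and> y 0 = a \<and> u 0 = b \<and>
        (\<forall>x\<in>{0..pi}. norm (y x) \<le> C * (norm a + norm b + L1_mass f) \<and>
                     norm (u x) \<le> C * (norm a + norm b + L1_mass f))"
    by (rule hill_initial_value_problem[OF Q, of z]) (rule that, assumption+)
  have sol_comb: "hill_system Q z (\<lambda>t. f t + c * g t) (\<lambda>t. y t + c * v t) (\<lambda>t. u t + c * w t)"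
    if "hill_system Q z f y u" "hill_system Q z g v w" for f y u g v w c
    using ac_on_add_scale[of 0 pi y "\<lambda>t. u t + Q t * y t" v "\<lambda>t. w t + Q t * v t" c]
      ac_on_add_scale[of 0 pi u "\<lambda>t. f t - z * y t - Q t * (u t + Q t * y t)" w
        "\<lambda>t. g t - z * v t - Q t * (w t + Q t * v t)" c] that
    by (simp add: hill_system_def algebra_simps)
  have hill: "hill_solution bc Q z f y u \<longleftrightarrow> hill_system Q z f y u \<and> satisfies_bc bc y u" for f y u
    by (simp add: hill_solution_def hill_system_def)
  obtain y1 u1 where s1: "hill_system Q z (\<lambda>_. 0) y1 u1" "y1 0 = 1" "u1 0 = 0" and
      b1: "\<And>x. x \<in> {0..pi} \<Longrightarrow> norm (y1 x) \<le> C"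
    using ivp[of "\<lambda>_. 0" 1 0] by (auto simp: L1_mass_def)
  obtain y2 u2 where s2: "hill_system Q z (\<lambda>_. 0) y2 u2" "y2 0 = 0" "u2 0 = 1" and
      b2: "\<And>x. x \<in> {0..pi} \<Longrightarrow> norm (y2 x) \<le> C"
    using ivp[of "\<lambda>_. 0" 0 1] by (auto simp: L1_mass_def)
  define L where "L v = (fst v * fst (bc_defect bc y1 u1) + snd v * fst (bc_defect bc y2 u2),
      fst v * snd (bc_defect bc y1 u1) + snd v * snd (bc_defect bc y2 u2))" for v
  have comb: "hill_system Q z f (\<lambda>t. y t + a * y1 t + b * y2 t) (\<lambda>t. u t + a * u1 t + b * u2 t)" if "hill_system Q z f y u" for f y u a b
    using sol_comb[OF sol_comb[OF that s1(1)] s2(1)] by simp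
  have defect: "bc_defect bc (\<lambda>t. y t + fst v * y1 t + snd v * y2 t) (\<lambda>t. u t + fst v * u1 t + snd v * u2 t)
      = bc_defect bc y u + L v" for y u v
    unfolding bc_defect_combination L_def ..
  have linL: "linear L"
    by (rule linearI) (auto simp: L_def algebra_simps scaleR_conv_of_real)
  have "inj L"
    unfolding linear_injective_0[OF linL]
  proof (intro allI impI)
    fix v assume "L v = 0"
    define y where "y t = fst v * y1 t + snd v * y2 t" for t
    define u where "u t = fst v * u1 t + snd v * u2 t" for t
    have "hill_system Q z (\<lambda>_. 0) (\<lambda>_. 0) (\<lambda>_. 0)"
      by (simp add: hill_system_def ac_on_def)
    then have "hill_system Q z (\<lambda>_. 0) y u"
      using comb[of "\<lambda>_. 0" "\<lambda>_. 0" "\<lambda>_. 0" "fst v" "snd v"] by (simp add: y_def[abs_def] u_def[abs_def])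
    moreover have "satisfies_bc bc y u"
    proof -
      have "bc_defect bc y u = bc_defect bc (\<lambda>_. 0) (\<lambda>_. 0) + L v"
        using defect[of "\<lambda>_. 0" v "\<lambda>_. 0"] by (simp add: y_def[abs_def] u_def[abs_def])
      also have "\<dots> = 0"
        using \<open>L v = 0\<close> by (cases bc) (auto simp: zero_prod_def)
      finally show ?thesis by (simp add: bc_defect_eq_0_iff)
    qed
    ultimately have y0: "y x = 0" if "x \<in> {0..pi}" for x
      using z that unfolding eigenvalue_iff[OF Q] hill by blast
    have ac: "ac_on 0 pi y (\<lambda>t. u t + Q t * y t)" "ac_on 0 pi u (\<lambda>t. 0 - z * y t - Q t * (u t + Q t * y t))"
      using \<open>hill_system Q z (\<lambda>_. 0) y u\<close> by (auto simp: hill_system_def)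
    \<comment> \<open>\<open>y = 0\<close> does not yet give \<open>v = 0\<close>. With
      \<open>y = 0\<close> the first equation makes the integral of the continuous \<open>u\<close>
      vanish identically, so \<open>u 0 = 0\<close>; the initial values are the two entries of
      \<open>v\<close>.\<close>
    have "integral {0..x} u = 0" if x: "x \<in> {0..pi}" for x
    proof -
      have "integral {0..x} u = integral {0..x} (\<lambda>t. u t + Q t * y t)"
        by (rule integral_cong) (use y0 x in auto)
      also have "\<dots> = y x - y 0"
        using ac_onD[OF ac(1) x] by simp
      finally show ?thesis using y0 x by simp
    qed
    moreover have "((\<lambda>x. integral {0..x} u) has_vector_derivative u 0) (at 0 within {0..pi})"
      by (rule integral_has_vector_derivative[OF ac_on_continuous[OF ac(2)]]) simp
    ultimately have "((\<lambda>x. 0) has_vector_derivative u 0) (at 0 within {0..pi})"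
      by (intro has_vector_derivative_transform[of 0 "{0..pi}" "\<lambda>x. 0" "\<lambda>x. integral {0..x} u"]) auto
    then have "u 0 = 0"
      using vector_derivative_unique_within_closed_interval[of 0 pi 0 "\<lambda>_. 0" "u 0" 0] by simp
    moreover have "y 0 = fst v" "u 0 = snd v"
      using s1 s2 by (auto simp: y_def u_def)
    ultimately show "v = 0"
      using y0[of 0] by (simp add: prod_eq_iff)
  qed
  obtain B where B: "B > 0" "\<And>v. B * norm v \<le> norm (L v)"
    using linear_inj_bounded_below_pos[OF linL \<open>inj L\<close>] by blast
  have surj: "surj L"
    by (rule linear_injective_imp_surjective[OF linL \<open>inj L\<close>]) simp
  \<comment> \<open>\<open>C\<close> for the particular solution, and for each of the two
    fundamental solutions a coefficient at most \<open>4 * C / B\<close> times the bound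
    \<open>C\<close>; the 4 is that of \<open>bc_defect_bound\<close>.\<close>
  define C' where "C' = C + 2 * (4 * C / B) * C"
  have "C' \<ge> 0" using C B by (simp add: C'_def)
  moreover have "\<exists>y u. hill_solution bc Q z f y u \<and>
        (\<forall>x\<in>{0..pi}. norm (y x) \<le> C' * L1_mass f)"
    if f: "f absolutely_integrable_on {0..pi}" for f
  proof -
    let ?n = "L1_mass f"
    have n0: "?n \<ge> 0"
      using f by (auto intro!: Henstock_Kurzweil_Integration.integral_nonneg simp: L1_mass_def absolutely_integrable_on_def)
    obtain y u where s: "hill_system Q z f y u" and b: "\<And>x. x \<in> {0..pi} \<Longrightarrow> norm (y x) \<le> C * ?n"
        "\<And>x. x \<in> {0..pi} \<Longrightarrow> norm (u x) \<le> C * ?n"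
      using ivp[OF f, of 0 0] by auto
    obtain v where v: "L v = - bc_defect bc y u"
      using surj by (metis surjD)
    have "norm (bc_defect bc y u) \<le> 4 * (C * ?n)"
      by (rule bc_defect_bound) (rule b, assumption)+
    then have "B * norm v \<le> 4 * (C * ?n)"
      using B(2)[of v] by (simp add: v)
    then have "norm v \<le> 4 * C / B * ?n"
      using B(1) by (simp add: field_simps)
    then have v12: "norm (fst v) \<le> 4 * C / B * ?n" "norm (snd v) \<le> 4 * C / B * ?n"
      using norm_fst_le[of "fst v" "snd v"] norm_snd_le[of "snd v" "fst v"] by auto
    let ?y = "\<lambda>t. y t + fst v * y1 t + snd v * y2 t" and ?u = "\<lambda>t. u t + fst v * u1 t + snd v * u2 t"
    have "bc_defect bc ?y ?u = 0"
      unfolding defect v by simp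
    then have "hill_solution bc Q z f ?y ?u"
      unfolding hill bc_defect_eq_0_iff using comb[OF s] by blast
    moreover have "norm (?y x) \<le> C' * ?n" if x: "x \<in> {0..pi}" for x
    proof -
      have "norm (?y x) \<le> norm (y x) + norm (fst v * y1 x) + norm (snd v * y2 x)"
        by norm
      also have "\<dots> \<le> C * ?n + 4 * C / B * ?n * C + 4 * C / B * ?n * C"
        unfolding norm_mult using b(1)[OF x] v12 b1[OF x] b2[OF x] B C n0
        by (intro add_mono mult_mono) auto
      also have "\<dots> = C' * ?n"
        by (simp add: C'_def algebra_simps)
      finally show ?thesis .
    qed
    ultimately show ?thesis by blast
  qed
  ultimately show ?thesis using that by blast
qed

section \<open>Resolvent estimates\<close>

definition outer_region :: "nat \<Rightarrow> complex set"
  where "outer_region N = {z. real N ^ 2 + real N \<le> norm z \<and> Re z \<le> real N ^ 2 + real N}"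

text \<open>Let \<open>\<mu> = a + b \<i>\<close>. For \<open>b \<ge> 1/4\<close> the exponential is
  at most \<open>exp (- pi / 2) \<le> 1/2\<close>. For smaller \<open>b\<close> the two conditions
  on \<open>z\<close> squeeze \<open>a\<^sup>2\<close> around \<open>(N + 1/2)\<^sup>2\<close>, so
  \<open>|a|\<close> is within \<open>1/4\<close> of a half-integer and the exponential has
  nonpositive real part.\<close>

lemma outer_region_sqrt:
  assumes N: "N \<ge> 1" and z: "z \<in> outer_region N"
  obtains \<mu> where "\<mu>\<^sup>2 = z" "Im \<mu> \<ge> 0" "\<mu> \<noteq> 0" "norm \<mu> = sqrt (norm z)"
    "norm (1 - exp (2 * \<i> * \<mu> * pi)) \<ge> 1 / 2"
proof -
  obtain \<mu> where \<mu>: "\<mu>\<^sup>2 = z" "Im \<mu> \<ge> 0"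
  proof (cases "Im (csqrt z) \<ge> 0")
    case True
    then show ?thesis using that[of "csqrt z"] by simp
  next
    case False
    then show ?thesis using that[of "- csqrt z"] by simp
  qed
  define a b where "a = Re \<mu>" and "b = Im \<mu>"
  have b0: "b \<ge> 0" using \<mu> by (simp add: b_def)
  have nz: "norm z = a\<^sup>2 + b\<^sup>2"
    unfolding \<mu>(1)[symmetric] norm_power cmod_power2 a_def b_def ..
  have rz: "Re z = a\<^sup>2 - b\<^sup>2"
    unfolding \<mu>(1)[symmetric] by (simp add: a_def b_def power2_eq_square)
  have nz': "norm z = (norm \<mu>)\<^sup>2"
    unfolding \<mu>(1)[symmetric] norm_power ..
  have "0 < real N ^ 2 + real N"
    using N by (intro add_nonneg_pos) auto
  then have z0: "norm z > 0"
    using z unfolding outer_region_def mem_Collect_eq by linarith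
  let ?e = "exp (2 * \<i> * \<mu> * pi)"
  have e: "?e = exp (- (2 * pi * b)) * cis (2 * pi * a)"
  proof -
    have "2 * \<i> * \<mu> * pi = Complex (- (2 * pi * b)) (2 * pi * a)"
      by (simp add: complex_eq_iff a_def b_def)
    then show ?thesis by (simp only: exp_eq_polar complex.sel)
  qed
  have "norm (1 - ?e) \<ge> 1 / 2"
  proof (cases "b \<ge> 1 / 4")
    case True
    have "2 * pi * b \<ge> pi / 2" using True by simp
    then have "1 + 1 \<le> exp (2 * pi * b)"
      using exp_ge_add_one_self[of "2 * pi * b"] pi_ge_two by linarith
    then have "exp (- (2 * pi * b)) \<le> 1 / 2"
      by (simp add: exp_minus field_simps)
    then have "norm ?e \<le> 1 / 2"
      unfolding e by (simp add: norm_mult)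
    then show ?thesis
      using norm_triangle_ineq2[of 1 ?e] by simp
  next
    case False
    have "b\<^sup>2 \<le> (1 / 4)\<^sup>2"
      using False b0 by (intro power_mono) auto
    define n where "n = real N + 1 / 2"
    have "real N ^ 2 + real N = n\<^sup>2 - 1 / 4"
      by (simp add: n_def power2_eq_square algebra_simps)
    \<comment> \<open>The radius is \<open>n\<^sup>2 - 1/4\<close>: the modulus condition bounds
      \<open>a\<^sup>2\<close> from below and the real part bounds it from above, each up to
      \<open>b\<^sup>2 \<le> 1/16\<close>. Dividing \<open>5/16\<close> by
      \<open>|a| + n \<ge> 3/2\<close> then gives less than \<open>1/4\<close>.\<close>
    then have "\<bar>a\<^sup>2 - n\<^sup>2\<bar> \<le> 5 / 16"
      using z \<open>b\<^sup>2 \<le> (1 / 4)\<^sup>2\<close> unfolding outer_region_def mem_Collect_eq nz rz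
      by (simp add: power2_eq_square)
    moreover have "\<bar>a\<^sup>2 - n\<^sup>2\<bar> = \<bar>\<bar>a\<bar> - n\<bar> * (\<bar>a\<bar> + n)"
    proof -
      have "a\<^sup>2 - n\<^sup>2 = (\<bar>a\<bar> - n) * (\<bar>a\<bar> + n)"
        by (simp add: power2_eq_square algebra_simps flip: abs_mult)
      then show ?thesis by (simp add: abs_mult n_def)
    qed
    moreover have "\<bar>\<bar>a\<bar> - n\<bar> * (3 / 2) \<le> \<bar>\<bar>a\<bar> - n\<bar> * (\<bar>a\<bar> + n)"
      using N by (intro mult_left_mono) (auto simp: n_def)
    ultimately have \<delta>: "\<bar>\<bar>a\<bar> - n\<bar> < 1 / 4" by linarith
    have "cos (2 * pi * a) = cos (2 * pi * \<bar>a\<bar>)"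
      by (cases "a \<ge> 0") auto
    also have "2 * pi * \<bar>a\<bar> = 2 * pi * (\<bar>a\<bar> - n) + (2 * real N * pi + pi)"
      by (simp add: n_def algebra_simps)
    also have "cos \<dots> = - cos (2 * pi * (\<bar>a\<bar> - n))"
      by (simp only: cos_add sin_add cos_2npi sin_2npi cos_pi sin_pi) simp
    also have "\<dots> \<le> 0"
    proof -
      have "\<bar>2 * pi * (\<bar>a\<bar> - n)\<bar> \<le> 2 * pi * (1 / 4)"
        using \<delta> unfolding abs_mult by (intro mult_mono) auto
      then have "- (pi / 2) \<le> 2 * pi * (\<bar>a\<bar> - n)" "2 * pi * (\<bar>a\<bar> - n) \<le> pi / 2"
        unfolding abs_le_iff by linarith+
      then show ?thesis
        using cos_ge_zero[of "2 * pi * (\<bar>a\<bar> - n)"] by simp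
    qed
    finally have "Re ?e \<le> 0"
      unfolding e by (simp add: mult_nonneg_nonpos)
    then have "1 \<le> Re (1 - ?e)" by simp
    also have "\<dots> \<le> norm (1 - ?e)" by (rule complex_Re_le_cmod)
    finally show ?thesis by simp
  qed
  moreover have "\<mu> \<noteq> 0" "norm \<mu> = sqrt (norm z)"
    using z0 nz' by (auto simp: real_sqrt_unique)
  ultimately show ?thesis using that \<mu> by blast
qed

lemma integral_mult_le_L1_mass:
  assumes g: "continuous_on {0..pi} g" "\<And>t. t \<in> {0..pi} \<Longrightarrow> norm (g t) \<le> B"
    and f: "f absolutely_integrable_on {0..pi}"
  shows "norm (integral {0..pi} (\<lambda>t. g t * f t)) \<le> B * L1_mass f"
proof -
  have "norm (integral {0..pi} (\<lambda>t. g t * f t)) \<le> integral {0..pi} (\<lambda>t. B * norm (f t))"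
  proof (rule integral_norm_bound_integral)
    show "(\<lambda>t. g t * f t) integrable_on {0..pi}"
      by (rule set_lebesgue_integral_eq_integral(1)[OF absolutely_integrable_continuous_mult[OF g(1) f]])
    show "(\<lambda>t. B * norm (f t)) integrable_on {0..pi}"
      using f by (auto simp: absolutely_integrable_on_def intro: integrable_on_mult_right)
  qed (use g in \<open>auto simp: norm_mult intro: mult_right_mono\<close>)
  then show ?thesis by (simp add: L1_mass_def)
qed

lemma green_kernel_integral_le:
  assumes "green_kernel bc z x B g" "f absolutely_integrable_on {0..pi}"
  shows "norm (integral {0..pi} (\<lambda>t. g t * f t)) \<le> B * L1_mass f"
  by (rule integral_mult_le_L1_mass) (use assms in \<open>auto simp: green_kernel_def\<close>)

lemma green_kernel_perturbation:
  assumes "green_kernel bc z x B g" "measure_potential Q K" "hill_solution bc Q z f y u"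
    and "\<And>t. t \<in> {0..pi} \<Longrightarrow> norm (y t) \<le> S"
  shows "norm (y x - integral {0..pi} (\<lambda>t. g t * f t)) \<le> K * (B * S)"
  using assms unfolding green_kernel_def by blast

lemma green_kernel_outer:
  assumes "N \<ge> 1" "z \<in> outer_region N" "x \<in> {0..pi}"
  obtains g where "green_kernel bc z x (4 / sqrt (norm z)) g"
proof -
  obtain \<mu> where \<mu>: "\<mu>\<^sup>2 = z" "Im \<mu> \<ge> 0" "\<mu> \<noteq> 0" "norm \<mu> = sqrt (norm z)"
    "norm (1 - exp (2 * \<i> * \<mu> * pi)) \<ge> 1 / 2"
    using outer_region_sqrt[OF assms(1,2)] by blast
  obtain g where "green_kernel bc (\<mu>\<^sup>2) x (4 / norm \<mu>) g"
    using green_function[OF \<mu>(2,3) assms(3) \<mu>(5)] .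
  then show ?thesis
    unfolding \<mu>(1,4) by (rule that)
qed

lemma hill_solution_attains_sup:
  assumes "hill_solution bc Q z f y u"
  obtains x where "x \<in> {0..pi}" "\<And>t. t \<in> {0..pi} \<Longrightarrow> norm (y t) \<le> norm (y x)"
proof -
  have "continuous_on {0..pi} (\<lambda>t. norm (y t))"
    by (intro continuous_intros hill_solution_continuous[OF assms])
  then show ?thesis
    using continuous_attains_sup[of "{0..pi}" "\<lambda>t. norm (y t)"] that by auto
qed

text \<open>For \<open>Q = 0\<close> the mass is 0, and the error term of the kernel
  disappears.\<close>

lemma green_kernel_free:
  assumes g: "green_kernel bc z x B g" and sol: "hill_solution bc (\<lambda>_. 0) z f y u"
  shows "y x = integral {0..pi} (\<lambda>t. g t * f t)"
proof -
  obtain x' where "\<And>t. t \<in> {0..pi} \<Longrightarrow> norm (y t) \<le> norm (y x')"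
    using hill_solution_attains_sup[OF sol] by blast
  from green_kernel_perturbation[OF g measure_potential_zero sol this] show ?thesis by simp
qed

text \<open>The same kernel represents \<open>y0\<close> exactly and \<open>y\<close> up to
  \<open>4 K / sqrt |z|\<close> times the supremum of \<open>y\<close>. Smallness of
  \<open>K\<close> absorbs half of that supremum, which is thus at most \<open>2 * S0\<close>; hence
  \<open>8 = 4 * 2\<close>.\<close>

lemma hill_solution_perturbation:
  assumes N: "N \<ge> 1" and z: "z \<in> outer_region N" and Q: "measure_potential Q K"
    and small: "8 * K \<le> sqrt (norm z)"
    and sol: "hill_solution bc Q z f y u" and sol0: "hill_solution bc (\<lambda>_. 0) z f y0 u0"
    and S0: "\<And>t. t \<in> {0..pi} \<Longrightarrow> norm (y0 t) \<le> S0" and x: "x \<in> {0..pi}"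
  shows "norm (y x - y0 x) \<le> 8 * K / sqrt (norm z) * S0"
proof -
  obtain x1 where x1: "x1 \<in> {0..pi}" and sup: "\<And>t. t \<in> {0..pi} \<Longrightarrow> norm (y t) \<le> norm (y x1)"
    using hill_solution_attains_sup[OF sol] by blast
  have diff: "norm (y x - y0 x) \<le> K * (4 / sqrt (norm z) * norm (y x1))" if x: "x \<in> {0..pi}" for x
  proof -
    obtain g where g: "green_kernel bc z x (4 / sqrt (norm z)) g"
      using green_kernel_outer[OF N z x] .
    show ?thesis
      using green_kernel_perturbation[OF g Q sol sup] green_kernel_free[OF g sol0] by simp
  qed
  have "0 < real N ^ 2 + real N"
    using N by (intro add_nonneg_pos) auto
  then have "norm z > 0"
    using z unfolding outer_region_def mem_Collect_eq by linarith
  then have sq: "sqrt (norm z) > 0" by simp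
  have K0: "K \<ge> 0" by (rule measure_potentialD(3)[OF Q])
  have "K * (4 / sqrt (norm z) * norm (y x1)) = (4 * K / sqrt (norm z)) * norm (y x1)"
    by simp
  also have "\<dots> \<le> 1 / 2 * norm (y x1)"
    using small sq by (intro mult_right_mono) (auto simp: field_simps)
  finally have "norm (y x1 - y0 x1) \<le> 1 / 2 * norm (y x1)"
    using diff[OF x1] by linarith
  then have y: "norm (y x1) \<le> 2 * S0"
    using S0[OF x1] norm_triangle_ineq2[of "y x1" "y0 x1"] by linarith
  have "norm (y x - y0 x) \<le> (4 * K / sqrt (norm z)) * norm (y x1)"
    using diff[OF x] by (simp add: mult_ac)
  also have "\<dots> \<le> (4 * K / sqrt (norm z)) * (2 * S0)"
    using y K0 by (intro mult_left_mono) auto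
  finally show ?thesis by simp
qed

text \<open>An eigenfunction and the free solution 0 share the source 0; comparing them with
  \<open>S0 = 0\<close> makes the eigenfunction vanish.\<close>

lemma outer_region_no_eigenvalue:
  assumes N: "N \<ge> 1" and z: "z \<in> outer_region N" and Q: "measure_potential Q K"
    and small: "8 * K \<le> sqrt (norm z)"
  shows "\<not> eigenvalue bc Q z"
proof
  assume "eigenvalue bc Q z"
  then obtain y u x where *: "hill_solution bc Q z (\<lambda>_. 0) y u" "x \<in> {0..pi}" "y x \<noteq> 0"
    unfolding eigenvalue_iff[OF Q] by blast
  have "hill_solution bc (\<lambda>_. 0) z (\<lambda>_. 0) (\<lambda>_. 0) (\<lambda>_. 0)"
    by (cases bc) (auto simp: hill_solution_def ac_on_def)
  from hill_solution_perturbation[OF N z Q small *(1) this, of 0 x] show False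
    using * by simp
qed

section \<open>Riemann--Lebesgue property of the free resolvent\<close>

lemma L1_iff: "f \<in> L1 \<longleftrightarrow> f absolutely_integrable_on {0..pi}"
  by (simp add: L1_def integrable_lebesgue_on_iff)

lemma L1_mass_eq: assumes "f \<in> L1" shows "L1_mass f = (\<integral>t. norm (f t) \<partial>leb)"
  unfolding L1_mass_def
  using assms by (intro lebesgue_integral_eq_integral[symmetric]) (auto simp: L1_def)

lemma negligible_AE_leb:
  assumes "negligible N" "\<And>t. t \<in> {a..b} - N \<Longrightarrow> P t"
  shows "AE t in lebesgue_on {a..b}. P (t::real)"
proof -
  have "AE t in lebesgue. t \<in> {a..b} \<longrightarrow> P t"
    by (rule AE_I'[of N]) (use assms in \<open>auto simp: negligible_iff_null_sets\<close>)
  then show ?thesis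
    by (subst AE_restrict_space_iff) auto
qed

lemma L1_mass_tendsto:
  assumes f: "f \<in> L1" and s: "\<And>n::nat. s n \<in> borel_measurable leb"
    and dom: "\<And>n x. x \<in> {0..pi} \<Longrightarrow> norm (f x - s n x) \<le> w x" "integrable leb w"
    and lim: "AE x in leb. (\<lambda>n. s n x) \<longlonglongrightarrow> f x"
  shows "(\<lambda>n. L1_mass (\<lambda>t. f t - s n t)) \<longlonglongrightarrow> 0"
proof -
  have fm: "f \<in> borel_measurable leb" using f by (auto simp: L1_def)
  have m: "(\<lambda>x. f x - s n x) \<in> borel_measurable leb" for n
    using fm s by measurable
  have "(\<lambda>n. \<integral>t. norm (f t - s n t) \<partial>leb) \<longlonglongrightarrow> (\<integral>t. 0 \<partial>leb)"
  proof (rule integral_dominated_convergence[where w=w])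
    show "AE x in leb. (\<lambda>n. norm (f x - s n x)) \<longlonglongrightarrow> 0"
      using lim
    proof eventually_elim
      case (elim x)
      then have "(\<lambda>n. norm (f x - s n x)) \<longlonglongrightarrow> norm (f x - f x)"
        by (intro tendsto_intros)
      then show ?case by simp
    qed
    show "AE x in leb. norm (norm (f x - s n x)) \<le> w x" for n
      using dom(1) by (intro AE_I2) auto
  qed (use m dom(2) in \<open>auto intro: borel_measurable_norm\<close>)
  moreover have "(\<lambda>x. f x - s n x) \<in> L1" for n
    unfolding L1_def mem_Collect_eq
    by (rule Bochner_Integration.integrable_bound[OF dom(2) m])
       (auto intro!: AE_I2 order_trans[OF dom(1)])
  ultimately show ?thesis by (simp add: L1_mass_eq)
qed

lemma L1_mass_triangle:
  assumes "f \<in> L1" "g \<in> L1" "h \<in> L1"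
  shows "L1_mass (\<lambda>t. f t - h t) \<le> L1_mass (\<lambda>t. f t - g t) + L1_mass (\<lambda>t. g t - h t)"
proof -
  have d: "(\<lambda>t. f t - h t) \<in> L1" "(\<lambda>t. f t - g t) \<in> L1" "(\<lambda>t. g t - h t) \<in> L1"
    using assms by (auto simp: L1_def)
  have "(\<integral>t. norm (f t - h t) \<partial>leb) \<le> (\<integral>t. norm (f t - g t) + norm (g t - h t) \<partial>leb)"
    using d by (intro integral_mono) (auto simp: L1_def norm_triangle_sub intro: norm_diff_triangle_le)
  also have "\<dots> = (\<integral>t. norm (f t - g t) \<partial>leb) + (\<integral>t. norm (g t - h t) \<partial>leb)"
    using d by (intro Bochner_Integration.integral_add) (auto simp: L1_def)
  finally show ?thesis
    using d by (simp add: L1_mass_eq)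
qed

text \<open>Measurability supplies continuous functions converging almost everywhere; clipping makes
  them uniformly bounded, so they converge in \<open>L1\<close> by domination, and Stone-Weierstrass
  replaces a continuous function by a polynomial.\<close>

lemma L1_approx_polynomial:
  fixes h :: "real \<Rightarrow> complex"
  assumes h: "h \<in> borel_measurable leb" and c: "\<And>t. norm (h t) \<le> c" and "e > 0"
  obtains p :: "real \<Rightarrow> complex" where "polynomial_function p" "L1_mass (\<lambda>t. h t - p t) \<le> e"
proof -
  have c0: "c \<ge> 0" using order_trans[OF norm_ge_zero c] .
  have "h measurable_on {0..pi}"
    using h by (simp add: measurable_on_iff_borel_measurable)
  then obtain N g where N: "negligible N" and g: "\<And>n. continuous_on UNIV (g n)"
    and lim: "\<And>x. x \<notin> N \<Longrightarrow> (\<lambda>n. g n x) \<longlonglongrightarrow> (if x \<in> {0..pi} then h x else 0)"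
    unfolding measurable_on_def by blast
  \<comment> \<open>Radial retraction onto the ball of radius \<open>c + 1\<close>: continuous, and
    the identity on the values of \<open>h\<close>. The summand 1 keeps the divisor positive when
    \<open>c = 0\<close>.\<close>
  define clip where "clip w = w /\<^sub>R max 1 (norm w / (c + 1))" for w :: complex
  have clip_cont: "continuous_on UNIV clip"
    unfolding clip_def by (intro continuous_intros) (use c0 in auto)
  have clip_le: "norm (clip w) \<le> c + 1" for w
  proof (cases "norm w \<le> c + 1")
    case True
    then show ?thesis using c0 by (auto simp: clip_def max_def field_simps)
  next
    case False
    then have "max 1 (norm w / (c + 1)) = norm w / (c + 1)"
      using c0 by (simp add: max_def field_simps)
    then show ?thesis
      using False c0 by (simp add: clip_def)
  qed
  have clip_id: "clip w = w" if "norm w \<le> c" for w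
    using c0 that by (auto simp: clip_def max_def field_simps)
  define s where "s n x = clip (g n x)" for n x
  have s_cont: "continuous_on UNIV (s n)" for n
    unfolding s_def by (rule continuous_on_compose2[OF clip_cont g]) auto
  have hL2: "h \<in> L2"
    by (rule bounded_imp_L2[OF h]) (rule c)
  have "(\<lambda>n. L1_mass (\<lambda>t. h t - s n t)) \<longlonglongrightarrow> 0"
  proof (rule L1_mass_tendsto)
    show "h \<in> L1" by (rule L2_imp_L1[OF hL2])
    show "s n \<in> borel_measurable leb" for n
      by (intro continuous_imp_measurable_on_sets_lebesgue continuous_on_subset[OF s_cont]) auto
    show "norm (h x - s n x) \<le> c + (c + 1)" for n x
      unfolding s_def by (intro order_trans[OF norm_triangle_ineq4] add_mono c clip_le)
    show "integrable leb (\<lambda>x. c + (c + 1))"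
      by (intro finite_measure.integrable_const finite_measure_lebesgue_on) auto
    show "AE x in leb. (\<lambda>n. s n x) \<longlonglongrightarrow> h x"
    proof (rule negligible_AE_leb[OF N])
      fix x assume x: "x \<in> {0..pi} - N"
      have "(\<lambda>n. clip (g n x)) \<longlonglongrightarrow> clip (h x)"
        using lim[of x] x clip_cont by (intro continuous_on_tendsto_compose[OF clip_cont]) auto
      then show "(\<lambda>n. s n x) \<longlonglongrightarrow> h x"
        by (simp add: s_def clip_id[OF c])
    qed
  qed
  then have "\<forall>\<^sub>F n in sequentially. L1_mass (\<lambda>t. h t - s n t) < e / 2"
    using \<open>e > 0\<close> by (intro order_tendstoD) auto
  then obtain n where n: "L1_mass (\<lambda>t. h t - s n t) < e / 2"
    by (auto simp: eventually_sequentially)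
  have sc: "continuous_on {0..pi} (s n)"
    by (rule continuous_on_subset[OF s_cont]) simp
  obtain p where p: "polynomial_function p" "\<And>t. t \<in> {0..pi} \<Longrightarrow> norm (s n t - p t) < e / 8"
    using Stone_Weierstrass_polynomial_function[OF _ sc, of "e / 8"] \<open>e > 0\<close> by auto
  have pc: "continuous_on {0..pi} p"
    by (rule continuous_on_polymonial_function[OF p(1)])
  have L: "h \<in> L1" "s n \<in> L1" "p \<in> L1"
    by (intro L2_imp_L1 hL2 continuous_imp_L2 sc pc)+
  have "L1_mass (\<lambda>t. s n t - p t) \<le> integral {0..pi} (\<lambda>t. e / 8)"
    unfolding L1_mass_def using p(2)
    by (intro integral_le) (auto intro!: integrable_continuous_real continuous_intros sc pc less_imp_le)
  also have "\<dots> = pi * e / 8" by simp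
  also have "\<dots> \<le> e / 2" using pi_less_4 \<open>e > 0\<close> by (simp add: field_simps)
  finally have "L1_mass (\<lambda>t. h t - p t) \<le> e"
    using L1_mass_triangle[OF L] n by linarith
  then show ?thesis using that p(1) by blast
qed

text \<open>The approximants have to satisfy every boundary condition, so they are sought as
  \<open>m * p\<close> with a polynomial \<open>p\<close> and a weight \<open>m\<close> having
  double zeros at both end points. Thus \<open>f / m\<close> has to be approximated, after a
  truncation that makes this quotient bounded.\<close>

lemma L1_approx_nice:
  assumes f: "f \<in> L1" and "e > 0"
  obtains \<phi> \<phi>1 \<phi>2 :: "real \<Rightarrow> complex" where
    "\<And>t S. (\<phi> has_vector_derivative \<phi>1 t) (at t within S)"
    "\<And>t S. (\<phi>1 has_vector_derivative \<phi>2 t) (at t within S)"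
    "continuous_on {0..pi} \<phi>2" "\<phi> 0 = 0" "\<phi> pi = 0" "\<phi>1 0 = 0" "\<phi>1 pi = 0"
    "L1_mass (\<lambda>t. f t - \<phi> t) \<le> e"
proof -
  define m where "m t = (t * (pi - t))\<^sup>2" for t :: real
  \<comment> \<open>One \<open>n\<close> controls both \<open>1 / m\<close> and \<open>f\<close>, so
    the quotient \<open>h\<close> below is bounded by \<open>n\<^sup>2\<close>; away from the end
    points the truncation is eventually inactive.\<close>
  define s where "s n t = (if 1 \<le> real n * m t \<and> norm (f t) \<le> real n then f t else 0)" for n t
  have fm: "f \<in> borel_measurable leb" and fi: "integrable leb f"
    using f by (auto simp: L1_def)
  have mm: "m \<in> borel_measurable leb"
    unfolding m_def by (intro continuous_imp_measurable_on_sets_lebesgue continuous_intros) auto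
  have sm: "s n \<in> borel_measurable leb" for n
  proof -
    note [measurable] = fm mm
    show ?thesis unfolding s_def by measurable
  qed
  have m_pos: "m t > 0" if "t \<in> {0..pi} - {0, pi}" for t
    using that by (auto simp: m_def)
  have m_nn: "m t \<ge> 0" for t by (simp add: m_def)
  have "(\<lambda>n. L1_mass (\<lambda>t. f t - s n t)) \<longlonglongrightarrow> 0"
  proof (rule L1_mass_tendsto[OF f sm])
    show "norm (f x - s n x) \<le> norm (f x)" for n x
      by (simp add: s_def)
    show "integrable leb (\<lambda>x. norm (f x))" using fi by simp
    show "AE x in leb. (\<lambda>n. s n x) \<longlonglongrightarrow> f x"
    proof (rule negligible_AE_leb[of "{0, pi}"])
      fix x assume x: "x \<in> {0..pi} - {0, pi}"
      have "\<forall>\<^sub>F n in sequentially. s n x = f x"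
      proof -
        have "\<forall>\<^sub>F n in sequentially. real n \<ge> max (1 / m x) (norm (f x))"
          using filterlim_real_sequentially unfolding filterlim_at_top by blast
        then show ?thesis
        proof eventually_elim
          case (elim n)
          then show ?case using m_pos[OF x] x by (auto simp: s_def field_simps)
        qed
      qed
      then show "(\<lambda>n. s n x) \<longlonglongrightarrow> f x"
        by (rule tendsto_eventually)
    qed simp
  qed
  then have "\<forall>\<^sub>F n in sequentially. L1_mass (\<lambda>t. f t - s n t) < e / 2"
    using \<open>e > 0\<close> by (intro order_tendstoD) auto
  then obtain n where n: "L1_mass (\<lambda>t. f t - s n t) < e / 2"
    by (auto simp: eventually_sequentially)
  define h where "h t = s n t / of_real (m t)" for t
  have hm: "h \<in> borel_measurable leb"
    unfolding h_def using sm mm by measurable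
  have h_le: "norm (h t) \<le> (real n)\<^sup>2" for t
  proof (cases "s n t = 0")
    case False
    then have *: "1 \<le> real n * m t" "norm (f t) \<le> real n" "s n t = f t"
      by (auto simp: s_def split: if_splits)
    then have "m t > 0" using m_nn[of t] by (cases "m t = 0") auto
    have "norm (f t) * 1 \<le> real n * (real n * m t)"
      using * by (intro mult_mono) auto
    then show ?thesis
      using * \<open>m t > 0\<close> by (simp add: h_def norm_divide field_simps power2_eq_square)
  qed (simp add: h_def)
  have s_eq: "s n t = of_real (m t) * h t" for t
    by (cases "m t = 0") (auto simp: h_def s_def)
  \<comment> \<open>On the interval \<open>m\<close> is at most \<open>pi ^ 4\<close>, which is the
    loss when the approximation is multiplied back by \<open>m\<close>.\<close>
  obtain p :: "real \<Rightarrow> complex" where p: "polynomial_function p" "L1_mass (\<lambda>t. h t - p t) \<le> e / 2 / pi ^ 4"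
    by (rule L1_approx_polynomial[OF hm h_le, of "e / 2 / pi ^ 4"]) (use \<open>e > 0\<close> in auto)
  define \<phi> where "\<phi> t = m t *\<^sub>R p t" for t
  have "real_polynomial_function m"
    unfolding m_def by (intro real_polynomial_function_power real_polynomial_function.intros
        real_polynomial_function_diff bounded_linear_ident)
  then have m_poly: "polynomial_function m"
    by (simp add: real_polynomial_function_eq)
  have \<phi>_poly: "polynomial_function \<phi>"
    unfolding \<phi>_def by (intro polynomial_function_mult m_poly p)
  obtain \<phi>1 where \<phi>1: "polynomial_function \<phi>1" "\<And>x. (\<phi> has_vector_derivative \<phi>1 x) (at x)"
    using has_vector_derivative_polynomial_function[OF \<phi>_poly] by blast
  obtain \<phi>2 where \<phi>2: "polynomial_function \<phi>2" "\<And>x. (\<phi>1 has_vector_derivative \<phi>2 x) (at x)"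
    using has_vector_derivative_polynomial_function[OF \<phi>1(1)] by blast
  obtain p' where p': "\<And>x. (p has_vector_derivative p' x) (at x)"
    using has_vector_derivative_polynomial_function[OF p(1)] by blast
  have m': "(m has_real_derivative 2 * (t * (pi - t)) * (pi - 2 * t)) (at t)" for t
    unfolding m_def by (auto intro!: derivative_eq_intros simp: algebra_simps)
  have \<phi>': "\<phi>1 t = m t *\<^sub>R p' t + (2 * (t * (pi - t)) * (pi - 2 * t)) *\<^sub>R p t" for t
  proof -
    have "(\<phi> has_vector_derivative m t *\<^sub>R p' t + (2 * (t * (pi - t)) * (pi - 2 * t)) *\<^sub>R p t) (at t)"
      unfolding \<phi>_def by (rule has_vector_derivative_scaleR[OF m' p'])
    then show ?thesis by (rule vector_derivative_unique_at[OF \<phi>1(2)])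
  qed
  have L: "f \<in> L1" "s n \<in> L1" "\<phi> \<in> L1" "h \<in> L1" "p \<in> L1"
  proof -
    show "f \<in> L1" by fact
    show "\<phi> \<in> L1" "p \<in> L1"
      by (intro L2_imp_L1 continuous_imp_L2 continuous_on_polymonial_function \<phi>_poly p)+
    show "h \<in> L1"
      by (rule L2_imp_L1[OF bounded_imp_L2[OF hm h_le]])
    show "s n \<in> L1"
      by (rule L2_imp_L1[OF bounded_imp_L2[OF sm, of _ "real n"]]) (auto simp: s_def)
  qed
  have "L1_mass (\<lambda>t. s n t - \<phi> t) \<le> integral {0..pi} (\<lambda>t. pi ^ 4 * norm (h t - p t))"
    unfolding L1_mass_def
  proof (rule integral_le)
    have i: "(\<lambda>t. norm (s n t - \<phi> t)) integrable_on {0..pi}" "(\<lambda>t. norm (h t - p t)) integrable_on {0..pi}"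
      using L by (auto simp: L1_def intro!: integrable_on_lebesgue_on)
    then show "(\<lambda>t. norm (s n t - \<phi> t)) integrable_on {0..pi}"
      "(\<lambda>t. pi ^ 4 * norm (h t - p t)) integrable_on {0..pi}"
      by (auto intro: integrable_on_mult_right)
    fix t assume t: "t \<in> {0..pi}"
    have "t * (pi - t) \<le> pi * pi"
      using t by (intro mult_mono) auto
    then have "m t \<le> (pi * pi)\<^sup>2"
      unfolding m_def using t by (intro power_mono) auto
    then have "m t * norm (h t - p t) \<le> pi ^ 4 * norm (h t - p t)"
      by (intro mult_right_mono) (auto simp: power2_eq_square power4_eq_xxxx)
    moreover have "s n t - \<phi> t = of_real (m t) * (h t - p t)"
      by (simp add: s_eq \<phi>_def scaleR_conv_of_real algebra_simps)
    ultimately show "norm (s n t - \<phi> t) \<le> pi ^ 4 * norm (h t - p t)"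
      using m_nn[of t] by (simp add: norm_mult)
  qed
  also have "\<dots> = pi ^ 4 * L1_mass (\<lambda>t. h t - p t)"
    by (simp add: L1_mass_def)
  also have "\<dots> \<le> pi ^ 4 * (e / 2 / pi ^ 4)"
    using p by (intro mult_left_mono) auto
  also have "\<dots> = e / 2" by simp
  finally have "L1_mass (\<lambda>t. f t - \<phi> t) \<le> e"
    using L1_mass_triangle[OF L(1-3)] n by linarith
  moreover have "\<phi> 0 = 0" "\<phi> pi = 0" "\<phi>1 0 = 0" "\<phi>1 pi = 0"
    by (simp_all add: \<phi>' \<phi>_def m_def)
  moreover have "continuous_on {0..pi} \<phi>2"
    by (rule continuous_on_polymonial_function[OF \<phi>2(1)])
  ultimately show ?thesis
    using that[of \<phi> \<phi>1 \<phi>2] \<phi>1(2) \<phi>2(2) by (auto intro: has_vector_derivative_at_within)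
qed

text \<open>A smooth \<open>\<phi>\<close> vanishing with its derivative at both ends is itself the
  free solution with source \<open>z \<phi> + \<phi>2\<close>, so \<open>z\<close> times the image
  of \<open>\<phi>\<close> is \<open>\<phi>\<close> minus the image of \<open>\<phi>2\<close>: the
  image is of order \<open>1 / |z|\<close>. The remainder \<open>f - \<phi>\<close> costs at most
  \<open>4 / sqrt |z|\<close> times its mass \<open>e / 8\<close>, half of the allowance.\<close>

lemma free_resolvent_Riemann_Lebesgue:
  assumes f: "f \<in> L1" and "e > 0"
  obtains R where "R > 0" "\<And>N z y u x. N \<ge> 1 \<Longrightarrow> z \<in> outer_region N \<Longrightarrow> norm z \<ge> R \<Longrightarrow>
    hill_solution bc (\<lambda>_. 0) z f y u \<Longrightarrow> x \<in> {0..pi} \<Longrightarrow> norm (y x) \<le> e / sqrt (norm z)"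
proof -
  obtain \<phi> \<phi>1 \<phi>2 :: "real \<Rightarrow> complex" where
    d: "\<And>t S. (\<phi> has_vector_derivative \<phi>1 t) (at t within S)"
      "\<And>t S. (\<phi>1 has_vector_derivative \<phi>2 t) (at t within S)"
    and c2: "continuous_on {0..pi} \<phi>2" and v: "\<phi> 0 = 0" "\<phi> pi = 0" "\<phi>1 0 = 0" "\<phi>1 pi = 0"
    and near: "L1_mass (\<lambda>t. f t - \<phi> t) \<le> e / 8"
    using L1_approx_nice[OF f, of "e / 8"] \<open>e > 0\<close> by auto
  have c: "continuous_on {0..pi} \<phi>" "continuous_on {0..pi} \<phi>1"
    using d by (auto intro!: continuous_on_vector_derivative)
  have L: "\<phi> \<in> L1" "\<phi>2 \<in> L1"
    by (intro L2_imp_L1 continuous_imp_L2 c c2)+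
  have "bounded (\<phi> ` {0..pi})"
    by (intro compact_imp_bounded compact_continuous_image c) auto
  then obtain B where B: "\<And>t. t \<in> {0..pi} \<Longrightarrow> norm (\<phi> t) \<le> B"
    unfolding bounded_iff by blast
  have B0: "B \<ge> 0" by (rule order_trans[OF norm_ge_zero B[of 0]]) auto
  have m2: "L1_mass \<phi>2 \<ge> 0"
    by (simp add: L1_mass_eq L)
  define D where "D = B + 4 * L1_mass \<phi>2"
  \<comment> \<open>\<open>D\<close> bounds \<open>|z|\<close> times the image of
    \<open>\<phi>\<close>, and \<open>D \<le> e / 2 * sqrt |z|\<close> beyond
    \<open>(2 * D / e)^2\<close>. The maximum with 1 makes \<open>4 / sqrt |z|\<close> at most 4, as
    used in \<open>D\<close>.\<close>
  define R where "R = max 1 ((2 * D / e)\<^sup>2)"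
  have "R > 0" by (simp add: R_def)
  moreover have "norm (y x) \<le> e / sqrt (norm z)"
    if N: "N \<ge> 1" and z: "z \<in> outer_region N" and R: "norm z \<ge> R"
      and sol: "hill_solution bc (\<lambda>_. 0) z f y u" and x: "x \<in> {0..pi}" for N z y u x
  proof -
    obtain g where g: "green_kernel bc z x (4 / sqrt (norm z)) g"
      using green_kernel_outer[OF N z x] .
    have gc: "continuous_on {0..pi} g"
      using g by (simp add: green_kernel_def)
    let ?G = "\<lambda>f. integral {0..pi} (\<lambda>t. g t * f t)"
    have z1: "norm z \<ge> 1" and zD: "(2 * D / e)\<^sup>2 \<le> norm z"
      using R by (auto simp: R_def)
    have sD: "2 * D / e \<le> sqrt (norm z)"
      using zD by (rule real_le_rsqrt)
    have gi: "(\<lambda>t. g t * h t) integrable_on {0..pi}" if "h \<in> L1" for h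
      by (rule set_lebesgue_integral_eq_integral(1)[OF absolutely_integrable_continuous_mult[OF gc]])
         (use that in \<open>simp add: L1_iff\<close>)
    have "hill_solution bc (\<lambda>_. 0) z (\<lambda>t. z * \<phi> t + \<phi>2 t) \<phi> \<phi>1"
    proof -
      have "ac_on 0 pi \<phi> \<phi>1" "ac_on 0 pi \<phi>1 \<phi>2"
        by (intro ac_on_has_vector_derivative d c c2)+
      moreover have "satisfies_bc bc \<phi> \<phi>1"
        using v by (cases bc) auto
      ultimately show ?thesis by (simp add: hill_solution_def)
    qed
    from green_kernel_free[OF g this]
    have "\<phi> x = ?G (\<lambda>t. z * \<phi> t + \<phi>2 t)" .
    also have "\<dots> = integral {0..pi} (\<lambda>t. z * (g t * \<phi> t) + g t * \<phi>2 t)"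
      by (simp add: algebra_simps)
    also have "\<dots> = z * ?G \<phi> + ?G \<phi>2"
      by (simp add: Henstock_Kurzweil_Integration.integral_add integrable_on_mult_right gi L)
    finally have "z * ?G \<phi> = \<phi> x - ?G \<phi>2" by simp
    then have "norm z * norm (?G \<phi>) = norm (\<phi> x - ?G \<phi>2)"
      by (metis norm_mult)
    also have "\<dots> \<le> norm (\<phi> x) + norm (?G \<phi>2)"
      by (rule norm_triangle_ineq4)
    also have "\<dots> \<le> B + 4 / sqrt (norm z) * L1_mass \<phi>2"
      using green_kernel_integral_le[OF g, of \<phi>2] L B[OF x] by (auto simp: L1_iff)
    also have "\<dots> \<le> B + 4 * L1_mass \<phi>2"
    proof -
      have "1 \<le> sqrt (norm z)" using z1 by simp
      then have "4 / sqrt (norm z) \<le> 4" by (simp add: divide_le_eq)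
      then show ?thesis using m2 by (intro add_left_mono mult_right_mono) auto
    qed
    finally have "norm z * norm (?G \<phi>) \<le> D" by (simp add: D_def)
    also have "\<dots> \<le> e / 2 * sqrt (norm z)"
      using sD \<open>e > 0\<close> by (simp add: field_simps)
    finally have *: "sqrt (norm z) * norm (?G \<phi>) \<le> e / 2"
    proof -
      assume "norm z * norm (?G \<phi>) \<le> e / 2 * sqrt (norm z)"
      moreover have "norm z * norm (?G \<phi>) = sqrt (norm z) * norm (?G \<phi>) * sqrt (norm z)"
        using real_sqrt_mult_self[of "norm z"] by (simp add: mult_ac)
      ultimately have "sqrt (norm z) * norm (?G \<phi>) * sqrt (norm z) \<le> e / 2 * sqrt (norm z)"
        by (simp only:)
      then show ?thesis
        by (rule mult_right_le_imp_le) (use z1 in \<open>intro real_sqrt_gt_zero, linarith\<close>)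
    qed
    have fd: "(\<lambda>t. f t - \<phi> t) \<in> L1" using f L by (auto simp: L1_def)
    have "y x = ?G f" by (rule green_kernel_free[OF g sol])
    also have "\<dots> = ?G (\<lambda>t. f t - \<phi> t) + ?G \<phi>"
      using gi[OF fd] gi[OF L(1)] by (simp add: right_diff_distrib Henstock_Kurzweil_Integration.integral_diff gi f L)
    finally have "norm (y x) \<le> norm (?G (\<lambda>t. f t - \<phi> t)) + norm (?G \<phi>)"
      by (simp only: norm_triangle_ineq)
    moreover have "norm (?G (\<lambda>t. f t - \<phi> t)) \<le> 4 / sqrt (norm z) * (e / 8)"
      using fd near
      by (intro order_trans[OF green_kernel_integral_le[OF g]] mult_left_mono) (auto simp: L1_iff)
    moreover have "norm (?G \<phi>) \<le> (e / 2) / sqrt (norm z)"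
    proof -
      have "sqrt (norm z) > 0" using z1 by (intro real_sqrt_gt_zero) linarith
      then show ?thesis
        using * by (simp only: pos_le_divide_eq mult.commute)
    qed
    ultimately have "norm (y x) \<le> 4 / sqrt (norm z) * (e / 8) + (e / 2) / sqrt (norm z)"
      by linarith
    also have "\<dots> = e / sqrt (norm z)"
      by simp
    finally show ?thesis .
  qed
  ultimately show ?thesis using that by blast
qed

section \<open>The resolvent family\<close>

lemma ac_on_cong:
  assumes "ac_on a b F f" "\<And>t. t \<in> {a..b} \<Longrightarrow> F t = G t" "\<And>t. t \<in> {a..b} \<Longrightarrow> f t = g t"
  shows "ac_on a b G g"
proof -
  have "ac_on a b F g"
    by (rule ac_on_cong_AE[OF assms(1)]) (use assms(3) in \<open>auto intro!: AE_I2\<close>)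
  then show ?thesis
    using assms(2) unfolding ac_on_def by (metis atLeastAtMost_iff order_refl order_trans)
qed

lemma hill_solution_cong:
  assumes "hill_solution bc Q z f y u" "\<And>t. t \<in> {0..pi} \<Longrightarrow> y t = v t"
  shows "hill_solution bc Q z f v u"
proof -
  have "satisfies_bc bc v u"
    using assms by (cases bc) (auto simp: hill_solution_def)
  moreover have "ac_on 0 pi v (\<lambda>t. u t + Q t * v t)"
    by (rule ac_on_cong[of 0 pi y "\<lambda>t. u t + Q t * y t"]) (use assms in \<open>simp_all add: hill_solution_def\<close>)
  moreover have "ac_on 0 pi u (\<lambda>t. f t - z * v t - Q t * (u t + Q t * v t))"
    by (rule ac_on_cong[of 0 pi u "\<lambda>t. f t - z * y t - Q t * (u t + Q t * y t)"])
       (use assms in \<open>simp_all add: hill_solution_def\<close>)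
  ultimately show ?thesis by (simp add: hill_solution_def)
qed

text \<open>The resolvent on all of \<open>L1\<close>. The value 0 off the interval removes the
  freedom of the choice there, so that linearity, bounds and the resolvent identity hold at every
  real \<open>x\<close>.\<close>

definition hill_res :: "bc \<Rightarrow> (real \<Rightarrow> complex) \<Rightarrow> complex \<Rightarrow> (real \<Rightarrow> complex) \<Rightarrow> real \<Rightarrow> complex"
  where "hill_res bc Q z f x =
    (if x \<in> {0..pi} then (SOME y. \<exists>u. hill_solution bc Q z f y u) x else 0)"

lemma hill_solution_unique:
  assumes Q: "measure_potential Q K" and z: "\<not> eigenvalue bc Q z"
    and "hill_solution bc Q z f y u" "hill_solution bc Q z f v w" "x \<in> {0..pi}"
  shows "y x = v x"
proof -
  have "hill_solution bc Q z (\<lambda>_. 0) (\<lambda>t. y t + - 1 * v t) (\<lambda>t. u t + - 1 * w t)"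
    using hill_solution_add_scale[OF assms(3,4), of "-1"] by simp
  then have "y x + - 1 * v x = 0"
    using z assms(5) unfolding eigenvalue_iff[OF Q] by blast
  then show ?thesis by simp
qed

lemma hill_res_solution:
  assumes "measure_potential Q K" "\<not> eigenvalue bc Q z" "f \<in> L1"
  obtains u where "hill_solution bc Q z f (hill_res bc Q z f) u"
proof -
  have "\<exists>y u. hill_solution bc Q z f y u"
    using hill_solvable[OF assms(1,2)] assms(3) by (metis L1_iff)
  then obtain u where u: "hill_solution bc Q z f (SOME y. \<exists>u. hill_solution bc Q z f y u) u"
    using someI_ex[of "\<lambda>y. \<exists>u. hill_solution bc Q z f y u"] by blast
  have "hill_solution bc Q z f (hill_res bc Q z f) u"
    by (rule hill_solution_cong[OF u]) (simp add: hill_res_def)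
  then show ?thesis using that by blast
qed

lemma hill_res_eq:
  assumes "measure_potential Q K" "\<not> eigenvalue bc Q z" "f \<in> L1"
    and "hill_solution bc Q z f y u" "x \<in> {0..pi}"
  shows "hill_res bc Q z f x = y x"
proof -
  obtain w where "hill_solution bc Q z f (hill_res bc Q z f) w"
    using hill_res_solution[OF assms(1-3)] .
  then show ?thesis
    using hill_solution_unique[OF assms(1,2) _ assms(4,5)] by blast
qed

lemma hill_res_continuous:
  assumes "measure_potential Q K" "\<not> eigenvalue bc Q z" "f \<in> L1"
  shows "continuous_on {0..pi} (hill_res bc Q z f)"
  using hill_res_solution[OF assms] hill_solution_continuous by metis

lemma hill_res_L1:
  assumes "measure_potential Q K" "\<not> eigenvalue bc Q z" "f \<in> L1"
  shows "hill_res bc Q z f \<in> L1"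
  by (rule L2_imp_L1[OF continuous_imp_L2[OF hill_res_continuous[OF assms]]])

lemma L1_add_scale: "f \<in> L1 \<Longrightarrow> g \<in> L1 \<Longrightarrow> (\<lambda>t. f t + c * g t) \<in> L1"
  by (simp add: L1_def)

lemma hill_res_add_scale:
  assumes Q: "measure_potential Q K" "\<not> eigenvalue bc Q z" and "f \<in> L1" "g \<in> L1"
  shows "hill_res bc Q z (\<lambda>t. f t + c * g t) x = hill_res bc Q z f x + c * hill_res bc Q z g x"
proof (cases "x \<in> {0..pi}")
  case True
  obtain u where u: "hill_solution bc Q z f (hill_res bc Q z f) u"
    using hill_res_solution[OF Q assms(3)] .
  obtain v where v: "hill_solution bc Q z g (hill_res bc Q z g) v"
    using hill_res_solution[OF Q assms(4)] .
  show ?thesis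
    by (rule hill_res_eq[OF Q _ hill_solution_add_scale[OF u v] True]) (intro L1_add_scale assms)
next
  case False
  then show ?thesis by (auto simp: hill_res_def)
qed

lemma L1_mass_nonneg: "f \<in> L1 \<Longrightarrow> L1_mass f \<ge> 0"
  by (simp add: L1_mass_eq)

lemma L1_mass_le:
  assumes "f \<in> L1" "\<And>t. t \<in> {0..pi} \<Longrightarrow> norm (f t) \<le> B"
  shows "L1_mass f \<le> pi * B"
proof -
  have "(\<lambda>t. norm (f t)) integrable_on {0..pi}"
    using assms(1) by (auto simp: L1_iff absolutely_integrable_on_def)
  then have "L1_mass f \<le> integral {0..pi} (\<lambda>t. B)"
    unfolding L1_mass_def by (intro integral_le assms) auto
  then show ?thesis by simp
qed

lemma L1_mass_add_scale_le:
  assumes "f \<in> L1" "g \<in> L1"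
  shows "L1_mass (\<lambda>t. f t + c * g t) \<le> L1_mass f + norm c * L1_mass g"
proof -
  have "(\<integral>t. norm (f t + c * g t) \<partial>leb) \<le> (\<integral>t. norm (f t) + norm c * norm (g t) \<partial>leb)"
    using assms by (intro integral_mono) (auto simp: L1_def norm_mult intro: order_trans[OF norm_triangle_ineq])
  also have "\<dots> = (\<integral>t. norm (f t) \<partial>leb) + norm c * (\<integral>t. norm (g t) \<partial>leb)"
    using assms by (subst Bochner_Integration.integral_add) (auto simp: L1_def)
  finally show ?thesis
    using assms L1_add_scale[OF assms] by (simp add: L1_mass_eq)
qed

text \<open>A solution at \<open>z\<close> solves the equation at \<open>w\<close> with source
  \<open>f + (w - z) y\<close>, and for \<open>z\<close> near \<open>w\<close> half of the supremum
  of \<open>y\<close> is absorbed. The bound is first proved for arbitrary solutions: with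
  \<open>f = 0\<close> it excludes eigenvalues near \<open>w\<close>, and only then is the resolvent
  known to exist there.\<close>

lemma hill_res_locally_bounded:
  assumes Q: "measure_potential Q K" and w: "\<not> eigenvalue bc Q w"
  obtains \<delta> C where "\<delta> > 0" "C \<ge> 0"
    "\<And>z. norm (z - w) < \<delta> \<Longrightarrow> \<not> eigenvalue bc Q z"
    "\<And>z f x. norm (z - w) < \<delta> \<Longrightarrow> f \<in> L1 \<Longrightarrow> norm (hill_res bc Q z f x) \<le> C * L1_mass f"
proof -
  obtain C where C: "C \<ge> 0" and "\<And>f. f absolutely_integrable_on {0..pi} \<Longrightarrow>
      \<exists>y u. hill_solution bc Q w f y u \<and> (\<forall>x\<in>{0..pi}. norm (y x) \<le> C * L1_mass f)"
    by (rule hill_solvable[OF Q w]) (rule that, assumption+)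
  then have ex: "\<exists>y u. hill_solution bc Q w f y u \<and> (\<forall>x\<in>{0..pi}. norm (y x) \<le> C * L1_mass f)"
    if "f \<in> L1" for f
    using that unfolding L1_iff by blast
  \<comment> \<open>Makes \<open>C * pi * norm (w - z)\<close> at most \<open>1/2\<close>, where
    \<open>pi\<close> is the cost of bounding a mass by a supremum; \<open>C + 1\<close> avoids a
    zero denominator.\<close>
  define \<delta> where "\<delta> = 1 / (2 * pi * (C + 1))"
  have \<delta>: "\<delta> > 0" using C by (simp add: \<delta>_def)
  have bound: "norm (y x) \<le> 2 * C * L1_mass f"
    if sol: "hill_solution bc Q z f y u" and f: "f \<in> L1" and z: "norm (z - w) < \<delta>" and x: "x \<in> {0..pi}"
    for z f y u x
  proof -
    obtain x1 where x1: "x1 \<in> {0..pi}" and sup: "\<And>t. t \<in> {0..pi} \<Longrightarrow> norm (y t) \<le> norm (y x1)"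
      using hill_solution_attains_sup[OF sol] by blast
    let ?g = "\<lambda>t. f t + (w - z) * y t"
    have yL1: "y \<in> L1"
      by (intro L2_imp_L1 continuous_imp_L2 hill_solution_continuous[OF sol])
    have gL1: "?g \<in> L1" by (rule L1_add_scale[OF f yL1])
    obtain v s where v: "hill_solution bc Q w ?g v s" "\<And>x. x \<in> {0..pi} \<Longrightarrow> norm (v x) \<le> C * L1_mass ?g"
      using ex[OF gL1] by blast
    have "y x1 = v x1"
      by (rule hill_solution_unique[OF Q w hill_solution_shift[OF sol] v(1) x1])
    then have "norm (y x1) \<le> C * L1_mass ?g"
      using v(2)[OF x1] by simp
    also have "\<dots> \<le> C * (L1_mass f + norm (w - z) * (pi * norm (y x1)))"
      using C L1_mass_add_scale_le[OF f yL1, of "w - z"] L1_mass_le[OF yL1 sup]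
      by (intro mult_left_mono order_trans[OF L1_mass_add_scale_le[OF f yL1]] add_left_mono) auto
    also have "\<dots> = C * L1_mass f + (C * pi * norm (w - z)) * norm (y x1)"
      by (simp add: algebra_simps)
    also have "\<dots> \<le> C * L1_mass f + 1 / 2 * norm (y x1)"
    proof (intro add_left_mono mult_right_mono)
      have "C * pi * norm (w - z) \<le> (C + 1) * pi * \<delta>"
        using z C \<delta> by (intro mult_mono) (auto simp: norm_minus_commute)
      also have "\<dots> = 1 / 2"
      proof -
        have "C + 1 \<noteq> 0" using C by simp
        then show ?thesis by (simp add: \<delta>_def)
      qed
      finally show "C * pi * norm (w - z) \<le> 1 / 2" .
    qed auto
    finally show ?thesis using sup[OF x] by linarith
  qed
  have noeig: "\<not> eigenvalue bc Q z" if z: "norm (z - w) < \<delta>" for z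
  proof
    assume "eigenvalue bc Q z"
    then obtain y u x where *: "hill_solution bc Q z (\<lambda>_. 0) y u" "x \<in> {0..pi}" "y x \<noteq> 0"
      unfolding eigenvalue_iff[OF Q] by blast
    have "(\<lambda>_. 0) \<in> L1" by (simp add: L1_def)
    from bound[OF *(1) this z *(2)] show False
      using * by (simp add: L1_mass_def)
  qed
  show ?thesis
  proof (rule that[OF \<delta>])
    show "norm (hill_res bc Q z f x) \<le> 2 * C * L1_mass f" if z: "norm (z - w) < \<delta>" and f: "f \<in> L1" for z f x
    proof (cases "x \<in> {0..pi}")
      case True
      obtain u where "hill_solution bc Q z f (hill_res bc Q z f) u"
        using hill_res_solution[OF Q noeig[OF z] f] .
      from bound[OF this f z True] show ?thesis .
    qed (use C L1_mass_nonneg[OF f] in \<open>auto simp: hill_res_def\<close>)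
  qed (use C noeig in auto)
qed

text \<open>The function obtained at \<open>w\<close> solves the equation at \<open>z\<close> with
  source \<open>f\<close> plus \<open>z - w\<close> times itself; linearity at \<open>z\<close> does
  the rest.\<close>

lemma hill_resolvent_identity:
  assumes Q: "measure_potential Q K" and z: "\<not> eigenvalue bc Q z" and w: "\<not> eigenvalue bc Q w"
    and f: "f \<in> L1"
  shows "hill_res bc Q z f x = hill_res bc Q w f x + (w - z) * hill_res bc Q z (hill_res bc Q w f) x"
proof (cases "x \<in> {0..pi}")
  case True
  let ?y = "hill_res bc Q w f"
  have yL1: "?y \<in> L1" by (rule hill_res_L1[OF Q w f])
  obtain u where u: "hill_solution bc Q w f ?y u"
    using hill_res_solution[OF Q w f] .
  have "hill_res bc Q z (\<lambda>t. f t + (z - w) * ?y t) x = ?y x"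
    by (rule hill_res_eq[OF Q z _ hill_solution_shift[OF u] True]) (rule L1_add_scale[OF f yL1])
  then show ?thesis
    using hill_res_add_scale[OF Q z f yL1, of "z - w" x] by (simp add: algebra_simps)
next
  case False
  then show ?thesis by (auto simp: hill_res_def)
qed

lemma open_not_eigenvalue:
  assumes Q: "measure_potential Q K"
  shows "open {z. \<not> eigenvalue bc Q z}"
  unfolding open_dist
proof
  fix w assume "w \<in> {z. \<not> eigenvalue bc Q z}"
  then obtain \<delta> where "\<delta> > 0" "\<And>z. norm (z - w) < \<delta> \<Longrightarrow> \<not> eigenvalue bc Q z"
    using hill_res_locally_bounded[OF Q, of bc w] by (metis mem_Collect_eq)
  then show "\<exists>e>0. \<forall>z. dist z w < e \<longrightarrow> z \<in> {z. \<not> eigenvalue bc Q z}"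
    by (auto simp: dist_norm)
qed

lemma hill_res_locally_Lipschitz:
  assumes Q: "measure_potential Q K" and w: "\<not> eigenvalue bc Q w"
  obtains \<delta> L where "\<delta> > 0" "L \<ge> 0"
    "\<And>z f x. norm (z - w) < \<delta> \<Longrightarrow> f \<in> L1 \<Longrightarrow>
      norm (hill_res bc Q z f x - hill_res bc Q w f x) \<le> L * norm (z - w) * L1_mass f"
proof -
  obtain \<delta> C where \<delta>: "\<delta> > 0" and C: "C \<ge> 0"
    and ne: "\<And>z. norm (z - w) < \<delta> \<Longrightarrow> \<not> eigenvalue bc Q z"
    and bd: "\<And>z f x. norm (z - w) < \<delta> \<Longrightarrow> f \<in> L1 \<Longrightarrow> norm (hill_res bc Q z f x) \<le> C * L1_mass f"
    using hill_res_locally_bounded[OF Q w] by metis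
  have "norm (hill_res bc Q z f x - hill_res bc Q w f x) \<le> (C * pi * C) * norm (z - w) * L1_mass f"
    if z: "norm (z - w) < \<delta>" and f: "f \<in> L1" for z f x
  proof -
    let ?y = "hill_res bc Q w f"
    have yL1: "?y \<in> L1" by (rule hill_res_L1[OF Q w f])
    have "norm (hill_res bc Q z f x - ?y x) = norm (z - w) * norm (hill_res bc Q z ?y x)"
      using hill_resolvent_identity[OF Q ne[OF z] w f, of x] by (simp add: norm_mult norm_minus_commute)
    also have "\<dots> \<le> norm (z - w) * (C * (pi * (C * L1_mass f)))"
      using \<delta> C by (intro mult_left_mono order_trans[OF bd[OF z yL1]] L1_mass_le yL1 bd f) auto
    finally show ?thesis by (simp add: algebra_simps)
  qed
  then show ?thesis using that[of \<delta> "C * pi * C"] \<delta> C by auto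
qed

text \<open>By the resolvent identity the difference quotient at \<open>w\<close> is exactly minus
  the resolvent at \<open>z\<close> applied to the resolvent at \<open>w\<close> of
  \<open>f\<close>, and the local Lipschitz bound gives its limit. Evaluation at a fixed
  \<open>x\<close> reduces the later deformation of contours to scalar complex analysis.\<close>

lemma hill_res_holomorphic:
  assumes Q: "measure_potential Q K" and f: "f \<in> L1"
  shows "(\<lambda>z. hill_res bc Q z f x) holomorphic_on {z. \<not> eigenvalue bc Q z}"
proof -
  have "((\<lambda>z. hill_res bc Q z f x) has_field_derivative
      - hill_res bc Q w (hill_res bc Q w f) x) (at w)" if w: "\<not> eigenvalue bc Q w" for w
  proof -
    let ?y = "hill_res bc Q w f"
    have yL1: "?y \<in> L1" by (rule hill_res_L1[OF Q w f])
    obtain \<delta> L where \<delta>: "\<delta> > 0" and L: "L \<ge> 0"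
      and lip: "\<And>z f x. norm (z - w) < \<delta> \<Longrightarrow> f \<in> L1 \<Longrightarrow>
        norm (hill_res bc Q z f x - hill_res bc Q w f x) \<le> L * norm (z - w) * L1_mass f"
      using hill_res_locally_Lipschitz[OF Q w] by metis
    obtain \<delta>' where \<delta>': "\<delta>' > 0" "\<And>z. norm (z - w) < \<delta>' \<Longrightarrow> \<not> eigenvalue bc Q z"
      using hill_res_locally_bounded[OF Q w] by metis
    have ev: "\<forall>\<^sub>F z in at w. z \<noteq> w \<and> norm (z - w) < min \<delta> \<delta>'"
      unfolding eventually_at using \<delta> \<delta>' by (intro exI[of _ "min \<delta> \<delta>'"]) (auto simp: dist_norm)
    have "((\<lambda>z. - hill_res bc Q z ?y x) \<longlongrightarrow> - hill_res bc Q w ?y x) (at w)"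
    proof (intro tendsto_minus, subst tendsto_dist_iff, rule tendsto_sandwich)
      show "\<forall>\<^sub>F z in at w. 0 \<le> dist (hill_res bc Q z ?y x) (hill_res bc Q w ?y x)" by simp
      show "\<forall>\<^sub>F z in at w. dist (hill_res bc Q z ?y x) (hill_res bc Q w ?y x) \<le> L * norm (z - w) * L1_mass ?y"
        using ev by eventually_elim (auto simp: dist_norm intro: lip yL1)
      have "((\<lambda>z. L * norm (z - w) * L1_mass ?y) \<longlongrightarrow> L * norm (w - w) * L1_mass ?y) (at w)"
        by (intro tendsto_intros)
      then show "((\<lambda>z. L * norm (z - w) * L1_mass ?y) \<longlongrightarrow> 0) (at w)" by simp
    qed simp
    moreover have "\<forall>\<^sub>F z in at w. - hill_res bc Q z ?y x = (hill_res bc Q z f x - hill_res bc Q w f x) / (z - w)"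
      using ev
    proof eventually_elim
      case (elim z)
      then have "hill_res bc Q z f x - hill_res bc Q w f x = (w - z) * hill_res bc Q z ?y x"
        using hill_resolvent_identity[OF Q _ w f, of z x] \<delta>'(2)[of z] by simp
      then show ?case using elim by (simp add: field_simps)
    qed
    ultimately show ?thesis
      unfolding has_field_derivative_iff by (rule Lim_transform_eventually)
  qed
  then show ?thesis
    unfolding holomorphic_on_def by (auto simp: field_differentiable_def intro: has_field_derivative_at_within)
qed

text \<open>Both sides solve the same equation through continuous representatives, so they agree at
  every point of the interval and not merely almost everywhere.\<close>

lemma resolvent_eq_hill_res:
  assumes Q: "measure_potential Q K" and z: "\<not> eigenvalue bc Q z" and f: "f \<in> L2" and x: "x \<in> {0..pi}"
  shows "resolvent bc Q z f x = hill_res bc Q z f x"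
proof -
  have fL1: "f \<in> L1" by (rule L2_imp_L1[OF f])
  obtain u where u: "hill_solution bc Q z f (hill_res bc Q z f) u"
    using hill_res_solution[OF Q z fL1] .
  have "\<exists>y w. hill_op bc Q y w \<and> (AE x in leb. z * y x - w x = f x)"
    using hill_solution_imp_hill_op[OF Q u f]
    by (intro exI[of _ "hill_res bc Q z f"] exI[of _ "\<lambda>x. z * hill_res bc Q z f x - f x"]) auto
  then have "\<exists>w. hill_op bc Q (resolvent bc Q z f) w \<and> (AE x in leb. z * resolvent bc Q z f x - w x = f x)"
    unfolding resolvent_def by (rule someI_ex)
  then obtain v where "hill_solution bc Q z f (resolvent bc Q z f) v"
    using hill_op_imp_solution by metis
  then show ?thesis
    using hill_res_eq[OF Q z fL1 _ x] by simp
qed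

section \<open>Contour integrals of the resolvent\<close>

text \<open>Completeness is what allows continuous functions with values in this space to be
  integrated.\<close>

instance bcontfun :: (metric_space, banach) banach ..

lemma path_image_subset_apply:
  "path_image \<gamma> \<subseteq> S \<Longrightarrow> t \<in> {0..1} \<Longrightarrow> \<gamma> t \<in> S"
  unfolding path_image_def by blast

text \<open>
  A bounded operator from $L^1$ to the bounded functions is encoded by its values on the unit ball,
  a bounded function of the pair \<open>(f, x)\<close>. The discrete topology makes these functions a Banach
  space with the operator norm, so that the Henstock--Kurzweil integral of the library applies.
\<close>

definition res_ball ::
    "bc \<Rightarrow> (real \<Rightarrow> complex) \<Rightarrow> complex \<Rightarrow> complex \<Rightarrow> ((real \<Rightarrow> complex) \<times> real) discrete \<Rightarrow>\<^sub>C complex"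
  where "res_ball bc Q c z = Bcontfun (\<lambda>p. case of_discrete p of (f, x) \<Rightarrow>
    if f \<in> L1 \<and> L1_mass f \<le> 1 then c * hill_res bc Q z f x else 0)"

lemma res_ball_apply:
  assumes Q: "measure_potential Q K" and z: "\<not> eigenvalue bc Q z"
  shows "res_ball bc Q c z (discrete (f, x)) =
    (if f \<in> L1 \<and> L1_mass f \<le> 1 then c * hill_res bc Q z f x else 0)"
proof -
  let ?F = "\<lambda>p. case of_discrete p of (f, x) \<Rightarrow>
    if f \<in> L1 \<and> L1_mass f \<le> 1 then c * hill_res bc Q z f x else 0"
  obtain \<delta> C where \<delta>: "\<delta> > 0" and C: "C \<ge> 0"
    and bd: "\<And>w f x. norm (w - z) < \<delta> \<Longrightarrow> f \<in> L1 \<Longrightarrow> norm (hill_res bc Q w f x) \<le> C * L1_mass f"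
    using hill_res_locally_bounded[OF Q z] by metis
  have "?F \<in> bcontfun"
  proof (rule bcontfun_normI)
    show "continuous_on UNIV ?F"
      by (simp add: continuous_on_open_vimage open_discrete)
    show "norm (?F p) \<le> norm c * C" for p
    proof -
      obtain f x where p: "of_discrete p = (f, x)" by (cases "of_discrete p")
      show ?thesis
      proof (cases "f \<in> L1 \<and> L1_mass f \<le> 1")
        case True
        then have "norm (hill_res bc Q z f x) \<le> C * L1_mass f"
          using bd[of z] \<delta> by simp
        also have "\<dots> \<le> C * 1" using True C by (intro mult_left_mono) auto
        finally show ?thesis using True by (simp add: p norm_mult mult_left_mono)
      qed (use C in \<open>auto simp: p\<close>)
    qed
  qed
  then show ?thesis
    by (simp add: res_ball_def Bcontfun_inverse discrete_inverse)
qed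

lemma continuous_on_res_ball:
  assumes Q: "measure_potential Q K"
  shows "continuous_on {z. \<not> eigenvalue bc Q z} (res_ball bc Q c)"
  unfolding continuous_on_eq_continuous_within
proof
  fix w assume "w \<in> {z. \<not> eigenvalue bc Q z}"
  then have w: "\<not> eigenvalue bc Q w" by simp
  obtain \<delta> L where \<delta>: "\<delta> > 0" and L: "L \<ge> 0"
    and lip: "\<And>z f x. norm (z - w) < \<delta> \<Longrightarrow> f \<in> L1 \<Longrightarrow>
      norm (hill_res bc Q z f x - hill_res bc Q w f x) \<le> L * norm (z - w) * L1_mass f"
    using hill_res_locally_Lipschitz[OF Q w] by metis
  let ?S = "{z. \<not> eigenvalue bc Q z}"
  have near: "dist (res_ball bc Q c z) (res_ball bc Q c w) \<le> norm c * L * norm (z - w)"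
    if z: "norm (z - w) < \<delta>" "\<not> eigenvalue bc Q z" for z
  proof (rule dist_bound)
    fix p :: "((real \<Rightarrow> complex) \<times> real) discrete"
    obtain f x where p: "p = discrete (f, x)"
      by (metis of_discrete_inverse surj_pair)
    show "dist (res_ball bc Q c z p) (res_ball bc Q c w p) \<le> norm c * L * norm (z - w)"
    proof (cases "f \<in> L1 \<and> L1_mass f \<le> 1")
      case True
      have "norm (hill_res bc Q z f x - hill_res bc Q w f x) \<le> L * norm (z - w) * L1_mass f"
        using True lip[OF z(1)] by blast
      also have "\<dots> \<le> L * norm (z - w) * 1"
        using True L by (intro mult_left_mono) auto
      finally show ?thesis
        using True unfolding p res_ball_apply[OF Q z(2)] res_ball_apply[OF Q w]
        by (simp add: dist_norm right_diff_distrib[symmetric] norm_mult mult.assoc mult_left_mono)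
    next
      case False
      then show ?thesis
        unfolding p res_ball_apply[OF Q z(2)] res_ball_apply[OF Q w] using L by auto
    qed
  qed
  have "((\<lambda>z. res_ball bc Q c z) \<longlongrightarrow> res_ball bc Q c w) (at w within ?S)"
  proof (subst tendsto_dist_iff, rule tendsto_sandwich)
    show "\<forall>\<^sub>F z in at w within ?S. 0 \<le> dist (res_ball bc Q c z) (res_ball bc Q c w)" by simp
    have "\<forall>\<^sub>F z in at w within ?S. z \<in> ?S \<and> norm (z - w) < \<delta>"
      unfolding eventually_at using \<delta> by (intro exI[of _ \<delta>]) (auto simp: dist_norm)
    then show "\<forall>\<^sub>F z in at w within ?S. dist (res_ball bc Q c z) (res_ball bc Q c w) \<le> norm c * L * norm (z - w)"
      by eventually_elim (auto intro: near)
    have "((\<lambda>z. norm c * L * norm (z - w)) \<longlongrightarrow> norm c * L * norm (w - w)) (at w within ?S)"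
      by (intro tendsto_intros)
    then show "((\<lambda>z. norm c * L * norm (z - w)) \<longlongrightarrow> 0) (at w within ?S)" by simp
  qed simp
  then show "continuous (at w within ?S) (res_ball bc Q c)"
    by (simp add: continuous_within)
qed

text \<open>On an affine piece the velocity of the path is the constant \<open>d\<close> except
  possibly at the two ends, where changing the integrand is harmless; with a constant velocity the
  integrand is continuous.\<close>

lemma res_ball_integrable_affine:
  assumes Q: "measure_potential Q K"
    and \<gamma>: "continuous_on {0..1} \<gamma>" "\<gamma> ` {0..1} \<subseteq> {z. \<not> eigenvalue bc Q z}"
    and ab: "0 \<le> a" "a < b" "b \<le> 1"
    and aff: "\<And>t. t \<in> {a<..<b} \<Longrightarrow> \<gamma> t = p + t *\<^sub>R d"
  shows "(\<lambda>t. res_ball bc Q (vector_derivative \<gamma> (at t within {0..1})) (\<gamma> t)) integrable_on {a..b}"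
proof -
  have sub: "{a..b} \<subseteq> {0..1}" using ab by auto
  have "continuous_on {a..b} (\<lambda>t. res_ball bc Q d (\<gamma> t))"
    by (rule continuous_on_compose2[OF continuous_on_res_ball[OF Q] continuous_on_subset[OF \<gamma>(1) sub]])
       (use \<gamma>(2) sub in blast)
  then have "(\<lambda>t. res_ball bc Q d (\<gamma> t)) integrable_on {a..b}"
    by (rule integrable_continuous_real)
  then show ?thesis
  proof (rule integrable_spike_finite[of "{a, b}", rotated 2])
    fix t assume t: "t \<in> {a..b} - {a, b}"
    have "((\<lambda>t. p + t *\<^sub>R d) has_vector_derivative d) (at t)"
      by (auto intro!: derivative_eq_intros)
    then have "(\<gamma> has_vector_derivative d) (at t)"
      by (rule has_vector_derivative_transform_within_open[of _ _ _ "{a<..<b}"]) (use t aff in auto)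
    then have "(\<gamma> has_vector_derivative d) (at t within {0..1})"
      by (rule has_vector_derivative_at_within)
    then have "vector_derivative \<gamma> (at t within {0..1}) = d"
      by (intro vector_derivative_within_closed_interval) (use t ab in auto)
    then show "res_ball bc Q (vector_derivative \<gamma> (at t within {0..1})) (\<gamma> t) = res_ball bc Q d (\<gamma> t)"
      by simp
  qed simp
qed

lemma res_ball_integrable_rectpath:
  fixes a b :: complex
  defines "\<gamma> \<equiv> rectpath a b"
  assumes Q: "measure_potential Q K" and im: "path_image \<gamma> \<subseteq> {z. \<not> eigenvalue bc Q z}"
  shows "(\<lambda>t. res_ball bc Q (vector_derivative \<gamma> (at t within {0..1})) (\<gamma> t)) integrable_on {0..1}"
proof -
  define a2 where "a2 = Complex (Re b) (Im a)"
  define a4 where "a4 = Complex (Re a) (Im b)"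
  have \<gamma>: "\<gamma> = linepath a a2 +++ linepath a2 b +++ linepath b a4 +++ linepath a4 a"
    by (simp add: \<gamma>_def rectpath_def Let_def a2_def a4_def)
  have cont: "continuous_on {0..1} \<gamma>"
    using path_rectpath[of a b] unfolding path_def \<gamma>_def .
  note piece = res_ball_integrable_affine[OF Q cont im[unfolded path_image_def]]
  let ?\<Psi> = "\<lambda>t. res_ball bc Q (vector_derivative \<gamma> (at t within {0..1})) (\<gamma> t)"
  \<comment> \<open>The right-nested \<open>+++\<close> gives each side half of the remaining
    parameter interval, so the corners sit at \<open>1/2\<close>, \<open>3/4\<close>,
    \<open>7/8\<close> and the four sides are traversed with factors 2, 4, 8, 8.\<close>
  have i1: "?\<Psi> integrable_on {0..1/2}"
    by (rule piece[where p=a and d="2 *\<^sub>R (a2 - a)"])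
       (auto simp: \<gamma> joinpaths_def linepath_def algebra_simps)
  have i2: "?\<Psi> integrable_on {1/2..3/4}"
    by (rule piece[where p="a2 - 2 *\<^sub>R (b - a2)" and d="4 *\<^sub>R (b - a2)"])
       (auto simp: \<gamma> joinpaths_def linepath_def algebra_simps)
  have i3: "?\<Psi> integrable_on {3/4..7/8}"
    by (rule piece[where p="b - 6 *\<^sub>R (a4 - b)" and d="8 *\<^sub>R (a4 - b)"])
       (auto simp: \<gamma> joinpaths_def linepath_def algebra_simps)
  have i4: "?\<Psi> integrable_on {7/8..1}"
    by (rule piece[where p="a4 - 7 *\<^sub>R (a - a4)" and d="8 *\<^sub>R (a - a4)"])
       (auto simp: \<gamma> joinpaths_def linepath_def algebra_simps)
  note combine = Henstock_Kurzweil_Integration.integrable_combine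
  have "?\<Psi> integrable_on {0..3/4}"
    by (rule combine[OF _ _ i1 i2]) auto
  then have "?\<Psi> integrable_on {0..7/8}"
    by (rule combine[rotated 2, OF _ i3]) auto
  then show ?thesis
    by (rule combine[rotated 2, OF _ i4]) auto
qed

section \<open>Scalar contour integrals and their uniform Riemann sums\<close>

lemma hill_res_contour_integrable:
  assumes "measure_potential Q K" "f \<in> L1" "valid_path \<gamma>"
    and "path_image \<gamma> \<subseteq> {z. \<not> eigenvalue bc Q z}"
  shows "(\<lambda>z. hill_res bc Q z f x) contour_integrable_on \<gamma>"
  by (rule contour_integrable_holomorphic_simple[OF hill_res_holomorphic open_not_eigenvalue]) (use assms in auto)

lemma contour_integral_hill_res_add_scale:
  assumes Q: "measure_potential Q K" and "f \<in> L1" "g \<in> L1" "valid_path \<gamma>"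
    and im: "path_image \<gamma> \<subseteq> {z. \<not> eigenvalue bc Q z}"
  shows "contour_integral \<gamma> (\<lambda>z. hill_res bc Q z (\<lambda>t. f t + c * g t) x) =
    contour_integral \<gamma> (\<lambda>z. hill_res bc Q z f x) + c * contour_integral \<gamma> (\<lambda>z. hill_res bc Q z g x)"
proof -
  have "contour_integral \<gamma> (\<lambda>z. hill_res bc Q z (\<lambda>t. f t + c * g t) x) =
      contour_integral \<gamma> (\<lambda>z. hill_res bc Q z f x + c * hill_res bc Q z g x)"
    by (rule contour_integral_eq) (use im hill_res_add_scale[OF Q _ assms(2,3)] in auto)
  also have "\<dots> = contour_integral \<gamma> (\<lambda>z. hill_res bc Q z f x) + c * contour_integral \<gamma> (\<lambda>z. hill_res bc Q z g x)"
    using hill_res_contour_integrable[OF Q assms(2,4) im] hill_res_contour_integrable[OF Q assms(3,4) im]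
    by (simp add: contour_integral_add contour_integrable_lmul contour_integral_lmul)
  finally show ?thesis .
qed

text \<open>Convergence in the norm of the encoding space is uniform over \<open>x\<close> and over
  the unit ball of \<open>L1\<close>. Evaluation at a pair is bounded linear and identifies the
  limit with the scalar contour integral; homogeneity in \<open>f\<close> then extends the estimate
  beyond the ball.\<close>

lemma riemann_sums_hill_res:
  fixes a b :: complex
  defines "\<gamma> \<equiv> rectpath a b"
  assumes Q: "measure_potential Q K" and im: "path_image \<gamma> \<subseteq> {z. \<not> eigenvalue bc Q z}" and "e > 0"
  shows "\<forall>\<^sub>F p in division_filter {0..1}. \<forall>f\<in>L1. \<forall>x.
    norm ((\<Sum>(t, k)\<in>p. measure lborel k *\<^sub>R
        (vector_derivative \<gamma> (at t within {0..1}) * hill_res bc Q (\<gamma> t) f x))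
      - contour_integral \<gamma> (\<lambda>z. hill_res bc Q z f x)) \<le> e * L1_mass f"
proof -
  let ?\<Psi> = "\<lambda>t. res_ball bc Q (vector_derivative \<gamma> (at t within {0..1})) (\<gamma> t)"
  let ?vd = "\<lambda>t. vector_derivative \<gamma> (at t within {0..1})"
  let ?T = "\<lambda>f x. contour_integral \<gamma> (\<lambda>z. hill_res bc Q z f x)"
  have vp: "valid_path \<gamma>" by (simp add: \<gamma>_def)
  have ne: "\<not> eigenvalue bc Q (\<gamma> t)" if "t \<in> {0..1}" for t
    using path_image_subset_apply[OF im that] by simp
  obtain I where I: "(?\<Psi> has_integral I) {0..1}"
    using res_ball_integrable_rectpath[OF Q im[unfolded \<gamma>_def]] unfolding \<gamma>_def by blast
  have I_eq: "I (discrete (f, x)) = ?T f x" if f: "f \<in> L1" "L1_mass f \<le> 1" for f x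
  proof -
    have "bounded_linear (\<lambda>\<Phi> :: ((real \<Rightarrow> complex) \<times> real) discrete \<Rightarrow>\<^sub>C complex. \<Phi> (discrete (f, x)))"
      by (rule bounded_linear_intro[of _ 1]) (auto simp: norm_bounded)
    from has_integral_linear[OF I this]
    have "((\<lambda>t. ?\<Psi> t (discrete (f, x))) has_integral I (discrete (f, x))) {0..1}"
      by (simp add: o_def)
    then have "((\<lambda>t. hill_res bc Q (\<gamma> t) f x * ?vd t) has_integral I (discrete (f, x))) {0..1}"
      by (rule has_integral_eq[rotated]) (use f in \<open>simp add: res_ball_apply[OF Q ne] mult.commute\<close>)
    then have "((\<lambda>z. hill_res bc Q z f x) has_contour_integral I (discrete (f, x))) \<gamma>"
      unfolding has_contour_integral_def .
    then show ?thesis by (rule contour_integral_unique[symmetric])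
  qed
  have "((\<lambda>p. \<Sum>(t, k)\<in>p. measure lborel k *\<^sub>R ?\<Psi> t) \<longlongrightarrow> I) (division_filter {0..1})"
    using I has_integral_cbox[of ?\<Psi> I 0 1] by simp
  then have "\<forall>\<^sub>F p in division_filter {0..1}. dist (\<Sum>(t, k)\<in>p. measure lborel k *\<^sub>R ?\<Psi> t) I < e"
    using \<open>e > 0\<close> by (rule tendstoD)
  then show ?thesis
    using eventually_division_filter_tagged_division[of "{0..1::real}"]
  proof eventually_elim
    case (elim p)
    have tag: "t \<in> {0..1}" if "(t, k) \<in> p" for t k
      using elim(2) that by (meson subsetD tag_in_interval)
    let ?S = "\<lambda>f x. \<Sum>(t, k)\<in>p. measure lborel k *\<^sub>R (?vd t * hill_res bc Q (\<gamma> t) f x)"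
    have ball: "norm (?S f x - ?T f x) \<le> e" if f: "f \<in> L1" "L1_mass f \<le> 1" for f x
    proof -
      have lin: "linear (\<lambda>\<Phi> :: ((real \<Rightarrow> complex) \<times> real) discrete \<Rightarrow>\<^sub>C complex. \<Phi> (discrete (f, x)))"
        by (rule linearI) auto
      have "(\<Sum>(t, k)\<in>p. measure lborel k *\<^sub>R ?\<Psi> t) (discrete (f, x)) = ?S f x"
        unfolding linear_sum[OF lin]
        by (rule sum.cong) (use f tag in \<open>auto simp: res_ball_apply[OF Q ne]\<close>)
      then have "norm (?S f x - ?T f x) = dist ((\<Sum>(t, k)\<in>p. measure lborel k *\<^sub>R ?\<Psi> t) (discrete (f, x))) (I (discrete (f, x)))"
        by (simp add: dist_norm I_eq[OF f])
      also have "\<dots> \<le> e"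
        using dist_bounded elim(1) by (meson less_imp_le order_trans)
      finally show ?thesis .
    qed
    show ?case
    proof (intro ballI allI)
      fix f x assume f: "f \<in> L1"
      show "norm (?S f x - ?T f x) \<le> e * L1_mass f"
      proof (rule field_le_epsilon)
        fix \<eta> :: real assume "\<eta> > 0"
        \<comment> \<open>Dividing by the mass itself would fail for mass 0; the surplus
          \<open>\<eta> / e\<close> keeps \<open>s\<close> positive and costs \<open>\<eta>\<close>
          after multiplication by \<open>e\<close>.\<close>
        define s where "s = L1_mass f + \<eta> / e"
        have s: "s > 0" using \<open>\<eta> > 0\<close> \<open>e > 0\<close> L1_mass_nonneg[OF f] by (simp add: s_def add_nonneg_pos)
        define g where "g t = 0 + (1 / of_real s) * f t" for t
        have zL1: "(\<lambda>_. 0) \<in> L1" by (simp add: L1_def)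
        have gL1: "g \<in> L1" unfolding g_def by (rule L1_add_scale[OF zL1 f])
        have "L1_mass g \<le> L1_mass (\<lambda>_. 0) + norm (1 / complex_of_real s) * L1_mass f"
          unfolding g_def by (rule L1_mass_add_scale_le[OF zL1 f])
        also have "\<dots> = L1_mass f / s" using s by (simp add: L1_mass_def norm_divide)
        also have "\<dots> \<le> 1" using s \<open>\<eta> > 0\<close> \<open>e > 0\<close> by (simp add: s_def divide_le_eq)
        finally have g1: "L1_mass g \<le> 1" .
        have fg: "f = (\<lambda>t. 0 + of_real s * g t)"
          using s by (simp add: g_def)
        have z0: "hill_res bc Q z (\<lambda>_. 0) x = 0" if "\<not> eigenvalue bc Q z" for z
          using hill_res_add_scale[OF Q that zL1 zL1, of 1 x] by simp
        have "hill_res bc Q z f x = of_real s * hill_res bc Q z g x" if "\<not> eigenvalue bc Q z" for z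
          using hill_res_add_scale[OF Q that zL1 gL1, of "of_real s" x] z0[OF that]
          unfolding fg[symmetric] by simp
        then have "?S f x = (\<Sum>(t, k)\<in>p. of_real s * (measure lborel k *\<^sub>R (?vd t * hill_res bc Q (\<gamma> t) g x)))"
          by (intro sum.cong) (use tag ne in auto)
        also have "\<dots> = of_real s * ?S g x"
          by (simp add: sum_distrib_left case_prod_unfold)
        finally have S: "?S f x = of_real s * ?S g x" .
        have "?T (\<lambda>_. 0) x = 0"
          using contour_integral_hill_res_add_scale[OF Q zL1 zL1 vp im, of 1 x] by simp
        then have T: "?T f x = of_real s * ?T g x"
          using contour_integral_hill_res_add_scale[OF Q zL1 gL1 vp im, of "of_real s" x]
          unfolding fg[symmetric] by simp
        have "norm (?S f x - ?T f x) = s * norm (?S g x - ?T g x)"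
          unfolding S T right_diff_distrib[symmetric] norm_mult using s by simp
        also have "\<dots> \<le> s * e"
          using s ball[OF gL1 g1] by (intro mult_left_mono) auto
        also have "\<dots> = e * L1_mass f + \<eta>"
          using \<open>e > 0\<close> by (simp add: s_def field_simps)
        finally show "norm (?S f x - ?T f x) \<le> e * L1_mass f + \<eta>" .
      qed
    qed
  qed
qed

text \<open>The Riemann sums are continuous in \<open>x\<close> and converge uniformly.\<close>

lemma contour_integral_hill_res_continuous:
  assumes Q: "measure_potential Q K" and im: "path_image (rectpath a b) \<subseteq> {z. \<not> eigenvalue bc Q z}"
    and f: "f \<in> L1"
  shows "continuous_on {0..pi} (\<lambda>x. contour_integral (rectpath a b) (\<lambda>z. hill_res bc Q z f x))"
proof (rule uniform_limit_theorem)
  let ?\<gamma> = "rectpath a b"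
  let ?S = "\<lambda>p x. \<Sum>(t, k)\<in>p. measure lborel k *\<^sub>R
        (vector_derivative ?\<gamma> (at t within {0..1}) * hill_res bc Q (?\<gamma> t) f x)"
  show "\<forall>\<^sub>F p in division_filter {0..1::real}. continuous_on {0..pi} (?S p)"
    using eventually_division_filter_tagged_division[of "{0..1::real}"]
  proof eventually_elim
    case (elim p)
    have "t \<in> {0..1}" if "(t, k) \<in> p" for t k
      using elim that by (meson subsetD tag_in_interval)
    then have "\<not> eigenvalue bc Q (?\<gamma> t)" if "(t, k) \<in> p" for t k
      using path_image_subset_apply[OF im] that by blast
    then show ?case
      by (auto intro!: continuous_intros hill_res_continuous[OF Q _ f] simp: case_prod_unfold)
  qed
  show "uniform_limit {0..pi} ?S (\<lambda>x. contour_integral ?\<gamma> (\<lambda>z. hill_res bc Q z f x)) (division_filter {0..1})"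
  proof (rule uniform_limitI)
    fix e :: real assume "e > 0"
    define e' where "e' = e / (L1_mass f + 1)"
    have m: "L1_mass f \<ge> 0" by (rule L1_mass_nonneg[OF f])
    then have "e' > 0" using \<open>e > 0\<close> by (simp add: e'_def)
    have lt: "e' * L1_mass f < e"
      using \<open>e > 0\<close> m by (simp add: e'_def field_simps)
    show "\<forall>\<^sub>F p in division_filter {0..1}. \<forall>x\<in>{0..pi}.
        dist (?S p x) (contour_integral ?\<gamma> (\<lambda>z. hill_res bc Q z f x)) < e"
      using riemann_sums_hill_res[OF Q im \<open>e' > 0\<close>]
    proof eventually_elim
      case (elim p)
      then show ?case
        using f lt unfolding dist_norm by (blast intro: le_less_trans)
    qed
  qed
  show "division_filter {0..1::real} \<noteq> bot"
    using division_filter_not_empty[of 0 "1::real"] by simp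
qed

text \<open>A single partition of accuracy 1 suffices: the integral differs by at most the mass of
  \<open>f\<close> from a finite sum of bounded operators.\<close>

lemma contour_integral_hill_res_bounded:
  assumes Q: "measure_potential Q K" and im: "path_image (rectpath a b) \<subseteq> {z. \<not> eigenvalue bc Q z}"
  obtains C where "C \<ge> 0"
    "\<And>f x. f \<in> L1 \<Longrightarrow> norm (contour_integral (rectpath a b) (\<lambda>z. hill_res bc Q z f x)) \<le> C * L1_mass f"
proof -
  let ?\<gamma> = "rectpath a b"
  let ?vd = "\<lambda>t. vector_derivative ?\<gamma> (at t within {0..1})"
  have "\<forall>\<^sub>F p in division_filter {0..1::real}. p tagged_division_of {0..1} \<and> (\<forall>f\<in>L1. \<forall>x.
    norm ((\<Sum>(t, k)\<in>p. measure lborel k *\<^sub>R (?vd t * hill_res bc Q (?\<gamma> t) f x))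
      - contour_integral ?\<gamma> (\<lambda>z. hill_res bc Q z f x)) \<le> 1 * L1_mass f)"
    by (intro eventually_conj riemann_sums_hill_res[OF Q im] eventually_division_filter_tagged_division) simp
  then obtain p where p: "p tagged_division_of {0..1::real}" and
    S: "\<And>f x. f \<in> L1 \<Longrightarrow> norm ((\<Sum>(t, k)\<in>p. measure lborel k *\<^sub>R (?vd t * hill_res bc Q (?\<gamma> t) f x))
      - contour_integral ?\<gamma> (\<lambda>z. hill_res bc Q z f x)) \<le> 1 * L1_mass f"
    using eventually_happens'[OF division_filter_not_empty[of 0 "1::real"]] by fastforce
  have "\<exists>C\<ge>0. \<forall>f\<in>L1. \<forall>x. norm (measure lborel k *\<^sub>R (?vd t * hill_res bc Q (?\<gamma> t) f x)) \<le> C * L1_mass f"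
    if "(t, k) \<in> p" for t k
  proof -
    have "t \<in> {0..1}" using p that by (meson subsetD tag_in_interval)
    then have ne: "\<not> eigenvalue bc Q (?\<gamma> t)"
      using path_image_subset_apply[OF im] by blast
    obtain \<delta> C where \<delta>: "\<delta> > 0" and C: "C \<ge> 0"
      and bd: "\<And>w f x. norm (w - ?\<gamma> t) < \<delta> \<Longrightarrow> f \<in> L1 \<Longrightarrow> norm (hill_res bc Q w f x) \<le> C * L1_mass f"
      using hill_res_locally_bounded[OF Q ne] by metis
    have "norm (measure lborel k *\<^sub>R (?vd t * hill_res bc Q (?\<gamma> t) f x)) \<le> (measure lborel k * norm (?vd t) * C) * L1_mass f"
      if f: "f \<in> L1" for f x
    proof -
      have "norm (hill_res bc Q (?\<gamma> t) f x) \<le> C * L1_mass f"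
        using bd[of "?\<gamma> t"] \<delta> f by simp
      then show ?thesis
        by (auto simp: norm_mult mult.assoc intro!: mult_left_mono)
    qed
    moreover have "measure lborel k * norm (?vd t) * C \<ge> 0" using C by simp
    ultimately show ?thesis by blast
  qed
  then obtain C where C: "\<And>t k. (t, k) \<in> p \<Longrightarrow> C t k \<ge> 0"
    "\<And>t k f x. (t, k) \<in> p \<Longrightarrow> f \<in> L1 \<Longrightarrow>
      norm (measure lborel k *\<^sub>R (?vd t * hill_res bc Q (?\<gamma> t) f x)) \<le> C t k * L1_mass f"
    by metis
  show ?thesis
  proof (rule that)
    show "0 \<le> (\<Sum>(t, k)\<in>p. C t k) + 1"
      using C(1) by (intro add_nonneg_nonneg sum_nonneg) auto
    fix f x assume f: "f \<in> L1"
    let ?S = "\<Sum>(t, k)\<in>p. measure lborel k *\<^sub>R (?vd t * hill_res bc Q (?\<gamma> t) f x)"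
    have "norm ?S \<le> (\<Sum>(t, k)\<in>p. C t k * L1_mass f)"
      by (rule sum_norm_le) (use C(2) f in auto)
    also have "\<dots> = (\<Sum>(t, k)\<in>p. C t k) * L1_mass f"
      by (simp add: sum_distrib_right case_prod_unfold)
    finally have "norm ?S \<le> (\<Sum>(t, k)\<in>p. C t k) * L1_mass f" .
    then show "norm (contour_integral ?\<gamma> (\<lambda>z. hill_res bc Q z f x)) \<le> ((\<Sum>(t, k)\<in>p. C t k) + 1) * L1_mass f"
      using S[OF f, of x] norm_triangle_sub[of "contour_integral ?\<gamma> (\<lambda>z. hill_res bc Q z f x)" ?S]
      by (simp add: norm_minus_commute distrib_right)
  qed
qed

text \<open>Neither the rectangle nor the disc need contain the other, so the contours are compared
  through winding numbers. A point outside \<open>S\<close> is either inside both, or has real part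
  above \<open>\<rho>\<close> and is outside both, so the global Cauchy theorem applies to their
  difference.\<close>

lemma rectpath_circlepath_integral:
  assumes S: "open S" and hol: "f holomorphic_on S" and pos: "\<omega> > 0" "h > 0" "\<rho> > 0"
    and out: "\<And>w. w \<notin> S \<Longrightarrow> Re w \<le> \<rho> \<Longrightarrow> w \<in> box (Complex (- \<omega>) (- h)) (Complex \<rho> h) \<and> norm w < \<rho>"
  shows "contour_integral (rectpath (Complex (- \<omega>) (- h)) (Complex \<rho> h)) f
    = contour_integral (circlepath 0 \<rho>) f"
proof -
  let ?a = "Complex (- \<omega>) (- h)" and ?b = "Complex \<rho> h" and ?m = "Complex \<rho> (- h)" and ?r = "complex_of_real \<rho>"
  define R where "R = rectpath ?a ?b"
  define C where "C = circlepath 0 \<rho>"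
  define P where "P = linepath ?a ?m +++ linepath ?m ?r"
  have ends: "pathstart R = ?a" "pathfinish R = ?a" "pathstart C = ?r" "pathfinish C = ?r"
    "pathstart P = ?a" "pathfinish P = ?r"
    by (simp_all add: R_def C_def P_def)
  have vp: "valid_path R" "valid_path C" "valid_path P"
    by (auto simp: R_def C_def P_def intro!: valid_path_join)
  note path = vp[THEN valid_path_imp_path]
  have inS: "w \<in> S" if "Re w \<le> \<rho>" "w \<notin> box ?a ?b \<or> norm w \<ge> \<rho>" for w
    using out[of w] that by force
  have R: "path_image R \<subseteq> S"
    unfolding R_def using pos
    by (auto simp: path_image_rectpath_cbox_minus_box in_cbox_complex_iff intro!: inS)
  have C: "path_image C \<subseteq> S"
    unfolding C_def using pos
    by (auto intro!: inS order_trans[OF complex_Re_le_cmod])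
  have P: "path_image P \<subseteq> S"
  proof -
    have "path_image P \<subseteq> closed_segment ?a ?m \<union> closed_segment ?m ?r"
      unfolding P_def by (simp add: path_image_join)
    also have "closed_segment ?a ?m \<subseteq> S"
      using pos by (auto simp: closed_segment_same_Im closed_segment_eq_real_ivl in_box_complex_iff intro!: inS)
    moreover have "closed_segment ?m ?r \<subseteq> S"
      using pos by (auto simp: closed_segment_same_Re closed_segment_eq_real_ivl in_box_complex_iff intro!: inS)
    ultimately show ?thesis by blast
  qed
  \<comment> \<open>\<open>P\<close> follows the rectangle from its corner to the point
    \<open>\<rho>\<close> of the circle. It joins the two closed contours into one and is run
    through in both directions, so its contributions cancel.\<close>
  define G where "G = R +++ (P +++ (reversepath C +++ reversepath P))"
  have "(f has_contour_integral 0) G"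
  proof (rule Cauchy_theorem_global[OF S hol])
    show "valid_path G"
      unfolding G_def using vp ends by (auto intro!: valid_path_join)
    show "pathfinish G = pathstart G"
      unfolding G_def using ends by simp
    show "path_image G \<subseteq> S"
      unfolding G_def using R C P ends by (simp add: path_image_join)
    fix w assume w: "w \<notin> S"
    have nin: "w \<notin> path_image R" "w \<notin> path_image C" "w \<notin> path_image P"
      using w R C P by auto
    have "winding_number G w = winding_number R w + winding_number (P +++ (reversepath C +++ reversepath P)) w"
      unfolding G_def by (rule winding_number_join) (use path nin ends in \<open>auto simp: path_image_join\<close>)
    also have "winding_number (P +++ (reversepath C +++ reversepath P)) w
        = winding_number P w + winding_number (reversepath C +++ reversepath P) w"
      by (rule winding_number_join) (use path nin ends in \<open>auto simp: path_image_join\<close>)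
    also have "winding_number (reversepath C +++ reversepath P) w
        = winding_number (reversepath C) w + winding_number (reversepath P) w"
      by (rule winding_number_join) (use path nin ends in auto)
    also have "winding_number (reversepath C) w = - winding_number C w"
      by (rule winding_number_reversepath) (use path nin in auto)
    also have "winding_number (reversepath P) w = - winding_number P w"
      by (rule winding_number_reversepath) (use path nin in auto)
    also have "winding_number R w = winding_number C w"
    proof (cases "Re w \<le> \<rho>")
      case True
      then have "w \<in> box ?a ?b" "norm w < \<rho>" using out[OF w] by auto
      then show ?thesis
        unfolding R_def C_def by (simp add: winding_number_rectpath winding_number_circlepath)
    next
      case False
      have "winding_number R w = 0"
        unfolding R_def by (rule winding_number_rectpath_outside) (use pos False in \<open>auto simp: in_cbox_complex_iff\<close>)
      moreover have "winding_number C w = 0"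
      proof (rule winding_number_zero_outside[of _ "cball 0 \<rho>"])
        show "w \<notin> cball 0 \<rho>" using False complex_Re_le_cmod[of w] by auto
        show "path_image C \<subseteq> cball 0 \<rho>" unfolding C_def using pos by auto
      qed (use path ends in auto)
      ultimately show ?thesis by simp
    qed
    finally show "winding_number G w = 0" by simp
  qed
  then have "contour_integral G f = 0" by (rule contour_integral_unique)
  moreover have ci: "f contour_integrable_on R" "f contour_integrable_on C" "f contour_integrable_on P"
    by (intro contour_integrable_holomorphic_simple[OF hol S] vp R C P)+
  then have "contour_integral G f = contour_integral R f
      + (contour_integral P f + (- contour_integral C f + - contour_integral P f))"
    unfolding G_def using vp ends
    by (simp add: contour_integral_reversepath contour_integrable_reversepath contour_integrable_joinI)
  ultimately show ?thesis
    by (simp add: R_def C_def)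
qed

section \<open>Spectral sums as contour integrals\<close>

text \<open>Cauchy-Schwarz in the form \<open>2 l |f| \<le> l^2 + |f|^2\<close>, integrated and used
  with \<open>l\<close> equal to the norm; the constant \<open>(pi + 1) / 2\<close> is rounded up to
  3. For norm 0 arbitrarily small \<open>l\<close> are used instead.\<close>

lemma L1_mass_le_L2_norm:
  assumes f: "f \<in> L2"
  shows "L1_mass f \<le> 3 * L2_norm f"
proof -
  define n where "n = L2_norm f"
  have n0: "n \<ge> 0" by (simp add: n_def L2_norm_def)
  have n2: "(\<integral>x. (norm (f x))\<^sup>2 \<partial>leb) = n\<^sup>2"
    by (simp add: n_def L2_norm_def)
  have i: "integrable leb (\<lambda>x. (norm (f x))\<^sup>2)" "integrable leb f"
    using f L2_imp_L1[OF f] by (auto simp: L2_def L1_def)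
  have c: "integrable leb (\<lambda>x. l)" "(\<integral>x. l \<partial>leb) = pi * l" for l :: real
    by (auto intro: finite_measure.integrable_const finite_measure_lebesgue_on simp: measure_restrict_space)
  have young: "2 * l * L1_mass f \<le> pi * l\<^sup>2 + n\<^sup>2" if "l \<ge> 0" for l
  proof -
    have "(\<integral>x. 2 * l * norm (f x) \<partial>leb) \<le> (\<integral>x. l\<^sup>2 + (norm (f x))\<^sup>2 \<partial>leb)"
    proof (rule integral_mono)
      show "2 * l * norm (f x) \<le> l\<^sup>2 + (norm (f x))\<^sup>2" for x
        using zero_le_power2[of "l - norm (f x)"] unfolding power2_diff by linarith
    qed (use i c in auto)
    also have "\<dots> = pi * l\<^sup>2 + n\<^sup>2"
      using i c by (subst Bochner_Integration.integral_add) (auto simp: n2)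
    finally show ?thesis
      using L1_mass_eq[OF L2_imp_L1[OF f]] by simp
  qed
  show ?thesis
  proof (cases "n = 0")
    case True
    have "L1_mass f \<le> 0"
    proof (rule field_le_epsilon)
      fix e :: real assume "e > 0"
      have "2 * (e / pi) * L1_mass f \<le> pi * (e / pi)\<^sup>2"
        using young[of "e / pi"] True \<open>e > 0\<close> by simp
      also have "\<dots> = (e / pi) * e" by (simp add: power2_eq_square)
      finally have "(e / pi) * (2 * L1_mass f) \<le> (e / pi) * e" by (simp add: mult_ac)
      then have "2 * L1_mass f \<le> e"
        by (rule mult_left_le_imp_le) (use \<open>e > 0\<close> in simp)
      then show "L1_mass f \<le> 0 + e"
        using L1_mass_nonneg[OF L2_imp_L1[OF f]] by linarith
    qed
    then show ?thesis using True by (simp add: n_def)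
  next
    case False
    have "n * (2 * L1_mass f) \<le> n * ((pi + 1) * n)"
      using young[OF n0] by (simp add: power2_eq_square algebra_simps)
    then have "2 * L1_mass f \<le> (pi + 1) * n"
      by (rule mult_left_le_imp_le) (use False n0 in simp)
    also have "\<dots> \<le> 6 * n"
      using pi_less_4 n0 by (intro mult_right_mono) auto
    finally show ?thesis by (simp add: n_def)
  qed
qed

lemma L2_cong:
  assumes "\<And>x. x \<in> {0..pi} \<Longrightarrow> f x = g x" "g \<in> L2"
  shows "f \<in> L2"
proof -
  have "f \<in> borel_measurable leb \<longleftrightarrow> g \<in> borel_measurable leb"
    by (rule measurable_cong) (use assms in auto)
  moreover have "integrable leb (\<lambda>x. (norm (f x))\<^sup>2) \<longleftrightarrow> integrable leb (\<lambda>x. (norm (g x))\<^sup>2)"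
    by (rule Bochner_Integration.integrable_cong) (use assms in auto)
  ultimately show ?thesis using assms(2) by (simp add: L2_def)
qed

lemma L2_norm_le:
  assumes "f \<in> L2" "\<And>x. x \<in> {0..pi} \<Longrightarrow> norm (f x) \<le> B" "B \<ge> 0"
  shows "L2_norm f \<le> 2 * B"
proof -
  have "(\<integral>x. (norm (f x))\<^sup>2 \<partial>leb) \<le> (\<integral>x. B\<^sup>2 \<partial>leb)"
  proof (rule integral_mono)
    show "integrable leb (\<lambda>x. B\<^sup>2)"
      by (intro finite_measure.integrable_const finite_measure_lebesgue_on) auto
    show "(norm (f x))\<^sup>2 \<le> B\<^sup>2" if "x \<in> space leb" for x
      using assms(2)[of x] that by (intro power_mono) auto
  qed (use assms in \<open>auto simp: L2_def\<close>)
  also have "\<dots> = pi * B\<^sup>2" by (simp add: measure_restrict_space)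
  also have "\<dots> \<le> 4 * B\<^sup>2" using pi_less_4 by (intro mult_right_mono) auto
  also have "\<dots> = (2 * B)\<^sup>2" by (simp add: power2_eq_square)
  finally show ?thesis
    unfolding L2_norm_def using assms(3) by (intro real_le_lsqrt) auto
qed

text \<open>A supremum bound relative to the mass of \<open>f\<close> is stronger than the operator
  norm on \<open>L2\<close>: the passage costs a factor 2 on the left and 3 on the right, hence
  \<open>e = \<epsilon> / 6\<close>.\<close>

lemma has_op_contour_integral_resolvent:
  assumes Q: "measure_potential Q K" and im: "path_image (rectpath a b) \<subseteq> {z. \<not> eigenvalue bc Q z}"
  shows "has_op_contour_integral (resolvent bc Q)
    (\<lambda>f x. contour_integral (rectpath a b) (\<lambda>z. hill_res bc Q z f x)) (rectpath a b)"
  unfolding has_op_contour_integral_def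
proof (intro conjI ballI allI impI)
  let ?\<gamma> = "rectpath a b"
  let ?T = "\<lambda>f x. contour_integral ?\<gamma> (\<lambda>z. hill_res bc Q z f x)"
  show T_L2: "?T f \<in> L2" if "f \<in> L2" for f
    by (intro continuous_imp_L2 contour_integral_hill_res_continuous[OF Q im] L2_imp_L1 that)
  fix \<epsilon> :: real assume "\<epsilon> > 0"
  define e where "e = \<epsilon> / 6"
  have "e > 0" using \<open>\<epsilon> > 0\<close> by (simp add: e_def)
  show "\<forall>\<^sub>F p in division_filter {0..1}. \<forall>f\<in>L2.
       let D = (\<lambda>x. (\<Sum>(t, k)\<in>p. measure lborel k *\<^sub>R
                 (vector_derivative ?\<gamma> (at t within {0..1}) * resolvent bc Q (?\<gamma> t) f x)) - ?T f x)
       in D \<in> L2 \<and> L2_norm D \<le> \<epsilon> * L2_norm f"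
    using riemann_sums_hill_res[OF Q im \<open>e > 0\<close>] eventually_division_filter_tagged_division[of "{0..1::real}"]
  proof eventually_elim
    case (elim p)
    have tag: "\<not> eigenvalue bc Q (?\<gamma> t)" if "(t, k) \<in> p" for t k
    proof -
      have "t \<in> {0..1}" using elim(2) that by (meson subsetD tag_in_interval)
      then show ?thesis using path_image_subset_apply[OF im] by blast
    qed
    show ?case
      unfolding Let_def
    proof
      fix f assume f: "f \<in> L2"
      note f1 = L2_imp_L1[OF f]
      let ?S = "\<lambda>R x. \<Sum>(t, k)\<in>p. measure lborel k *\<^sub>R
                 (vector_derivative ?\<gamma> (at t within {0..1}) * R (?\<gamma> t) f x)"
      let ?D = "\<lambda>x. ?S (resolvent bc Q) x - ?T f x"
      have eq: "?D x = ?S (hill_res bc Q) x - ?T f x" if "x \<in> {0..pi}" for x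
        by (intro arg_cong2[where f=minus] sum.cong refl)
           (use tag resolvent_eq_hill_res[OF Q _ f that] in auto)
      have "continuous_on {0..pi} (\<lambda>x. ?S (hill_res bc Q) x - ?T f x)"
        using tag
        by (auto intro!: continuous_intros hill_res_continuous[OF Q _ f1]
            contour_integral_hill_res_continuous[OF Q im f1] simp: case_prod_unfold)
      then have D: "?D \<in> L2"
        by (intro L2_cong[OF eq] continuous_imp_L2)
      have "L2_norm ?D \<le> 2 * (e * L1_mass f)"
      proof (rule L2_norm_le[OF D])
        show "norm (?D x) \<le> e * L1_mass f" if "x \<in> {0..pi}" for x
          unfolding eq[OF that] using elim(1) f1 by blast
        show "0 \<le> e * L1_mass f" using \<open>e > 0\<close> L1_mass_nonneg[OF f1] by simp
      qed
      also have "\<dots> \<le> 2 * (e * (3 * L2_norm f))"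
        using \<open>e > 0\<close> L1_mass_le_L2_norm[OF f] by (intro mult_left_mono) auto
      finally have "L2_norm ?D \<le> \<epsilon> * L2_norm f"
        by (simp add: e_def)
      with D show "?D \<in> L2 \<and> L2_norm ?D \<le> \<epsilon> * L2_norm f" ..
    qed
  qed
qed

lemma L2_norm_power2: "f \<in> L2 \<Longrightarrow> (L2_norm f)\<^sup>2 = (\<integral>x. (norm (f x))\<^sup>2 \<partial>leb)"
  by (simp add: L2_norm_def)

text \<open>One partition can be taken fine enough for both limits; the two errors are combined
  through \<open>|a - b|^2 \<le> 2 |a|^2 + 2 |b|^2\<close>, which takes the place of the triangle
  inequality of the norm.\<close>

lemma has_op_contour_integral_unique:
  assumes T: "has_op_contour_integral F T \<gamma>" and T': "has_op_contour_integral F T' \<gamma>" and f: "f \<in> L2"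
  shows "AE x in leb. T f x = T' f x"
proof -
  have L: "T f \<in> L2" "T' f \<in> L2"
    using T T' f by (auto simp: has_op_contour_integral_def)
  have d: "(\<lambda>x. T f x - T' f x) \<in> L2"
    using L2_add_scale[OF L, of "-1"] by simp
  let ?d = "\<integral>x. (norm (T f x - T' f x))\<^sup>2 \<partial>leb"
  have "?d \<le> 0 + e" if "e > 0" for e
  proof -
    \<comment> \<open>Chosen so that \<open>4 * (\<epsilon> * L2_norm f)\<^sup>2\<close> is at most
      \<open>e\<close>; the summand 1 covers the case of norm 0.\<close>
    define \<epsilon> where "\<epsilon> = sqrt (e / (4 * ((L2_norm f)\<^sup>2 + 1)))"
    have n: "(L2_norm f)\<^sup>2 + 1 > 0" by (intro add_nonneg_pos) auto
    have \<epsilon>: "\<epsilon> > 0" using that n by (simp add: \<epsilon>_def)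
    have \<epsilon>2: "\<epsilon>\<^sup>2 = e / (4 * ((L2_norm f)\<^sup>2 + 1))"
      unfolding \<epsilon>_def using that n by simp
    let ?S = "\<lambda>p x. \<Sum>(t, k)\<in>p. measure lborel k *\<^sub>R
                 (vector_derivative \<gamma> (at t within {0..1}) * F (\<gamma> t) f x)"
    have ne: "division_filter {0..1::real} \<noteq> bot"
      using division_filter_not_empty[of 0 "1::real"] by simp
    have "\<forall>\<^sub>F p in division_filter {0..1}.
        ((\<lambda>x. ?S p x - T f x) \<in> L2 \<and> L2_norm (\<lambda>x. ?S p x - T f x) \<le> \<epsilon> * L2_norm f) \<and>
        ((\<lambda>x. ?S p x - T' f x) \<in> L2 \<and> L2_norm (\<lambda>x. ?S p x - T' f x) \<le> \<epsilon> * L2_norm f)"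
      using T[unfolded has_op_contour_integral_def Let_def, THEN conjunct2, rule_format, OF \<epsilon>]
        T'[unfolded has_op_contour_integral_def Let_def, THEN conjunct2, rule_format, OF \<epsilon>]
      by eventually_elim (use f in blast)
    from eventually_happens'[OF ne this] obtain p :: "(real \<times> real set) set" where p: "(\<lambda>x. ?S p x - T f x) \<in> L2" "L2_norm (\<lambda>x. ?S p x - T f x) \<le> \<epsilon> * L2_norm f"
      "(\<lambda>x. ?S p x - T' f x) \<in> L2" "L2_norm (\<lambda>x. ?S p x - T' f x) \<le> \<epsilon> * L2_norm f"
      by blast
    have sq: "(\<integral>x. (norm (h x))\<^sup>2 \<partial>leb) \<le> (\<epsilon> * L2_norm f)\<^sup>2" if "h \<in> L2" "L2_norm h \<le> \<epsilon> * L2_norm f" for h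
      unfolding L2_norm_power2[OF that(1), symmetric]
      using that(2) by (intro power_mono) (auto simp: L2_norm_def)
    have "?d \<le> (\<integral>x. 2 * (norm (?S p x - T f x))\<^sup>2 + 2 * (norm (?S p x - T' f x))\<^sup>2 \<partial>leb)"
    proof (rule integral_mono)
      show "(norm (T f x - T' f x))\<^sup>2 \<le> 2 * (norm (?S p x - T f x))\<^sup>2 + 2 * (norm (?S p x - T' f x))\<^sup>2" for x
      proof -
        have "norm (T f x - T' f x) \<le> norm (?S p x - T f x) + norm (?S p x - T' f x)"
          using norm_triangle_ineq4[of "?S p x - T' f x" "?S p x - T f x"] by (simp add: algebra_simps)
        then have "(norm (T f x - T' f x))\<^sup>2 \<le> (norm (?S p x - T f x) + norm (?S p x - T' f x))\<^sup>2"
          by (intro power_mono) auto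
        also have "\<dots> \<le> 2 * (norm (?S p x - T f x))\<^sup>2 + 2 * (norm (?S p x - T' f x))\<^sup>2"
          using zero_le_power2[of "norm (?S p x - T f x) - norm (?S p x - T' f x)"]
          unfolding power2_diff power2_sum by linarith
        finally show ?thesis .
      qed
    qed (use p d in \<open>auto simp: L2_def\<close>)
    also have "\<dots> = 2 * (\<integral>x. (norm (?S p x - T f x))\<^sup>2 \<partial>leb) + 2 * (\<integral>x. (norm (?S p x - T' f x))\<^sup>2 \<partial>leb)"
      using p by (subst Bochner_Integration.integral_add) (auto simp: L2_def)
    also have "\<dots> \<le> 4 * (\<epsilon> * L2_norm f)\<^sup>2"
      using sq[OF p(1,2)] sq[OF p(3,4)] by linarith
    also have "\<dots> = e * ((L2_norm f)\<^sup>2 / ((L2_norm f)\<^sup>2 + 1))"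
    proof -
      have "4 * (e / (4 * X) * Y) = e * (Y / X)" for X Y :: real
        by simp
      then show ?thesis unfolding power_mult_distrib \<epsilon>2 .
    qed
    also have "\<dots> \<le> e * 1"
      using that n by (intro mult_left_mono) (auto simp: divide_le_eq)
    finally show ?thesis by simp
  qed
  then have "?d \<le> 0" by (rule field_le_epsilon)
  then have "?d = 0" by (intro antisym) auto
  then have "AE x in leb. (norm (T f x - T' f x))\<^sup>2 = 0"
    using d by (subst (asm) integral_nonneg_eq_0_iff_AE) (auto simp: L2_def)
  then show ?thesis by eventually_elim simp
qed

lemma op_contour_integral_resolvent:
  assumes Q: "measure_potential Q K" and im: "path_image (rectpath a b) \<subseteq> {z. \<not> eigenvalue bc Q z}"
    and f: "f \<in> L2"
  shows "AE x in leb. op_contour_integral (rectpath a b) (resolvent bc Q) f x =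
    contour_integral (rectpath a b) (\<lambda>z. hill_res bc Q z f x)"
proof -
  note T = has_op_contour_integral_resolvent[OF Q im]
  have "has_op_contour_integral (resolvent bc Q) (op_contour_integral (rectpath a b) (resolvent bc Q)) (rectpath a b)"
    unfolding op_contour_integral_def by (rule someI[of "\<lambda>T. has_op_contour_integral _ T _", OF T])
  from has_op_contour_integral_unique[OF this T f] show ?thesis .
qed

section \<open>Extension to integrable functions\<close>

lemma borel_measurable_AE_cong:
  fixes f g :: "real \<Rightarrow> complex"
  assumes "AE x in leb. f x = g x" "g \<in> borel_measurable leb"
  shows "f \<in> borel_measurable leb"
proof -
  obtain N where N: "negligible N" "\<And>t. t \<in> {0..pi} - N \<Longrightarrow> f t = g t"
    using AE_leb_negligible[OF assms(1)] by blast
  have "g measurable_on {0..pi}"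
    using assms(2) by (simp add: measurable_on_iff_borel_measurable)
  then have "f measurable_on {0..pi}"
    by (rule measurable_on_spike[OF _ N])
  then show ?thesis by (simp add: measurable_on_iff_borel_measurable)
qed

lemma L1_norm_eq: "f \<in> L1 \<Longrightarrow> L1_norm f = ennreal (L1_mass f)"
  unfolding L1_norm_def by (subst nn_integral_eq_integral) (auto simp: L1_def L1_mass_eq)

lemma Linf_norm_le:
  assumes "f \<in> borel_measurable leb" "AE x in leb. norm (f x) \<le> B"
  shows "Linf_norm f \<le> ennreal B"
  unfolding Linf_norm_def
proof (rule esssup_I)
  show "(\<lambda>x. ennreal (norm (f x))) \<in> borel_measurable leb"
    using assms(1) by measurable
  show "AE x in leb. ennreal (norm (f x)) \<le> ennreal B"
    using assms(2) by eventually_elim (rule ennreal_leI)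
qed

text \<open>\<open>g f\<close> meets the specification of the extension because \<open>g\<close> is
  Lipschitz from \<open>L1\<close> to the supremum norm, so the choice is legitimate. The
  truncations of \<open>f\<close> lie in \<open>L2\<close> and converge to \<open>f\<close> in
  \<open>L1\<close>; along them the chosen function and \<open>g f\<close> are limits of the same
  sequence, hence agree almost everywhere.\<close>

lemma L1_extension_eq:
  assumes D: "\<And>\<phi>. \<phi> \<in> L2 \<Longrightarrow> AE x in leb. D \<phi> x = g \<phi> x"
    and gm: "\<And>\<phi>. \<phi> \<in> L1 \<Longrightarrow> g \<phi> \<in> borel_measurable leb"
    and gC: "\<And>\<phi> f x. \<phi> \<in> L1 \<Longrightarrow> f \<in> L1 \<Longrightarrow> x \<in> {0..pi} \<Longrightarrow>
      norm (g \<phi> x - g f x) \<le> C * L1_mass (\<lambda>t. \<phi> t - f t)"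
    and f: "f \<in> L1"
  shows "AE x in leb. L1_extension D f x = g f x"
proof -
  define ext where "ext h \<longleftrightarrow> (\<forall>\<phi>. (\<forall>k. \<phi> k \<in> L2) \<longrightarrow>
    (\<lambda>k::nat. L1_norm (\<lambda>x. \<phi> k x - f x)) \<longlonglongrightarrow> 0 \<longrightarrow>
    (\<lambda>k. Linf_norm (\<lambda>x. D (\<phi> k) x - h x)) \<longlonglongrightarrow> 0)" for h
  have "ext (g f)"
    unfolding ext_def
  proof (intro allI impI)
    fix \<phi> :: "nat \<Rightarrow> real \<Rightarrow> complex"
    assume L2: "\<forall>k. \<phi> k \<in> L2" and lim: "(\<lambda>k. L1_norm (\<lambda>x. \<phi> k x - f x)) \<longlonglongrightarrow> 0"
    have L1: "\<phi> k \<in> L1" for k using L2 by (auto intro: L2_imp_L1)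
    have d: "(\<lambda>x. \<phi> k x - f x) \<in> L1" for k
      using L1_add_scale[OF L1[of k] f, of "-1"] by simp
    let ?m = "\<lambda>k. L1_mass (\<lambda>x. \<phi> k x - f x)"
    have "(\<lambda>k. ennreal (?m k)) \<longlonglongrightarrow> ennreal 0"
      using lim by (simp add: L1_norm_eq[OF d])
    then have "?m \<longlonglongrightarrow> 0"
      by (subst (asm) tendsto_ennreal_iff) (auto simp: L1_mass_nonneg[OF d])
    then have "(\<lambda>k. ennreal (C * ?m k)) \<longlonglongrightarrow> ennreal (C * 0)"
      by (intro tendsto_intros)
    then have u: "(\<lambda>k. ennreal (C * ?m k)) \<longlonglongrightarrow> 0" by simp
    have "Linf_norm (\<lambda>x. D (\<phi> k) x - g f x) \<le> ennreal (C * ?m k)" for k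
    proof (rule Linf_norm_le)
      have eq: "AE x in leb. D (\<phi> k) x = g (\<phi> k) x"
        using D L2 by blast
      have "D (\<phi> k) \<in> borel_measurable leb"
        by (rule borel_measurable_AE_cong[OF eq gm[OF L1]])
      then show "(\<lambda>x. D (\<phi> k) x - g f x) \<in> borel_measurable leb"
        using gm[OF f] by (rule borel_measurable_diff)
      have "AE x in leb. x \<in> {0..pi}" by (rule AE_I2) simp
      with eq show "AE x in leb. norm (D (\<phi> k) x - g f x) \<le> C * ?m k"
        by eventually_elim (auto intro: gC L1 f)
    qed
    then show "(\<lambda>k. Linf_norm (\<lambda>x. D (\<phi> k) x - g f x)) \<longlonglongrightarrow> 0"
      by (intro tendsto_sandwich[OF _ _ tendsto_const u]) auto
  qed
  then have ext: "ext (L1_extension D f)"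
    unfolding L1_extension_def ext_def[symmetric] by (rule someI[of ext])
  define s where "s k t = (if norm (f t) \<le> real k then f t else 0)" for k :: nat and t
  have fm: "f \<in> borel_measurable leb" and fi: "integrable leb f"
    using f by (auto simp: L1_def)
  have sm: "s k \<in> borel_measurable leb" for k
  proof -
    note [measurable] = fm
    show ?thesis unfolding s_def by measurable
  qed
  have sL2: "s k \<in> L2" for k
    by (rule bounded_imp_L2[OF sm, of _ "real k"]) (auto simp: s_def)
  have "(\<lambda>k. L1_mass (\<lambda>t. f t - s k t)) \<longlonglongrightarrow> 0"
  proof (rule L1_mass_tendsto[OF f sm])
    show "norm (f x - s k x) \<le> norm (f x)" for k x by (simp add: s_def)
    show "integrable leb (\<lambda>x. norm (f x))" using fi by simp
    show "AE x in leb. (\<lambda>k. s k x) \<longlonglongrightarrow> f x"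
    proof (rule AE_I2)
      fix x
      have "\<forall>\<^sub>F k in sequentially. real k \<ge> norm (f x)"
        using filterlim_real_sequentially unfolding filterlim_at_top by blast
      then have "\<forall>\<^sub>F k in sequentially. s k x = f x"
        by eventually_elim (simp add: s_def)
      then show "(\<lambda>k. s k x) \<longlonglongrightarrow> f x" by (rule tendsto_eventually)
    qed
  qed
  then have "(\<lambda>k. ennreal (L1_mass (\<lambda>t. f t - s k t))) \<longlonglongrightarrow> ennreal 0"
    by (rule tendsto_ennrealI)
  moreover have "ennreal (L1_mass (\<lambda>t. f t - s k t)) = L1_norm (\<lambda>t. s k t - f t)" for k
  proof -
    have "(\<lambda>t. s k t - f t) \<in> L1"
      using L1_add_scale[OF L2_imp_L1[OF sL2[of k]] f, of "-1"] by simp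
    then show ?thesis
      by (simp add: L1_norm_eq L1_mass_def norm_minus_commute)
  qed
  ultimately have s: "(\<lambda>k. L1_norm (\<lambda>t. s k t - f t)) \<longlonglongrightarrow> 0"
    by simp
  define a where "a k = Linf_norm (\<lambda>x. D (s k) x - L1_extension D f x)" for k
  define b where "b k = Linf_norm (\<lambda>x. D (s k) x - g f x)" for k
  have "a \<longlonglongrightarrow> 0" "b \<longlonglongrightarrow> 0"
    using ext \<open>ext (g f)\<close> s sL2 unfolding ext_def a_def b_def by blast+
  then have ab: "(\<lambda>k. a k + b k) \<longlonglongrightarrow> 0 + 0" by (rule tendsto_add)
  \<comment> \<open>\<open>esssup_AE\<close> asks for no measurability of the chosen extension,
    about which only \<open>ext\<close> is known; countably many \<open>k\<close> share one null
    set.\<close>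
  have "AE x in leb. \<forall>k. ennreal (norm (D (s k) x - L1_extension D f x)) \<le> a k"
    "AE x in leb. \<forall>k. ennreal (norm (D (s k) x - g f x)) \<le> b k"
    unfolding AE_all_countable a_def b_def Linf_norm_def by (intro allI esssup_AE)+
  then show ?thesis
  proof eventually_elim
    case (elim x)
    have "ennreal (norm (L1_extension D f x - g f x)) \<le> a k + b k" for k
    proof -
      have "norm (L1_extension D f x - g f x) \<le> norm (D (s k) x - L1_extension D f x) + norm (D (s k) x - g f x)"
        using norm_triangle_ineq4[of "D (s k) x - g f x" "D (s k) x - L1_extension D f x"]
        by (simp add: algebra_simps)
      then have "ennreal (norm (L1_extension D f x - g f x))
          \<le> ennreal (norm (D (s k) x - L1_extension D f x)) + ennreal (norm (D (s k) x - g f x))"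
        by (simp add: ennreal_plus[symmetric] ennreal_leI del: ennreal_plus)
      also have "\<dots> \<le> a k + b k" using elim by (intro add_mono) auto
      finally show ?thesis .
    qed
    then have "ennreal (norm (L1_extension D f x - g f x)) \<le> 0 + 0"
      by (intro LIMSEQ_le_const[OF ab]) auto
    then show ?case by simp
  qed
qed

section \<open>Equiconvergence\<close>

text \<open>A boundary point has real part at most \<open>N^2 + N\<close>, and admissibility places
  every eigenvalue with such a real part in the interior.\<close>

lemma admissible_path_image:
  assumes "admissible bc Q N \<omega> h"
  shows "path_image (rectpath (Complex (- \<omega>) (- h)) (Complex ((real N)\<^sup>2 + real N) h))
    \<subseteq> {z. \<not> eigenvalue bc Q z \<and> \<not> eigenvalue bc (\<lambda>_. 0) z}"
proof -
  let ?a = "Complex (- \<omega>) (- h)" and ?b = "Complex ((real N)\<^sup>2 + real N) h"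
  have pos: "\<omega> > 0" "h > 0" using assms by (auto simp: admissible_def)
  have r: "rect N \<omega> h = cbox ?a ?b"
    by (auto simp: rect_def in_cbox_complex_iff)
  have "path_image (rectpath ?a ?b) = cbox ?a ?b - box ?a ?b"
    by (rule path_image_rectpath_cbox_minus_box)
       (use pos in \<open>auto intro: order_trans[of _ 0]\<close>)
  then show ?thesis
    using assms unfolding admissible_def r interior_cbox by (auto simp: in_cbox_complex_iff)
qed

text \<open>
  The rectangle can be replaced by the circle of radius $N^2+N$: an eigenvalue with real part at
  most $N^2+N$ is not in the outer region, hence inside the circle.
\<close>

lemma admissible_contour_integral:
  assumes adm: "admissible bc Q N \<omega> h" and N: "N \<ge> 1"
    and P: "measure_potential P K" and PQ: "\<And>z. eigenvalue bc P z \<Longrightarrow> eigenvalue bc Q z \<or> eigenvalue bc (\<lambda>_. 0) z"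
    and small: "8 * K \<le> sqrt (real N ^ 2 + real N)" and f: "f \<in> L1"
  shows "contour_integral (rectpath (Complex (- \<omega>) (- h)) (Complex ((real N)\<^sup>2 + real N) h)) (\<lambda>z. hill_res bc P z f x)
    = contour_integral (circlepath 0 ((real N)\<^sup>2 + real N)) (\<lambda>z. hill_res bc P z f x)"
proof (rule rectpath_circlepath_integral[OF open_not_eigenvalue[OF P] hill_res_holomorphic[OF P f]])
  show "\<omega> > 0" "h > 0" using adm by (auto simp: admissible_def)
  show "(real N)\<^sup>2 + real N > 0" using N by (intro add_nonneg_pos) auto
  fix w assume "w \<notin> {z. \<not> eigenvalue bc P z}" and re: "Re w \<le> (real N)\<^sup>2 + real N"
  then have e: "eigenvalue bc P w" by simp
  have r: "rect N \<omega> h = cbox (Complex (- \<omega>) (- h)) (Complex ((real N)\<^sup>2 + real N) h)"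
    by (auto simp: rect_def in_cbox_complex_iff)
  have "w \<in> interior (rect N \<omega> h)"
    using adm PQ[OF e] re by (auto simp: admissible_def)
  moreover have "norm w < (real N)\<^sup>2 + real N"
  proof (rule ccontr)
    assume "\<not> ?thesis"
    then have w: "w \<in> outer_region N" "sqrt (real N ^ 2 + real N) \<le> sqrt (norm w)"
      using re by (auto simp: outer_region_def)
    then have "8 * K \<le> sqrt (norm w)"
      using small by linarith
    then show False
      using outer_region_no_eigenvalue[OF N w(1) P] e by blast
  qed
  ultimately show "w \<in> box (Complex (- \<omega>) (- h)) (Complex ((real N)\<^sup>2 + real N) h) \<and> norm w < (real N)\<^sup>2 + real N"
    unfolding r interior_cbox by blast
qed

lemma circle_difference_bound:
  assumes N: "N \<ge> 1" and Q: "measure_potential Q K" and small: "8 * K \<le> sqrt (real N ^ 2 + real N)"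
    and f: "f \<in> L1" and x: "x \<in> {0..pi}" and "e \<ge> 0"
    and free: "\<And>z y u t. z \<in> outer_region N \<Longrightarrow> norm z = real N ^ 2 + real N \<Longrightarrow>
      hill_solution bc (\<lambda>_. 0) z f y u \<Longrightarrow> t \<in> {0..pi} \<Longrightarrow> norm (y t) \<le> e / sqrt (norm z)"
  shows "norm (contour_integral (circlepath 0 (real N ^ 2 + real N)) (\<lambda>z. hill_res bc Q z f x)
    - contour_integral (circlepath 0 (real N ^ 2 + real N)) (\<lambda>z. hill_res bc (\<lambda>_. 0) z f x)) \<le> 2 * pi * (8 * K * e)"
proof -
  let ?\<rho> = "real N ^ 2 + real N"
  let ?c = "circlepath 0 ?\<rho>"
  have \<rho>: "?\<rho> > 0" using N by (intro add_nonneg_pos) auto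
  have K0: "K \<ge> 0" by (rule measure_potentialD(3)[OF Q])
  have out: "z \<in> outer_region N" if "norm z = ?\<rho>" for z
    using that complex_Re_le_cmod[of z] by (simp add: outer_region_def)
  have ne: "\<not> eigenvalue bc Q z" "\<not> eigenvalue bc (\<lambda>_. 0) z" if "norm z = ?\<rho>" for z
    using outer_region_no_eigenvalue[OF N out[OF that] Q] small that
      outer_region_no_eigenvalue[OF N out[OF that] measure_potential_zero] \<rho> by auto
  have im: "path_image ?c \<subseteq> {z. \<not> eigenvalue bc Q z}" "path_image ?c \<subseteq> {z. \<not> eigenvalue bc (\<lambda>_. 0) z}"
    using ne \<rho> by auto
  have ci: "(\<lambda>z. hill_res bc Q z f x) contour_integrable_on ?c"
    "(\<lambda>z. hill_res bc (\<lambda>_. 0) z f x) contour_integrable_on ?c"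
    using hill_res_contour_integrable[OF Q f _ im(1)] hill_res_contour_integrable[OF measure_potential_zero f _ im(2)]
    by auto
  then have "((\<lambda>z. hill_res bc Q z f x - hill_res bc (\<lambda>_. 0) z f x) has_contour_integral
      (contour_integral ?c (\<lambda>z. hill_res bc Q z f x) - contour_integral ?c (\<lambda>z. hill_res bc (\<lambda>_. 0) z f x))) ?c"
    by (intro has_contour_integral_diff has_contour_integral_integral)
  then have "norm (contour_integral ?c (\<lambda>z. hill_res bc Q z f x) - contour_integral ?c (\<lambda>z. hill_res bc (\<lambda>_. 0) z f x))
      \<le> (8 * K * e / ?\<rho>) * (2 * pi * ?\<rho>)"
  proof (rule has_contour_integral_bound_circlepath)
    show "0 \<le> 8 * K * e / ?\<rho>" using K0 \<open>e \<ge> 0\<close> \<rho> by simp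
    fix z :: complex assume "norm (z - 0) = ?\<rho>"
    then have z: "norm z = ?\<rho>" by simp
    obtain u where u: "hill_solution bc Q z f (hill_res bc Q z f) u"
      using hill_res_solution[OF Q ne(1)[OF z] f] .
    obtain u0 where u0: "hill_solution bc (\<lambda>_. 0) z f (hill_res bc (\<lambda>_. 0) z f) u0"
      using hill_res_solution[OF measure_potential_zero ne(2)[OF z] f] .
    have "norm (hill_res bc Q z f x - hill_res bc (\<lambda>_. 0) z f x) \<le> 8 * K / sqrt (norm z) * (e / sqrt (norm z))"
      by (rule hill_solution_perturbation[OF N out[OF z] Q _ u u0 _ x])
         (use small z free[OF out[OF z] z u0] in auto)
    also have "\<dots> = 8 * K * e / ?\<rho>"
      using \<rho> by (simp add: z)
    finally show "norm (hill_res bc Q z f x - hill_res bc (\<lambda>_. 0) z f x) \<le> 8 * K * e / ?\<rho>" .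
  qed (use \<rho> in auto)
  also have "\<dots> = 2 * pi * (8 * K * e)" using \<rho> by simp
  finally show ?thesis .
qed

lemma eventually_large:
  "\<forall>\<^sub>F N in sequentially. N \<ge> 1 \<and> c \<le> sqrt (real N ^ 2 + real N) \<and> R \<le> real N ^ 2 + real N"
proof -
  have "\<forall>\<^sub>F N in sequentially. real N \<ge> max 1 (max c R)"
    using filterlim_real_sequentially unfolding filterlim_at_top by blast
  then show ?thesis
  proof eventually_elim
    case (elim N)
    have "sqrt (real N ^ 2) \<le> sqrt (real N ^ 2 + real N)"
      by (rule real_sqrt_le_mono) simp
    moreover have "real N \<le> real N ^ 2 + real N" by simp
    moreover have "sqrt (real N ^ 2) = real N" by simp
    ultimately show ?case using elim by linarith
  qed
qed

text \<open>All eigenvalues in question lie in the open disc of radius \<open>N^2 + N\<close>, and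
  the rectangle is the square circumscribed about it.\<close>

lemma admissible_exists:
  assumes N: "N \<ge> 1" and Q: "measure_potential Q K" and small: "8 * K \<le> sqrt (real N ^ 2 + real N)"
  shows "admissible bc Q N (real N ^ 2 + real N) (real N ^ 2 + real N)"
  unfolding admissible_def
proof (intro conjI allI impI)
  let ?\<rho> = "real N ^ 2 + real N"
  show "?\<rho> > 0" "?\<rho> > 0" using N by (auto intro: add_nonneg_pos)
  fix z assume z: "(eigenvalue bc Q z \<or> eigenvalue bc (\<lambda>_. 0) z) \<and> Re z \<le> ?\<rho>"
  have "norm z < ?\<rho>"
  proof (rule ccontr)
    assume "\<not> norm z < ?\<rho>"
    then have out: "z \<in> outer_region N" "sqrt ?\<rho> \<le> sqrt (norm z)"
      using z by (auto simp: outer_region_def)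
    then have "8 * K \<le> sqrt (norm z)"
      using small by linarith
    then have "\<not> eigenvalue bc Q z"
      by (rule outer_region_no_eigenvalue[OF N out(1) Q])
    moreover have "\<not> eigenvalue bc (\<lambda>_. 0) z"
      by (rule outer_region_no_eigenvalue[OF N out(1) measure_potential_zero]) simp
    ultimately show False using z by blast
  qed
  moreover have "ball 0 ?\<rho> \<subseteq> rect N ?\<rho> ?\<rho>"
  proof
    fix w :: complex assume "w \<in> ball 0 ?\<rho>"
    then have "norm w < ?\<rho>" by simp
    then show "w \<in> rect N ?\<rho> ?\<rho>"
      using abs_Re_le_cmod[of w] abs_Im_le_cmod[of w] by (auto simp: rect_def)
  qed
  then have "ball 0 ?\<rho> \<subseteq> interior (rect N ?\<rho> ?\<rho>)"
    by (rule interior_maximal) simp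
  ultimately show "z \<in> interior (rect N ?\<rho> ?\<rho>)" by auto
qed

text \<open>The integrals over the rectangle serve to identify the extension; their bounds
  \<open>C1\<close> and \<open>C2\<close> may depend on \<open>N\<close>, \<open>\<omega>\<close>
  and \<open>h\<close>. The explicit bound comes from moving to the circle, where the prefactor
  \<open>1 / (2 * pi * \<i>)\<close> cancels the \<open>2 * pi\<close> of its length.\<close>

lemma Linf_norm_spectral_difference:
  assumes adm: "admissible bc Q N \<omega> h" and N: "N \<ge> 1" and Q: "measure_potential Q K"
    and small: "8 * K \<le> sqrt (real N ^ 2 + real N)" and f: "f \<in> L1" and "e \<ge> 0"
    and free: "\<And>z y u t. z \<in> outer_region N \<Longrightarrow> norm z = real N ^ 2 + real N \<Longrightarrow>
      hill_solution bc (\<lambda>_. 0) z f y u \<Longrightarrow> t \<in> {0..pi} \<Longrightarrow> norm (y t) \<le> e / sqrt (norm z)"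
  shows "Linf_norm (L1_extension (\<lambda>\<phi> x. spectral_sum bc Q N \<omega> h \<phi> x
    - spectral_sum bc (\<lambda>_. 0) N \<omega> h \<phi> x) f) \<le> ennreal (8 * K * e)"
proof -
  let ?D = "\<lambda>\<phi> x. spectral_sum bc Q N \<omega> h \<phi> x - spectral_sum bc (\<lambda>_. 0) N \<omega> h \<phi> x"
  let ?\<rho> = "real N ^ 2 + real N"
  define \<gamma> where "\<gamma> = rectpath (Complex (- \<omega>) (- h)) (Complex ((real N)\<^sup>2 + real N) h)"
  define T where "T P \<phi> x = contour_integral \<gamma> (\<lambda>z. hill_res bc P z \<phi> x)" for P \<phi> x
  define g where "g \<phi> x = 1 / (2 * pi * \<i>) * (T Q \<phi> x - T (\<lambda>_. 0) \<phi> x)" for \<phi> x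
  note Z = measure_potential_zero
  have im: "path_image \<gamma> \<subseteq> {z. \<not> eigenvalue bc Q z}" "path_image \<gamma> \<subseteq> {z. \<not> eigenvalue bc (\<lambda>_. 0) z}"
    using admissible_path_image[OF adm] unfolding \<gamma>_def by auto
  have vp: "valid_path \<gamma>" by (simp add: \<gamma>_def)
  have D: "AE x in leb. ?D \<phi> x = g \<phi> x" if "\<phi> \<in> L2" for \<phi>
    using op_contour_integral_resolvent[OF Q im(1)[unfolded \<gamma>_def] that]
      op_contour_integral_resolvent[OF Z im(2)[unfolded \<gamma>_def] that]
    unfolding spectral_sum_def g_def T_def \<gamma>_def
    by eventually_elim (simp add: right_diff_distrib)
  have gm: "g \<phi> \<in> borel_measurable leb" if "\<phi> \<in> L1" for \<phi>
  proof -
    have "continuous_on {0..pi} (g \<phi>)"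
      unfolding g_def T_def \<gamma>_def
      by (intro continuous_intros contour_integral_hill_res_continuous[OF Q im(1)[unfolded \<gamma>_def] that]
          contour_integral_hill_res_continuous[OF Z im(2)[unfolded \<gamma>_def] that])
    then show ?thesis by (intro continuous_imp_measurable_on_sets_lebesgue) auto
  qed
  obtain C1 where C1: "\<And>f x. f \<in> L1 \<Longrightarrow> norm (T Q f x) \<le> C1 * L1_mass f"
    using contour_integral_hill_res_bounded[OF Q im(1)[unfolded \<gamma>_def]] unfolding T_def \<gamma>_def by metis
  obtain C2 where C2: "\<And>f x. f \<in> L1 \<Longrightarrow> norm (T (\<lambda>_. 0) f x) \<le> C2 * L1_mass f"
    using contour_integral_hill_res_bounded[OF Z im(2)[unfolded \<gamma>_def]] unfolding T_def \<gamma>_def by metis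
  have gC: "norm (g \<phi> x - g f x) \<le> (1 / (2 * pi) * (C1 + C2)) * L1_mass (\<lambda>t. \<phi> t - f t)"
    if \<phi>: "\<phi> \<in> L1" and f: "f \<in> L1" for \<phi> f x
  proof -
    have d: "(\<lambda>t. \<phi> t - f t) \<in> L1"
      using L1_add_scale[OF \<phi> f, of "-1"] by simp
    have "T P (\<lambda>t. \<phi> t - f t) x = T P \<phi> x - T P f x"
      if "measure_potential P K'" "path_image \<gamma> \<subseteq> {z. \<not> eigenvalue bc P z}" for P K'
      using contour_integral_hill_res_add_scale[OF that(1) \<phi> f vp that(2), of "-1" x]
      unfolding T_def by simp
    from this[OF Q im(1)] this[OF Z im(2)]
    have "g \<phi> x - g f x = 1 / (2 * pi * \<i>) * (T Q (\<lambda>t. \<phi> t - f t) x - T (\<lambda>_. 0) (\<lambda>t. \<phi> t - f t) x)"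
      by (simp add: g_def right_diff_distrib)
    also have "norm \<dots> = 1 / (2 * pi) * norm (T Q (\<lambda>t. \<phi> t - f t) x - T (\<lambda>_. 0) (\<lambda>t. \<phi> t - f t) x)"
      by (simp add: norm_mult norm_divide)
    also have "\<dots> \<le> 1 / (2 * pi) * (C1 * L1_mass (\<lambda>t. \<phi> t - f t) + C2 * L1_mass (\<lambda>t. \<phi> t - f t))"
      by (intro mult_left_mono order_trans[OF norm_triangle_ineq4] add_mono C1 C2 d) auto
    also have "\<dots> = (1 / (2 * pi) * (C1 + C2)) * L1_mass (\<lambda>t. \<phi> t - f t)"
      by (simp only: mult.assoc distrib_right)
    finally show ?thesis .
  qed
  have AE: "AE x in leb. L1_extension ?D f x = g f x"
    by (rule L1_extension_eq[OF D gm gC f])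
  have bound: "norm (g f x) \<le> 8 * K * e" if x: "x \<in> {0..pi}" for x
  proof -
    have "T Q f x = contour_integral (circlepath 0 ?\<rho>) (\<lambda>z. hill_res bc Q z f x)"
      unfolding T_def \<gamma>_def by (rule admissible_contour_integral[OF adm N Q _ small f]) blast
    moreover have "T (\<lambda>_. 0) f x = contour_integral (circlepath 0 ?\<rho>) (\<lambda>z. hill_res bc (\<lambda>_. 0) z f x)"
      unfolding T_def \<gamma>_def by (rule admissible_contour_integral[OF adm N Z _ _ f]) auto
    moreover have "norm (contour_integral (circlepath 0 ?\<rho>) (\<lambda>z. hill_res bc Q z f x)
        - contour_integral (circlepath 0 ?\<rho>) (\<lambda>z. hill_res bc (\<lambda>_. 0) z f x)) \<le> 2 * pi * (8 * K * e)"
      by (rule circle_difference_bound[OF N Q small f x \<open>e \<ge> 0\<close>]) (rule free)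
    ultimately have "norm (T Q f x - T (\<lambda>_. 0) f x) \<le> 2 * pi * (8 * K * e)"
      by simp
    then show ?thesis
      by (simp add: g_def norm_mult norm_divide field_simps)
  qed
  show ?thesis
  proof (rule Linf_norm_le)
    show "L1_extension ?D f \<in> borel_measurable leb"
      by (rule borel_measurable_AE_cong[OF AE gm[OF f]])
    have "AE x in leb. x \<in> {0..pi}" by (rule AE_I2) simp
    with AE show "AE x in leb. norm (L1_extension ?D f x) \<le> 8 * K * e"
      by eventually_elim (simp add: bound)
  qed
qed

text \<open>The first conjunct keeps the second from being vacuous. There \<open>\<omega>\<close>
  and \<open>h\<close> may vary with \<open>N\<close> in any admissible way, which the estimate on
  the circle allows since it involves neither.\<close>

theorem theorem10:
  fixes Q :: "real \<Rightarrow> complex" and bc :: bc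
  assumes "\<And>x. Q (x + pi) = Q x"
    and "bounded_variation_on 0 pi Q"
  shows "(\<forall>\<^sub>F N in sequentially. \<exists>\<omega> h. admissible bc Q N \<omega> h) \<and>
    (\<forall>\<omega> h :: nat \<Rightarrow> real. (\<forall>\<^sub>F N in sequentially. admissible bc Q N (\<omega> N) (h N)) \<longrightarrow>
      (\<forall>f\<in>L1.
        (\<lambda>N. Linf_norm (L1_extension (\<lambda>\<phi> x. spectral_sum bc Q N (\<omega> N) (h N) \<phi> x
                                         - spectral_sum bc (\<lambda>_. 0) N (\<omega> N) (h N) \<phi> x) f))
          \<longlonglongrightarrow> 0))"
proof (intro conjI allI impI ballI)
  obtain K where Q: "measure_potential Q K"
    using bounded_variation_measure_potential[OF assms(2)] .
  have K0: "K \<ge> 0" by (rule measure_potentialD(3)[OF Q])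
  show "\<forall>\<^sub>F N in sequentially. \<exists>\<omega> h. admissible bc Q N \<omega> h"
    using eventually_large[of "8 * K" 0]
    by eventually_elim (blast intro: admissible_exists[OF _ Q])
  fix \<omega> h :: "nat \<Rightarrow> real" and f
  assume adm: "\<forall>\<^sub>F N in sequentially. admissible bc Q N (\<omega> N) (h N)" and f: "f \<in> L1"
  let ?F = "\<lambda>N. Linf_norm (L1_extension (\<lambda>\<phi> x. spectral_sum bc Q N (\<omega> N) (h N) \<phi> x
                                         - spectral_sum bc (\<lambda>_. 0) N (\<omega> N) (h N) \<phi> x) f)"
  have small: "\<forall>\<^sub>F N in sequentially. ?F N \<le> ennreal \<eta>" if "\<eta> > 0" for \<eta>
  proof -
    \<comment> \<open>The denominator \<open>8 * K + 1\<close> is positive even for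
      \<open>K = 0\<close>. The threshold \<open>R\<close> obtained below depends on
      \<open>f\<close> and \<open>e\<close>, not on \<open>N\<close>.\<close>
    define e where "e = \<eta> / (8 * K + 1)"
    have e: "e > 0" using that K0 by (simp add: e_def)
    have le: "8 * K * e \<le> \<eta>"
    proof -
      have "8 * K * e \<le> (8 * K + 1) * e" using e by (intro mult_right_mono) auto
      also have "\<dots> = \<eta>" using K0 by (simp add: e_def)
      finally show ?thesis .
    qed
    obtain R where R: "\<And>N z y u x. N \<ge> 1 \<Longrightarrow> z \<in> outer_region N \<Longrightarrow> norm z \<ge> R \<Longrightarrow>
        hill_solution bc (\<lambda>_. 0) z f y u \<Longrightarrow> x \<in> {0..pi} \<Longrightarrow> norm (y x) \<le> e / sqrt (norm z)"
      using free_resolvent_Riemann_Lebesgue[OF f e, of bc] by metis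
    show ?thesis
      using adm eventually_large[of "8 * K" R]
    proof eventually_elim
      case (elim N)
      have "?F N \<le> ennreal (8 * K * e)"
      proof (rule Linf_norm_spectral_difference[OF elim(1) _ Q _ f])
        fix z y u t
        assume "z \<in> outer_region N" "norm z = real N ^ 2 + real N"
          "hill_solution bc (\<lambda>_. 0) z f y u" "t \<in> {0..pi}"
        then show "norm (y t) \<le> e / sqrt (norm z)"
          using elim(2) by (intro R) auto
      qed (use elim(2) e in auto)
      also have "\<dots> \<le> ennreal \<eta>" using le by (rule ennreal_leI)
      finally show ?case .
    qed
  qed
  show "?F \<longlonglongrightarrow> 0"
  proof (rule order_tendstoI)
    fix a :: ennreal assume "0 < a"
    \<comment> \<open>A value \<open>b\<close> strictly below \<open>a\<close> is finite even when
      \<open>a\<close> is infinite, hence of the form \<open>ennreal \<eta>\<close>.\<close>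
    then obtain b where b: "0 < b" "b < a"
      using dense by blast
    then obtain \<eta> where "b = ennreal \<eta>" "\<eta> > 0"
      by (cases b) (auto simp: top_unique)
    with b show "\<forall>\<^sub>F N in sequentially. ?F N < a"
      using small[of \<eta>] by (auto elim!: eventually_mono intro: le_less_trans)
  qed simp
qed

end
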